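(* Let $J$ and $\mathfrak a$ be as in the context. Let $u_0\in L^\infty(\mathbb R^N)$, $u_0\ge 0$, be such that $|x|^\alpha u_0(x)\to A$ as $|x|\to\infty$, with $A>0$ and $0<\alpha\le N$. Let $p>1+\frac{2}{\alpha}$, and let $u$ be the solution to $$u_t(x,t)=\int_{\mathbb R^N} J(x-y)\big(u(y,t)-u(x,t)\big)\,dy-u^p(x,t)\quad\text{in }\mathbb R^N\times(0,\infty),\qquad u(x,0)=u_0(x).$$ Then the following hold. (i) If $\alpha<N$, then for every $K>0$, $$t^{\alpha/2}\,\|u(\cdot,t)-U_{\alpha,A}(\cdot,t)\|_{L^\infty(\{|x|\le K\sqrt t\})}\to 0\quad\text{as } t\to\infty.$$ (ii) If $\alpha=N$, then for every $K>0$, $$t^{N/2}\,\Big\|\frac{u(\cdot,t)}{\log t}-C_{A,N}\,U_{\mathfrak a}(\cdot,t)\Big\|_{L^\infty(\{|x|\le K\sqrt t\})}\to 0\quad\text{as } t\to\infty,$$ where $C_{A,N}$ is a constant that depends only on $A$ and $N$ (not on $J$, $p$, $u_0$ or $K$).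
   Context: $J\in C_0^\infty(\mathbb R^N)$ (smooth with compact support) is radially symmetric, $J\ge0$, $\int_{\mathbb R^N} J=1$. The diffusivity associated with $J$ is $\mathfrak a=\frac{1}{2N}\int_{\mathbb R^N}|z|^2J(z)\,dz$. The solution $u$ is the unique nonnegative bounded solution: a bounded measurable function on $\mathbb R^N\times[0,\infty)$ that, for each $x$, is $C^1$ in $t$ and satisfies the equation and the initial condition. The conditions on $u_0$ are understood pointwise for $u_0$ as a bounded measurable function. $U_{\mathfrak a}(x,t)=(4\pi\mathfrak a t)^{-N/2}e^{-|x|^2/(4\mathfrak a t)}$ is the fundamental solution of the heat equation with diffusivity $\mathfrak a$. For $0<\alpha<N$, $U_{\alpha,A}$ is the solution of the heat equation $U_t=\mathfrak a\Delta U$ in $\mathbb R^N\times(0,\infty)$ with $U(x,0)=A|x|^{-\alpha}$, i.e. $U_{\alpha,A}(x,t)=\int_{\mathbb R^N}U_{\mathfrak a}(x-y,t)\,A|y|^{-\alpha}\,dy$. *)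

theory Defs
  imports "HOL-Probability.Essential_Supremum"
begin

text \<open>The space \<open>\<real>\<^sup>N\<close> is a type \<open>'a\<close> of class \<open>euclidean_space\<close>, with \<open>N = DIM('a)\<close>
  (the class guarantees \<open>N \<ge> 1\<close>).\<close>

text \<open>For a function that is differentiable everywhere, \<open>\<lambda>x. frechet_derivative f (at x) v\<close> is its
  directional derivative along \<open>v\<close>.\<close>

primrec Ck :: "nat \<Rightarrow> ('a::euclidean_space \<Rightarrow> real) \<Rightarrow> bool" where
  "Ck 0 f \<longleftrightarrow> continuous_on UNIV f"
| "Ck (Suc k) f \<longleftrightarrow>
     (\<forall>x. f differentiable (at x)) \<and> (\<forall>v. Ck k (\<lambda>x. frechet_derivative f (at x) v))"

definition smooth :: "('a::euclidean_space \<Rightarrow> real) \<Rightarrow> bool" where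
  "smooth f \<longleftrightarrow> (\<forall>k. Ck k f)"

definition radially_symmetric :: "('a::euclidean_space \<Rightarrow> real) \<Rightarrow> bool" where
  "radially_symmetric f \<longleftrightarrow> (\<forall>x y. norm x = norm y \<longrightarrow> f x = f y)"

definition dispersal_kernel :: "('a::euclidean_space \<Rightarrow> real) \<Rightarrow> bool" where
  "dispersal_kernel J \<longleftrightarrow>
     smooth J \<and> compact (closure (support_on UNIV J)) \<and> radially_symmetric J \<and>
     (\<forall>x. 0 \<le> J x) \<and> (\<integral>x. J x \<partial>lborel) = 1"

definition diffusivity :: "('a::euclidean_space \<Rightarrow> real) \<Rightarrow> real" where
  "diffusivity J = 1 / (2 * real DIM('a)) * (\<integral>z. (norm z)\<^sup>2 * J z \<partial>lborel)"

text \<open>Bounded functions are kept as genuine functions rather than classes modulo null sets;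
  measurable means Lebesgue measurable. The function \<open>u x\<close> of the time variable is only relevant
  on \<open>[0,\<infinity>)\<close>, so its \<open>C\<^sup>1\<close> regularity there is one-sided at \<open>0\<close>. Since \<open>u\<close> is
  nonnegative and \<open>0 powr p = 0\<close>, \<open>u x t powr p\<close> is the usual real power for \<open>p > 0\<close>.\<close>

definition nonlocal_solution ::
  "('a::euclidean_space \<Rightarrow> real) \<Rightarrow> real \<Rightarrow> ('a \<Rightarrow> real) \<Rightarrow> ('a \<Rightarrow> real \<Rightarrow> real) \<Rightarrow> bool" where
  "nonlocal_solution J p u0 u \<longleftrightarrow>
     (\<lambda>(x, t). u x t) \<in> borel_measurable (lebesgue_on (UNIV \<times> {0..})) \<and>
     bounded ((\<lambda>(x, t). u x t) ` (UNIV \<times> {0..})) \<and>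
     (\<forall>x. \<forall>t\<ge>0. 0 \<le> u x t) \<and>
     (\<forall>x. \<exists>v. continuous_on {0..} v \<and>
              (\<forall>t\<ge>0. (u x has_real_derivative v t) (at t within {0..}))) \<and>
     (\<forall>x. \<forall>t>0. (u x has_real_derivative
        (\<integral>y. J (x - y) * (u y t - u x t) \<partial>lebesgue) - u x t powr p) (at t)) \<and>
     (\<forall>x. u x 0 = u0 x)"

definition heat_kernel :: "real \<Rightarrow> 'a::euclidean_space \<Rightarrow> real \<Rightarrow> real" where
  "heat_kernel a x t =
     (4 * pi * a * t) powr (- (real DIM('a) / 2)) * exp (- ((norm x)\<^sup>2 / (4 * a * t)))"

text \<open>The value of the initial datum at the origin, here \<open>A * 0 powr (-\<alpha>) = 0\<close>, does not affect
  the integral.\<close>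

definition heat_power_solution ::
  "real \<Rightarrow> real \<Rightarrow> real \<Rightarrow> 'a::euclidean_space \<Rightarrow> real \<Rightarrow> real" where
  "heat_power_solution a \<alpha> A x t =
     (\<integral>y. heat_kernel a (x - y) t * (A * norm y powr (- \<alpha>)) \<partial>lborel)"

text \<open>The value is \<open>\<infinity>\<close> if \<open>f\<close> is essentially unbounded or not measurable on \<open>S\<close>.\<close>

definition Linfty_norm :: "'a::euclidean_space set \<Rightarrow> ('a \<Rightarrow> real) \<Rightarrow> ereal" where
  "Linfty_norm S f = esssup (lebesgue_on S) (\<lambda>x. ereal \<bar>f x\<bar>)"

end

theory Submission
  imports Defs "HOL-Probability.Distributions"
begin

text \<open>Write \<open>N\<close> for the dimension, \<open>a\<close> for the diffusivity of \<open>J\<close>, \<open>G(x, t)\<close> for the heat kernel with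
  diffusivity \<open>a\<close>, and \<open>L v = J * v - v\<close> for the nonlocal diffusion operator. The proof compares \<open>u\<close>
  with the superpositions of heat kernels

    \<open>V\<^sub>k(x, t) = \<integral> r\<^sup>k G(x, t + r) dr\<close>, the integral being over \<open>r \<ge> 1\<close> (\<open>heat_mixture\<close>).

  They solve the heat equation, and for \<open>k = (N - \<alpha>)/2 - 1\<close> the scaling of \<open>G\<close> shows that \<open>V\<^sub>k(x, 0)\<close>
  is asymptotic to \<open>c |x|\<^sup>-\<^sup>\<alpha>\<close> at infinity, where \<open>c\<close> is the number \<open>riesz_const\<close>. Both limit profiles
  are hidden in \<open>V\<^sub>k\<close>. If \<open>\<alpha> < N\<close>, the same integral over all \<open>r > 0\<close> is the heat evolution of
  \<open>c |x|\<^sup>-\<^sup>\<alpha>\<close>, and the missing part \<open>r < 1\<close> is only \<open>O(t\<^bsup>-N/2\<^esup>)\<close>. If \<open>\<alpha> = N\<close>, then \<open>k = -1\<close>, and the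
  part \<open>1 \<le> r \<le> t\<close> contributes \<open>ln t \<cdot> G(x, t)\<close> up to \<open>O(t\<^bsup>-N/2\<^esup>)\<close>; here \<open>c\<close> does not depend on \<open>a\<close>,
  which is why \<open>C\<^sub>A\<^sub>,\<^sub>N = A / c\<close> does not depend on \<open>J\<close>. So it suffices to compare \<open>u\<close> with \<open>(A / c) V\<^sub>k\<close>.

  Since \<open>J\<close> is radial, \<open>L\<close> agrees with \<open>a \<Delta>\<close> on polynomials of degree at most three, and a Taylor
  expansion gives
  \<open>|L G - \<partial>\<^sub>t G| \<le> C (t + |x|\<^sup>2)\<^bsup>-N/2 - 3/2\<^esup>\<close> for \<open>t \<ge> 1\<close> (\<open>heat_kernel_consistency\<close>). Integrated against
  \<open>r\<^sup>k\<close>, this is at most \<open>C (1 + t)\<^bsup>-1-\<delta>\<^esup> V\<^bsub>k-\<kappa>\<^esub>\<close>: a faster decaying superposition with a factor that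
  is integrable in time (\<open>consistency_absorbed\<close>). The absorption term is of the same kind: once
  \<open>u \<le> C V\<^sub>k\<close> is known, \<open>p > 1 + 2/\<alpha>\<close> yields \<open>u\<^sup>p \<le> C (1 + t)\<^bsup>-1-\<delta>\<^esup> V\<^bsub>k-\<kappa>\<^esub>\<close>. Hence
  \<open>(A/c \<plusminus> \<epsilon>) V\<^sub>k \<plusminus> b(t) V\<^bsub>k-\<kappa>\<^esub>\<close>, with a suitable bounded increasing \<open>b\<close>, are a super- and a subsolution
  that lie above and below \<open>u\<close> at time \<open>0\<close>. The comparison principle, in the form \<open>mixture_barrier\<close>, therefore gives,
  for every \<open>\<epsilon> > 0\<close> and with some \<open>B\<close> depending on \<open>\<epsilon>\<close>,

    \<open>|u - (A / c) V\<^sub>k| \<le> \<epsilon> V\<^sub>k + B V\<^bsub>k-\<kappa>\<^esub>\<close> for all \<open>x\<close> and all \<open>t \<ge> 0\<close> (\<open>solution_sandwich\<close>).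

  After multiplication by \<open>t\<^bsup>\<alpha>/2\<^esup>\<close>, or by \<open>t\<^bsup>N/2\<^esup> / ln t\<close> if \<open>\<alpha> = N\<close>, the first term on the right stays
  below a multiple of \<open>\<epsilon>\<close> and the second one tends to \<open>0\<close>, uniformly in \<open>x\<close>.\<close>

section \<open>A comparison principle for nonlocal diffusion\<close>

definition nonlocal_op :: "('a::euclidean_space \<Rightarrow> real) \<Rightarrow> ('a \<Rightarrow> real) \<Rightarrow> 'a \<Rightarrow> real" where
  "nonlocal_op J f x = (\<integral>y. J (x - y) * (f y - f x) \<partial>lebesgue)"

lemma integral_lborel_reflect_shift:
  fixes g :: "'a::euclidean_space \<Rightarrow> real"
  assumes [measurable]: "g \<in> borel_measurable borel"
  shows "(\<integral>y. g (x - y) \<partial>lborel) = (\<integral>z. g z \<partial>lborel)"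
    and "integrable lborel (\<lambda>y. g (x - y)) \<longleftrightarrow> integrable lborel g"
proof -
  have lb: "(lborel :: 'a measure) = distr lborel borel (\<lambda>y. x - y)"
    using lborel_affine[of "-1" x] by (simp add: density_1)
  show "(\<integral>y. g (x - y) \<partial>lborel) = (\<integral>z. g z \<partial>lborel)"
    by (subst (2) lb) (simp add: integral_distr)
  show "integrable lborel (\<lambda>y. g (x - y)) \<longleftrightarrow> integrable lborel g"
    by (subst (2) lb) (simp add: integrable_distr_eq)
qed

locale probability_kernel =
  fixes J :: "'a::euclidean_space \<Rightarrow> real"
  assumes J_measurable [measurable]: "J \<in> borel_measurable borel"
    and J_nonneg: "\<And>x. 0 \<le> J x"
    and J_integrable: "integrable lborel J"
    and J_integral: "(\<integral>x. J x \<partial>lborel) = 1"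
begin

lemma integrable_J_shift: "integrable lebesgue (\<lambda>y. J (x - y))"
  using J_integrable integral_lborel_reflect_shift(2)[OF J_measurable, of x]
  by (subst integrable_completion) auto

lemma integral_J_shift: "(\<integral>y. J (x - y) \<partial>lebesgue) = 1"
  using J_integral integral_lborel_reflect_shift(1)[OF J_measurable, of x]
  by (subst integral_completion) auto

lemma integrable_J_mult:
  assumes "f \<in> borel_measurable lebesgue" "\<And>y. \<bar>f y\<bar> \<le> B"
  shows "integrable lebesgue (\<lambda>y. J (x - y) * f y)"
proof (rule Bochner_Integration.integrable_bound)
  show "integrable lebesgue (\<lambda>y. B * J (x - y))"
    using integrable_J_shift by simp
  have "(\<lambda>y. J (x - y)) \<in> borel_measurable lebesgue"
    using integrable_J_shift by (rule borel_measurable_integrable)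
  then show "(\<lambda>y. J (x - y) * f y) \<in> borel_measurable lebesgue"
    using assms(1) by (rule borel_measurable_times)
  have "0 \<le> B" using assms(2)[of undefined] by linarith
  show "AE y in lebesgue. norm (J (x - y) * f y) \<le> norm (B * J (x - y))"
  proof (rule AE_I2)
    fix y
    have "\<bar>f y\<bar> * J (x - y) \<le> B * J (x - y)"
      using assms(2) J_nonneg by (rule mult_right_mono)
    then show "norm (J (x - y) * f y) \<le> norm (B * J (x - y))"
      using J_nonneg[of "x - y"] \<open>0 \<le> B\<close> by (simp add: abs_mult mult.commute)
  qed
qed

lemma nonlocal_op_eq:
  assumes "f \<in> borel_measurable lebesgue" "\<And>y. \<bar>f y\<bar> \<le> B"
  shows "nonlocal_op J f x = (\<integral>y. J (x - y) * f y \<partial>lebesgue) - f x"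
  using integrable_J_mult[OF assms, of x] integrable_J_shift[of x]
  by (simp add: nonlocal_op_def right_diff_distrib integral_J_shift)

lemma nonlocal_op_lincomb:
  assumes f: "f \<in> borel_measurable lebesgue" "\<And>y. \<bar>f y\<bar> \<le> F"
    and g: "g \<in> borel_measurable lebesgue" "\<And>y. \<bar>g y\<bar> \<le> G"
    and h: "h \<in> borel_measurable lebesgue" "\<And>y. \<bar>h y\<bar> \<le> H"
  shows "nonlocal_op J (\<lambda>y. f y - (c * g y + d * h y)) x
    = nonlocal_op J f x - (c * nonlocal_op J g x + d * nonlocal_op J h x)"
proof -
  have bd: "\<bar>f y - (c * g y + d * h y)\<bar> \<le> F + (\<bar>c\<bar> * G + \<bar>d\<bar> * H)" for y
  proof -
    have "\<bar>f y - (c * g y + d * h y)\<bar> \<le> \<bar>f y\<bar> + (\<bar>c * g y\<bar> + \<bar>d * h y\<bar>)" by linarith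
    also have "\<dots> \<le> F + (\<bar>c\<bar> * G + \<bar>d\<bar> * H)"
      unfolding abs_mult using f(2) g(2) h(2) by (intro add_mono mult_left_mono) auto
    finally show ?thesis .
  qed
  have m: "(\<lambda>y. f y - (c * g y + d * h y)) \<in> borel_measurable lebesgue"
    using f(1) g(1) h(1) by measurable
  have "(\<integral>y. J (x - y) * (f y - (c * g y + d * h y)) \<partial>lebesgue)
      = (\<integral>y. J (x - y) * f y - (c * (J (x - y) * g y) + d * (J (x - y) * h y)) \<partial>lebesgue)"
    by (simp add: algebra_simps)
  also have "\<dots> = (\<integral>y. J (x - y) * f y \<partial>lebesgue)
      - (c * (\<integral>y. J (x - y) * g y \<partial>lebesgue) + d * (\<integral>y. J (x - y) * h y \<partial>lebesgue))"
    using integrable_J_mult[OF f] integrable_J_mult[OF g] integrable_J_mult[OF h] by simp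
  finally show ?thesis
    unfolding nonlocal_op_eq[OF m bd] nonlocal_op_eq[OF f] nonlocal_op_eq[OF g] nonlocal_op_eq[OF h]
    by (simp add: algebra_simps)
qed

text \<open>For bounded functions on the whole space a maximum principle cannot pick a point where a maximum is
  attained. Instead, \<open>exp t \<cdot> w\<close> has a time derivative bounded by \<open>J * (exp t \<cdot> w)\<close>, so a bound
  \<open>exp t \<cdot> w \<le> C\<close> improves by integration in time to \<open>C t\<close>, to \<open>C t\<^sup>2 / 2\<close>, and so on;
  the bounds \<open>C t\<^sup>n / n!\<close> tend to \<open>0\<close>.\<close>

theorem nonlocal_comparison:
  fixes w w' :: "'a \<Rightarrow> real \<Rightarrow> real"
  assumes meas: "\<And>t. 0 \<le> t \<Longrightarrow> (\<lambda>x. w x t) \<in> borel_measurable lebesgue"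
    and bdd: "\<And>x t. 0 \<le> t \<Longrightarrow> \<bar>w x t\<bar> \<le> B"
    and cont: "\<And>x. continuous_on {0..} (w x)"
    and deriv: "\<And>x t. 0 < t \<Longrightarrow> (w x has_real_derivative w' x t) (at t)"
    and sub: "\<And>x t. 0 < t \<Longrightarrow> w' x t \<le> nonlocal_op J (\<lambda>y. w y t) x"
    and init: "\<And>x. w x 0 \<le> 0"
    and "0 \<le> t"
  shows "w x t \<le> 0"
proof -
  have B: "0 \<le> B" using bdd[of 0 undefined] by linarith
  define C where "C = exp t * B"
  have iter: "exp s * w x s \<le> C * s ^ n / fact n" if "0 \<le> s" "s \<le> t" for n s x
    using that
  proof (induction n arbitrary: s x)
    case 0
    have "w x s \<le> B" using bdd[of s x] 0 by linarith
    then have "exp s * w x s \<le> exp s * B" by simp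
    also have "\<dots> \<le> exp t * B"
      using 0 B by (intro mult_right_mono) auto
    finally show ?case by (simp add: C_def)
  next
    case (Suc n)
    define h where "h r = exp r * w x r - C * r ^ Suc n / fact (Suc n)" for r
    have "h s \<le> h 0"
    proof (cases "s = 0")
      case False
      then have s: "0 < s" using Suc.prems by simp
      show ?thesis
      proof (rule DERIV_nonpos_imp_decreasing_open[OF less_imp_le[OF s]])
        show "continuous_on {0..s} h"
          unfolding h_def
          by (intro continuous_intros continuous_on_subset[OF cont]) auto
        fix r assume r: "0 < r" "r < s"
        let ?D = "exp r * w x r + exp r * w' x r - C * r ^ n / fact n"
        have "C / fact (Suc n) * (real (Suc n) * r ^ (Suc n - Suc 0)) = C / fact n * r ^ n"
          by (simp del: of_nat_Suc)
        then have "((\<lambda>r. C / fact (Suc n) * r ^ Suc n) has_real_derivative C / fact n * r ^ n) (at r)"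
          using DERIV_cmult[OF DERIV_pow[of "Suc n" r], of "C / fact (Suc n)"] by metis
        from DERIV_diff[OF DERIV_mult[OF DERIV_exp deriv[OF r(1), of x]] this]
        have D: "(h has_real_derivative ?D) (at r)"
          unfolding h_def by (simp add: mult.commute)
        have bd: "\<bar>w y r\<bar> \<le> B" for y using bdd r by simp
        have m: "(\<lambda>y. w y r) \<in> borel_measurable lebesgue" using meas r by simp
        have "exp r * (w x r + w' x r) \<le> exp r * (\<integral>y. J (x - y) * w y r \<partial>lebesgue)"
          using sub[OF r(1), of x] nonlocal_op_eq[OF m bd, of x] by simp
        also have "\<dots> = (\<integral>y. J (x - y) * (exp r * w y r) \<partial>lebesgue)"
          by (simp add: mult.left_commute)
        also have "\<dots> \<le> (\<integral>y. J (x - y) * (C * r ^ n / fact n) \<partial>lebesgue)"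
        proof (rule integral_mono)
          show "integrable lebesgue (\<lambda>y. J (x - y) * (exp r * w y r))"
            using integrable_mult_right[OF integrable_J_mult[OF m bd, of x], of "exp r"]
            by (simp add: mult.left_commute)
          show "integrable lebesgue (\<lambda>y. J (x - y) * (C * r ^ n / fact n))"
            using integrable_J_shift[of x] by simp
          show "J (x - y) * (exp r * w y r) \<le> J (x - y) * (C * r ^ n / fact n)" for y
            using Suc.IH[of r y] r Suc.prems by (intro mult_left_mono J_nonneg) auto
        qed
        also have "\<dots> = C * r ^ n / fact n"
          using integral_J_shift[of x] by simp
        finally have "?D \<le> 0" by (simp add: algebra_simps)
        with D show "\<exists>y. (h has_real_derivative y) (at r) \<and> y \<le> 0" by blast
      qed
    qed simp
    also have "h 0 \<le> 0" using init by (simp add: h_def)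
    finally show ?case by (simp add: h_def)
  qed
  have "(\<lambda>n. C * (t ^ n /\<^sub>R fact n)) \<longlonglongrightarrow> C * 0"
    by (intro tendsto_intros summable_LIMSEQ_zero summable_exp_generic)
  moreover have "exp t * w x t \<le> C * (t ^ n /\<^sub>R fact n)" for n
    using iter[of t x n] \<open>0 \<le> t\<close> by (simp add: field_simps)
  ultimately have "exp t * w x t \<le> 0"
    by (intro LIMSEQ_le_const[of "\<lambda>n. C * (t ^ n /\<^sub>R fact n)"]) auto
  then show ?thesis by (simp add: mult_le_0_iff)
qed

end

section \<open>Second moments of a radial kernel\<close>

lemma norm_sq_Basis: "(norm z)\<^sup>2 = (\<Sum>b\<in>Basis. (z \<bullet> b)\<^sup>2)"
  by (subst power2_norm_eq_inner, subst euclidean_inner) (simp add: power2_eq_square)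

text \<open>Exchanging two coordinates and changing the sign of one of them preserve both Lebesgue measure and
  the norm, hence every radial kernel. Isometries of these two kinds
  already determine the second moments.\<close>

definition swap_coords :: "'a::euclidean_space \<Rightarrow> 'a \<Rightarrow> 'a \<Rightarrow> 'a" where
  "swap_coords i j z = (\<Sum>b\<in>Basis. (z \<bullet> Transposition.transpose i j b) *\<^sub>R b)"

lemma swap_coords_inner:
  "b \<in> Basis \<Longrightarrow> swap_coords i j z \<bullet> b = z \<bullet> Transposition.transpose i j b"
  by (simp add: swap_coords_def inner_sum_left inner_Basis if_distrib cong: if_cong)

lemma transpose_Basis: 
  assumes "i \<in> Basis" "j \<in> Basis"
  shows "bij_betw (Transposition.transpose i j) Basis Basis"
  using assms by (intro bij_betwI[where g = "Transposition.transpose i j"])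
    (auto simp: Transposition.transpose_def)

lemma norm_swap_coords:
  assumes "i \<in> Basis" "j \<in> Basis"
  shows "norm (swap_coords i j z) = norm z"
proof -
  have "(\<Sum>b\<in>Basis. (z \<bullet> Transposition.transpose i j b)\<^sup>2) = (\<Sum>b\<in>Basis. (z \<bullet> b)\<^sup>2)"
    by (rule sum.reindex_bij_betw[OF transpose_Basis[OF assms]])
  then show ?thesis
    unfolding norm_eq_sqrt_inner
    by (subst (1 2) euclidean_inner) (simp add: swap_coords_inner power2_eq_square)
qed

lemma lborel_distr_swap_coords:
  assumes ij: "i \<in> Basis" "j \<in> Basis"
  shows "distr lborel borel (swap_coords i j) = (lborel :: 'a::euclidean_space measure)"
proof (rule lborel_eqI[symmetric])
  let ?p = "Transposition.transpose i j"
  note bij = transpose_Basis[OF ij]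
  have [measurable]: "swap_coords i j \<in> borel_measurable (borel :: 'a measure)"
    unfolding swap_coords_def by measurable
  fix l u :: 'a assume le: "\<And>b. b \<in> Basis \<Longrightarrow> l \<bullet> b \<le> u \<bullet> b"
  have pB: "?p b \<in> Basis" if "b \<in> Basis" for b
    using bij that by (auto simp: bij_betw_def)
  have pp: "?p (?p b) = b" for b by simp
  have "swap_coords i j -` box l u = box (swap_coords i j l) (swap_coords i j u)"
  proof (intro set_eqI)
    fix z
    have "z \<in> swap_coords i j -` box l u \<longleftrightarrow> (\<forall>b\<in>Basis. l \<bullet> b < z \<bullet> ?p b \<and> z \<bullet> ?p b < u \<bullet> b)"
      by (simp add: mem_box swap_coords_inner)
    also have "\<dots> \<longleftrightarrow> (\<forall>b\<in>Basis. l \<bullet> ?p b < z \<bullet> b \<and> z \<bullet> b < u \<bullet> ?p b)"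
      using pB pp by metis
    also have "\<dots> \<longleftrightarrow> z \<in> box (swap_coords i j l) (swap_coords i j u)"
      by (simp add: mem_box swap_coords_inner)
    finally show "z \<in> swap_coords i j -` box l u \<longleftrightarrow> z \<in> box (swap_coords i j l) (swap_coords i j u)" .
  qed
  then have "emeasure (distr lborel borel (swap_coords i j)) (box l u)
      = emeasure lborel (box (swap_coords i j l) (swap_coords i j u))"
    by (subst emeasure_distr) auto
  also have "\<dots> = (\<Prod>b\<in>Basis. (swap_coords i j u - swap_coords i j l) \<bullet> b)"
    using le pB by (intro emeasure_lborel_box) (simp add: swap_coords_inner)
  also have "(\<Prod>b\<in>Basis. (swap_coords i j u - swap_coords i j l) \<bullet> b)
      = (\<Prod>b\<in>Basis. (u - l) \<bullet> ?p b)"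
    by (intro prod.cong refl) (simp add: inner_diff_left swap_coords_inner)
  also have "\<dots> = (\<Prod>b\<in>Basis. (u - l) \<bullet> b)"
    by (rule prod.reindex_bij_betw[OF bij])
  finally show "emeasure (distr lborel borel (swap_coords i j)) (box l u) = (\<Prod>b\<in>Basis. (u - l) \<bullet> b)" .
qed simp

definition flip_coord :: "'a::euclidean_space \<Rightarrow> 'a \<Rightarrow> 'a" where
  "flip_coord i z = (\<Sum>b\<in>Basis. ((if b = i then -1 else 1) * (z \<bullet> b)) *\<^sub>R b)"

lemma flip_coord_inner:
  "b \<in> Basis \<Longrightarrow> flip_coord i z \<bullet> b = (if b = i then -1 else 1) * (z \<bullet> b)"
  by (simp add: flip_coord_def inner_sum_left inner_Basis if_distrib cong: if_cong)

lemma norm_flip_coord: "norm (flip_coord i z) = norm z"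
  unfolding norm_eq_sqrt_inner
  by (subst (1 2) euclidean_inner) (auto simp: flip_coord_inner intro!: sum.cong)

lemma lborel_distr_flip_coord:
  "distr lborel borel (flip_coord i) = (lborel :: 'a::euclidean_space measure)"
proof -
  have "lborel = density (distr lborel borel (\<lambda>x::'a. 0 + (\<Sum>j\<in>Basis. ((if j = i then -1 else 1) * (x \<bullet> j)) *\<^sub>R j)))
      (\<lambda>_. (\<Prod>j\<in>Basis. \<bar>if j = i then -1 else (1::real)\<bar>))"
    by (rule lborel_affine_euclidean) auto
  moreover have "(\<Prod>j\<in>(Basis::'a set). \<bar>if j = i then -1 else (1::real)\<bar>) = 1"
    by (intro prod.neutral) auto
  ultimately show ?thesis
    by (simp add: density_1 flip_coord_def[abs_def])
qed

locale dispersal =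
  fixes J :: "'a::euclidean_space \<Rightarrow> real"
  assumes kernel: "dispersal_kernel J"
begin

lemma continuous_J: "continuous_on UNIV J"
proof -
  have "Ck 0 J" using kernel unfolding dispersal_kernel_def smooth_def by blast
  then show ?thesis by simp
qed

lemma J_zero_outside: "\<exists>\<rho>>0. \<forall>z. \<rho> < norm z \<longrightarrow> J z = 0"
proof -
  have "bounded (closure (support_on UNIV J))"
    using kernel unfolding dispersal_kernel_def by (blast intro: compact_imp_bounded)
  then obtain b where b: "0 < b" "\<And>z. z \<in> closure (support_on UNIV J) \<Longrightarrow> norm z \<le> b"
    by (auto simp: bounded_pos)
  have "J z = 0" if "b < norm z" for z
  proof (rule ccontr)
    assume "J z \<noteq> 0"
    then have "z \<in> support_on UNIV J" by (simp add: support_on_def)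
    then have "z \<in> closure (support_on UNIV J)" using closure_subset by (rule subsetD[rotated])
    then show False using b(2)[of z] that by simp
  qed
  with b(1) show ?thesis by blast
qed

lemma J_sym: "norm x = norm y \<Longrightarrow> J x = J y"
  using kernel unfolding dispersal_kernel_def radially_symmetric_def by blast

sublocale probability_kernel J
proof
  show m: "J \<in> borel_measurable borel"
    using continuous_J by (rule borel_measurable_continuous_onI)
  show "0 \<le> J x" for x
    using kernel unfolding dispersal_kernel_def by blast
  show i: "(\<integral>x. J x \<partial>lborel) = 1"
    using kernel unfolding dispersal_kernel_def by blast
  show "integrable lborel J"
    using i not_integrable_integral_eq by fastforce
qed

lemma integrable_J_times:
  assumes g: "continuous_on UNIV g"
  shows "integrable lborel (\<lambda>z. J z * g z)"
proof -
  obtain \<rho> where \<rho>: "0 < \<rho>" "\<And>z. \<rho> < norm z \<Longrightarrow> J z = 0"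
    using J_zero_outside by blast
  have "compact (g ` cball 0 \<rho>)"
    by (intro compact_continuous_image continuous_on_subset[OF g]) auto
  then obtain B where "\<forall>y\<in>g ` cball 0 \<rho>. norm y \<le> B"
    using compact_imp_bounded bounded_iff by metis
  then have B: "\<And>z. norm z \<le> \<rho> \<Longrightarrow> \<bar>g z\<bar> \<le> B" by simp
  have [measurable]: "g \<in> borel_measurable borel"
    using g by (rule borel_measurable_continuous_onI)
  show ?thesis
  proof (rule Bochner_Integration.integrable_bound[where f = "\<lambda>z. B * J z"])
    show "integrable lborel (\<lambda>z. B * J z)" using J_integrable by simp
    show "AE z in lborel. norm (J z * g z) \<le> norm (B * J z)"
    proof (rule AE_I2)
      fix z show "norm (J z * g z) \<le> norm (B * J z)"
      proof (cases "norm z \<le> \<rho>")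
        case True
        have "\<bar>g z\<bar> * J z \<le> \<bar>B\<bar> * J z"
          using B[OF True] J_nonneg by (intro mult_right_mono) auto
        then show ?thesis using J_nonneg[of z] by (simp add: abs_mult mult.commute)
      qed (simp add: \<rho>)
    qed
  qed simp
qed

lemma integral_J_odd:
  assumes g: "continuous_on UNIV g" and odd: "\<And>z. g (- z) = - g z"
  shows "(\<integral>z. J z * g z \<partial>lborel) = 0"
proof -
  have [measurable]: "g \<in> borel_measurable borel"
    using g by (rule borel_measurable_continuous_onI)
  have "(\<integral>z. J z * g z \<partial>lborel) = (\<integral>z. J (0 - z) * g (0 - z) \<partial>lborel)"
    by (rule integral_lborel_reflect_shift(1)[symmetric]) measurable
  also have "\<dots> = (\<integral>z. - (J z * g z) \<partial>lborel)"
  proof (rule Bochner_Integration.integral_cong[OF refl])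
    fix z show "J (0 - z) * g (0 - z) = - (J z * g z)"
      using J_sym[of "- z" z] odd by simp
  qed
  also have "\<dots> = - (\<integral>z. J z * g z \<partial>lborel)" by simp
  finally show ?thesis by simp
qed

lemma integral_J_coords:
  assumes ij: "i \<in> Basis" "j \<in> Basis"
  shows "(\<integral>z. J z * ((z \<bullet> i) * (z \<bullet> j)) \<partial>lborel) = (if i = j then 2 * diffusivity J else 0)"
proof (cases "i = j")
  case False
  have [measurable]: "flip_coord i \<in> borel_measurable (borel :: 'a measure)"
    unfolding flip_coord_def by measurable
  have "(\<integral>z. J z * ((z \<bullet> i) * (z \<bullet> j)) \<partial>lborel)
      = (\<integral>z. J z * ((z \<bullet> i) * (z \<bullet> j)) \<partial>distr lborel borel (flip_coord i))"
    by (simp add: lborel_distr_flip_coord)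
  also have "\<dots> = (\<integral>z. J (flip_coord i z) * ((flip_coord i z \<bullet> i) * (flip_coord i z \<bullet> j)) \<partial>lborel)"
    by (subst integral_distr) measurable
  also have "\<dots> = (\<integral>z. - (J z * ((z \<bullet> i) * (z \<bullet> j))) \<partial>lborel)"
    using False ij by (intro Bochner_Integration.integral_cong[OF refl])
      (simp add: flip_coord_inner J_sym[OF norm_flip_coord])
  also have "\<dots> = - (\<integral>z. J z * ((z \<bullet> i) * (z \<bullet> j)) \<partial>lborel)" by simp
  finally show ?thesis using False by simp
next
  case True
  have eq: "(\<integral>z. J z * (z \<bullet> b)\<^sup>2 \<partial>lborel) = (\<integral>z. J z * (z \<bullet> i)\<^sup>2 \<partial>lborel)" if b: "b \<in> Basis" for b
  proof -
    have [measurable]: "swap_coords i b \<in> borel_measurable (borel :: 'a measure)"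
      unfolding swap_coords_def by measurable
    have "(\<integral>z. J z * (z \<bullet> b)\<^sup>2 \<partial>lborel)
        = (\<integral>z. J z * (z \<bullet> b)\<^sup>2 \<partial>distr lborel borel (swap_coords i b))"
      using ij b by (simp add: lborel_distr_swap_coords)
    also have "\<dots> = (\<integral>z. J (swap_coords i b z) * (swap_coords i b z \<bullet> b)\<^sup>2 \<partial>lborel)"
      by (subst integral_distr) measurable
    also have "\<dots> = (\<integral>z. J z * (z \<bullet> i)\<^sup>2 \<partial>lborel)"
      using ij b by (intro Bochner_Integration.integral_cong[OF refl])
        (simp add: swap_coords_inner J_sym[OF norm_swap_coords])
    finally show ?thesis .
  qed
  have "(\<integral>z. (norm z)\<^sup>2 * J z \<partial>lborel) = (\<integral>z. (\<Sum>b\<in>Basis. J z * (z \<bullet> b)\<^sup>2) \<partial>lborel)"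
    by (simp add: norm_sq_Basis sum_distrib_left mult.commute)
  also have "\<dots> = (\<Sum>b\<in>Basis. \<integral>z. J z * (z \<bullet> b)\<^sup>2 \<partial>lborel)"
    by (intro Bochner_Integration.integral_sum integrable_J_times continuous_intros)
  also have "\<dots> = (\<Sum>b\<in>(Basis::'a set). \<integral>z. J z * (z \<bullet> i)\<^sup>2 \<partial>lborel)"
    using eq by (intro sum.cong refl) auto
  also have "\<dots> = real DIM('a) * (\<integral>z. J z * (z \<bullet> i)\<^sup>2 \<partial>lborel)" by simp
  finally show ?thesis
    using True by (simp add: diffusivity_def power2_eq_square)
qed

text \<open>The definition of the diffusivity is made for this identity: the second moments of \<open>J\<close> are
  those of the heat kernel at time \<open>1\<close>, so \<open>J * v - v\<close> is close to \<open>a \<Delta> v\<close> for slowly varying \<open>v\<close>.\<close>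

lemma second_moment:
  "(\<integral>z. J z * (x \<bullet> z)\<^sup>2 \<partial>lborel) = 2 * diffusivity J * (norm x)\<^sup>2"
proof -
  have int: "integrable lborel (\<lambda>z. ((x \<bullet> i) * (x \<bullet> j)) * (J z * ((z \<bullet> i) * (z \<bullet> j))))" for i j
    by (intro integrable_mult_right integrable_J_times continuous_intros)
  have "(\<integral>z. J z * (x \<bullet> z)\<^sup>2 \<partial>lborel)
      = (\<integral>z. (\<Sum>i\<in>Basis. \<Sum>j\<in>Basis. ((x \<bullet> i) * (x \<bullet> j)) * (J z * ((z \<bullet> i) * (z \<bullet> j)))) \<partial>lborel)"
  proof (rule Bochner_Integration.integral_cong[OF refl])
    fix z
    have "(x \<bullet> z)\<^sup>2 = (\<Sum>i\<in>Basis. \<Sum>j\<in>Basis. ((x \<bullet> i) * (z \<bullet> i)) * ((x \<bullet> j) * (z \<bullet> j)))"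
      by (simp only: power2_eq_square euclidean_inner[of x z] sum_product)
    then show "J z * (x \<bullet> z)\<^sup>2
        = (\<Sum>i\<in>Basis. \<Sum>j\<in>Basis. ((x \<bullet> i) * (x \<bullet> j)) * (J z * ((z \<bullet> i) * (z \<bullet> j))))"
      by (simp only: sum_distrib_left) (simp only: mult_ac)
  qed
  also have "\<dots> = (\<Sum>i\<in>Basis. \<integral>z. (\<Sum>j\<in>Basis. ((x \<bullet> i) * (x \<bullet> j)) * (J z * ((z \<bullet> i) * (z \<bullet> j)))) \<partial>lborel)"
    by (intro Bochner_Integration.integral_sum Bochner_Integration.integrable_sum int)
  also have "\<dots> = (\<Sum>i\<in>Basis. \<Sum>j\<in>Basis. \<integral>z. ((x \<bullet> i) * (x \<bullet> j)) * (J z * ((z \<bullet> i) * (z \<bullet> j))) \<partial>lborel)"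
    by (intro sum.cong refl Bochner_Integration.integral_sum int)
  also have "\<dots> = (\<Sum>i\<in>Basis. \<Sum>j\<in>Basis. ((x \<bullet> i) * (x \<bullet> j)) * (\<integral>z. J z * ((z \<bullet> i) * (z \<bullet> j)) \<partial>lborel))"
    by simp
  also have "\<dots> = (\<Sum>i\<in>Basis. \<Sum>j\<in>Basis. if i = j then (x \<bullet> i)\<^sup>2 * (2 * diffusivity J) else 0)"
    by (intro sum.cong refl) (simp add: integral_J_coords power2_eq_square)
  also have "\<dots> = (\<Sum>i\<in>Basis. (x \<bullet> i)\<^sup>2 * (2 * diffusivity J))"
    by simp
  also have "\<dots> = 2 * diffusivity J * (norm x)\<^sup>2"
    by (simp add: norm_sq_Basis[of x] sum_distrib_left mult.commute)
  finally show ?thesis .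
qed

lemma norm_moment: "(\<integral>z. J z * (norm z)\<^sup>2 \<partial>lborel) = 2 * real DIM('a) * diffusivity J"
  by (simp add: diffusivity_def mult.commute)

lemma diffusivity_pos: "0 < diffusivity J"
proof -
  have int: "integrable lborel (\<lambda>z. J z * (norm z)\<^sup>2)"
    by (intro integrable_J_times continuous_intros)
  have "0 \<le> (\<integral>z. J z * (norm z)\<^sup>2 \<partial>lborel)"
    using J_nonneg by simp
  moreover have "(\<integral>z. J z * (norm z)\<^sup>2 \<partial>lborel) \<noteq> 0"
  proof
    assume "(\<integral>z. J z * (norm z)\<^sup>2 \<partial>lborel) = 0"
    then have "AE z in lborel. J z * (norm z)\<^sup>2 = 0"
      using integral_nonneg_eq_0_iff_AE[OF int] J_nonneg by simp
    then have "AE z in lborel. J z = 0"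
      using AE_lborel_singleton[of 0] by eventually_elim auto
    then have "(\<integral>z. J z \<partial>lborel) = integral\<^sup>L lborel (\<lambda>z::'a. 0)"
      by (intro integral_cong_AE) auto
    then show False using J_integral by simp
  qed
  ultimately show ?thesis
    unfolding norm_moment using DIM_positive[where 'a='a]
    by (simp add: zero_le_mult_iff)
qed

end

section \<open>The heat kernel as an approximate nonlocal solution\<close>

text \<open>The explicit bound comes from \<open>1 + s \<le> exp s\<close>, which turns every factor into an exponential of a
  quadratic polynomial in \<open>s\<close>, whose maximum is then read off.\<close>

lemma gaussian_beats_powers:
  fixes c D M s :: real
  assumes "0 < c" "0 \<le> M" "0 \<le> s"
  shows "(1 + s) ^ 3 * exp (D * (1 + s)) * exp (- c * s\<^sup>2) * (1 + s\<^sup>2) powr M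
    \<le> exp (D + (D + 3 + 2 * M)\<^sup>2 / (4 * c))"
proof -
  have e: "1 + s \<le> exp s" by simp
  have "(1 + s) ^ 3 \<le> exp s ^ 3"
    using e assms by (intro power_mono) auto
  then have 1: "(1 + s) ^ 3 \<le> exp (3 * s)"
    by (simp add: exp_of_nat_mult[symmetric])
  have "1 + s\<^sup>2 \<le> (1 + s)\<^sup>2" using assms by (simp add: power2_eq_square algebra_simps)
  also have "\<dots> \<le> (exp s)\<^sup>2" using e assms by (intro power_mono) auto
  also have "\<dots> = exp (2 * s)" by (simp add: exp_double)
  finally have "(1 + s\<^sup>2) powr M \<le> exp (2 * s) powr M"
    using assms by (intro powr_mono2) (auto intro: add_nonneg_nonneg)
  then have 2: "(1 + s\<^sup>2) powr M \<le> exp (2 * M * s)"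
    by (simp add: powr_def mult_ac)
  have "(1 + s) ^ 3 * exp (D * (1 + s)) * exp (- c * s\<^sup>2) * (1 + s\<^sup>2) powr M
      \<le> exp (3 * s) * exp (D * (1 + s)) * exp (- c * s\<^sup>2) * exp (2 * M * s)"
    using 1 2 assms by (intro mult_mono) auto
  also have "\<dots> = exp (D + (D + 3 + 2 * M) * s - c * s\<^sup>2)"
    by (simp add: exp_add[symmetric] algebra_simps)
  also have "\<dots> \<le> exp (D + (D + 3 + 2 * M)\<^sup>2 / (4 * c))"
  proof -
    have "0 \<le> (2 * c * s - (D + 3 + 2 * M))\<^sup>2" by simp
    then have "(D + 3 + 2 * M) * s - c * s\<^sup>2 \<le> (D + 3 + 2 * M)\<^sup>2 / (4 * c)"
      using assms by (simp add: field_simps power2_eq_square)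
    then show ?thesis by simp
  qed
  finally show ?thesis .
qed

lemma heat_kernel_scaled:
  fixes x :: "'a::euclidean_space"
  assumes "0 < a" "0 < t"
  shows "heat_kernel a x t = (4 * pi * a) powr (- (real DIM('a) / 2)) *
    t powr (- (real DIM('a) / 2)) * exp (- (1 / (4 * a)) * (norm x / sqrt t)\<^sup>2)"
  using assms by (simp add: heat_kernel_def powr_mult power_divide mult_ac)

lemma heat_kernel_nonneg: "0 \<le> heat_kernel a x t"
  by (simp add: heat_kernel_def)

lemma heat_kernel_le_powr:
  fixes x :: "'a::euclidean_space"
  assumes "0 < a" "0 < t"
  shows "heat_kernel a x t \<le> (4 * pi * a) powr (- (real DIM('a) / 2)) * t powr (- (real DIM('a) / 2))"
  using assms by (simp add: heat_kernel_scaled mult_left_le)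

lemma self_similar_powr:
  fixes X t :: real
  assumes "0 < t" 
  shows "(1 + (X / sqrt t)\<^sup>2) powr (- M) = t powr M * (t + X\<^sup>2) powr (- M)"
proof -
  have "1 + (X / sqrt t)\<^sup>2 = (t + X\<^sup>2) / t"
    using assms by (simp add: power_divide field_simps)
  then have "(1 + (X / sqrt t)\<^sup>2) powr (- M) = (t + X\<^sup>2) powr (- M) / t powr (- M)"
    using assms by (simp add: powr_divide)
  then show ?thesis by (simp add: powr_minus field_simps)
qed

text \<open>A Gaussian is dominated by every negative power. The parameter \<open>M\<close> trades decay in time for decay in
  space: \<open>M = N/2\<close> gives the bound \<open>(t + |x|\<^sup>2)\<^bsup>-N/2\<^esup>\<close> used for upper estimates, and a larger \<open>M\<close> shows
  that short times contribute little far away from the origin.\<close>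

lemma heat_kernel_tail:
  assumes "0 < a" "0 \<le> M"
  shows "\<exists>C>0. \<forall>t>0. \<forall>x::'a::euclidean_space.
    heat_kernel a x t \<le> C * (t powr (M - real DIM('a) / 2) * (t + (norm x)\<^sup>2) powr (- M))"
proof (intro exI conjI allI impI)
  let ?B = "exp (0 + (0 + 3 + 2 * M)\<^sup>2 / (4 * (1 / (4 * a))))"
  let ?C = "(4 * pi * a) powr (- (real DIM('a) / 2)) * ?B"
  show "0 < ?C" using assms by simp
  fix t :: real and x :: 'a assume t: "0 < t"
  define s where "s = norm x / sqrt t"
  have s: "0 \<le> s" using t by (simp add: s_def)
  have "exp (- (1 / (4 * a)) * s\<^sup>2) * (1 + s\<^sup>2) powr M
      \<le> (1 + s) ^ 3 * exp (0 * (1 + s)) * exp (- (1 / (4 * a)) * s\<^sup>2) * (1 + s\<^sup>2) powr M"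
    using mult_right_mono[OF one_le_power[of "1 + s" 3], of "exp (- (1 / (4 * a)) * s\<^sup>2) * (1 + s\<^sup>2) powr M"] s
    by simp
  also have "\<dots> \<le> ?B"
    by (rule gaussian_beats_powers) (use assms s in auto)
  finally have "exp (- (1 / (4 * a)) * s\<^sup>2) \<le> ?B * (1 + s\<^sup>2) powr (- M)"
    by (simp add: powr_minus field_simps add_nonneg_eq_0_iff)
  also have "(1 + s\<^sup>2) powr (- M) = t powr M * (t + (norm x)\<^sup>2) powr (- M)"
    unfolding s_def by (rule self_similar_powr[OF t])
  finally have "heat_kernel a x t \<le> (4 * pi * a) powr (- (real DIM('a) / 2)) *
    t powr (- (real DIM('a) / 2)) * (?B * (t powr M * (t + (norm x)\<^sup>2) powr (- M)))"
    unfolding heat_kernel_scaled[OF assms(1) t] s_def[symmetric]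
    by (intro mult_left_mono) auto
  also have "\<dots> = ?C * (t powr (M - real DIM('a) / 2) * (t + (norm x)\<^sup>2) powr (- M))"
  proof -
    have "t powr (M - real DIM('a) / 2) = t powr M * t powr (- (real DIM('a) / 2))"
      by (simp add: powr_add[symmetric])
    then show ?thesis by (simp only: mult_ac)
  qed
  finally show "heat_kernel a x t \<le> ?C * (t powr (M - real DIM('a) / 2) * (t + (norm x)\<^sup>2) powr (- M))" .
qed

definition heat_kernel_dt :: "real \<Rightarrow> 'a::euclidean_space \<Rightarrow> real \<Rightarrow> real" where
  "heat_kernel_dt a x t =
     heat_kernel a x t * ((norm x)\<^sup>2 / (4 * a * t\<^sup>2) - real DIM('a) / (2 * t))"

lemma DERIV_powr_times_exp:
  fixes k l e X t :: real
  assumes "0 < k" "0 < l" "0 < t"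
  shows "((\<lambda>t. (k * t) powr e * exp (- (X / (l * t)))) has_real_derivative
    (k * t) powr e * exp (- (X / (l * t))) * (X / (l * t\<^sup>2) + e / t)) (at t)"
proof -
  have p: "0 < k * t" and nz: "k \<noteq> 0" "l \<noteq> 0" "t \<noteq> 0" using assms by auto
  show ?thesis
    by (rule derivative_eq_intros refl p | (use nz in force))+
      (use nz p in \<open>simp add: powr_diff field_simps power2_eq_square\<close>)
qed

lemma heat_kernel_has_derivative:
  fixes x :: "'a::euclidean_space"
  assumes "0 < a" "0 < t"
  shows "((\<lambda>t. heat_kernel a x t) has_real_derivative heat_kernel_dt a x t) (at t)"
  using DERIV_powr_times_exp[of "4 * pi * a" "4 * a" t "- (real DIM('a) / 2)" "(norm x)\<^sup>2"] assms
  by (simp add: heat_kernel_def heat_kernel_dt_def)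

lemma abs_heat_kernel_dt_le:
  fixes x :: "'a::euclidean_space"
  assumes "0 < a" "0 < t"
  shows "\<bar>heat_kernel_dt a x t\<bar> \<le>
    (4 * pi * a) powr (- (real DIM('a) / 2)) * (1 + real DIM('a) / 2) * t powr (- (real DIM('a) / 2) - 1)"
proof -
  define y where "y = (norm x)\<^sup>2 / (4 * a * t)"
  let ?n = "real DIM('a)" and ?c = "(4 * pi * a) powr (- (real DIM('a) / 2))"
  have y: "0 \<le> y" using assms by (simp add: y_def)
  have "y * exp (- y) \<le> 1"
  proof -
    have "y \<le> exp y" using exp_ge_add_one_self[of y] by linarith
    then show ?thesis by (simp add: exp_minus field_simps)
  qed
  then have 1: "exp (- y) * (y + ?n / 2) \<le> 1 + ?n / 2"
    using y by (auto simp: distrib_left mult.commute intro!: add_mono mult_left_le)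
  have "heat_kernel_dt a x t = ?c * t powr (- (?n / 2) - 1) * (exp (- y) * (y - ?n / 2))"
  proof -
    have p: "t powr (- (?n / 2) - 1) = t powr (- (?n / 2)) / t"
      using assms by (simp add: powr_diff)
    have k: "heat_kernel a x t = ?c * t powr (- (?n / 2)) * exp (- y)"
      using assms by (simp add: heat_kernel_def y_def powr_mult)
    have "(norm x)\<^sup>2 / (4 * a * t\<^sup>2) - ?n / (2 * t) = (y - ?n / 2) / t"
      using assms by (simp add: y_def power2_eq_square diff_divide_distrib)
    then show ?thesis
      unfolding heat_kernel_dt_def k p by simp
  qed
  then have "\<bar>heat_kernel_dt a x t\<bar> = ?c * t powr (- (?n / 2) - 1) * (exp (- y) * \<bar>y - ?n / 2\<bar>)"
    by (simp add: abs_mult)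
  also have "\<dots> \<le> ?c * t powr (- (?n / 2) - 1) * (exp (- y) * (y + ?n / 2))"
    using y by (intro mult_left_mono) auto
  also have "\<dots> \<le> ?c * t powr (- (?n / 2) - 1) * (1 + ?n / 2)"
    using 1 by (intro mult_left_mono) auto
  finally show ?thesis by (simp add: mult_ac)
qed

lemma continuous_heat_kernel_space: "continuous_on UNIV (\<lambda>x. heat_kernel a x t)"
  unfolding heat_kernel_def divide_inverse by (intro continuous_intros)

lemma heat_kernel_measurable [measurable (raw)]:
  assumes [measurable]: "f \<in> borel_measurable M" "g \<in> borel_measurable M"
  shows "(\<lambda>p. heat_kernel a (f p) (g p)) \<in> borel_measurable M"
  unfolding heat_kernel_def by measurable

lemma heat_kernel_dt_measurable [measurable (raw)]:
  assumes [measurable]: "f \<in> borel_measurable M" "g \<in> borel_measurable M"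
  shows "(\<lambda>p. heat_kernel_dt a (f p) (g p)) \<in> borel_measurable M"
  unfolding heat_kernel_dt_def by measurable

lemma exp_second_order:
  fixes y :: real
  shows "\<bar>exp y - (1 + y + y\<^sup>2 / 2)\<bar> \<le> \<bar>y\<bar> ^ 3 * exp \<bar>y\<bar>"
proof -
  obtain t where t: "\<bar>t\<bar> \<le> \<bar>y\<bar>" "exp y = (\<Sum>m<3. y ^ m / fact m) + exp t / fact 3 * y ^ 3"
    using Maclaurin_exp_le by blast
  have eq: "exp y - (1 + y + y\<^sup>2 / 2) = exp t / 6 * y ^ 3"
    using t(2) by (simp add: numeral_3_eq_3 power2_eq_square fact_numeral)
  have "\<bar>exp y - (1 + y + y\<^sup>2 / 2)\<bar> = \<bar>y\<bar> ^ 3 * (exp t / 6)"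
    unfolding eq by (simp add: abs_mult power_abs)
  also have "\<dots> \<le> \<bar>y\<bar> ^ 3 * exp \<bar>y\<bar>"
  proof (intro mult_left_mono)
    have "exp t \<le> exp \<bar>y\<bar>" using t(1) by simp
    then show "exp t / 6 \<le> exp \<bar>y\<bar>" using exp_gt_zero[of t] by linarith
  qed auto
  finally show ?thesis .
qed

context dispersal
begin

lemma nonlocal_op_lborel:
  assumes "continuous_on UNIV f"
  shows "nonlocal_op J f x = (\<integral>z. J z * (f (x - z) - f x) \<partial>lborel)"
proof -
  have [measurable]: "f \<in> borel_measurable borel"
    using assms by (rule borel_measurable_continuous_onI)
  have "nonlocal_op J f x = (\<integral>y. J (x - y) * (f y - f x) \<partial>lborel)"
    unfolding nonlocal_op_def by (rule integral_completion) measurable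
  also have "\<dots> = (\<integral>y. J (x - y) * (f (x - (x - y)) - f x) \<partial>lborel)"
    by simp
  also have "\<dots> = (\<integral>z. J z * (f (x - z) - f x) \<partial>lborel)"
    by (rule integral_lborel_reflect_shift(1)) measurable
  finally show ?thesis .
qed

text \<open>With \<open>y(z) = (2 x \<bullet> z - |z|\<^sup>2) / (4 a t)\<close> one has \<open>G(x - z, t) = G(x, t) exp (y z)\<close>. Expand the exponential:
  by the moment identities, \<open>y + y\<^sup>2/2\<close> averages to \<open>\<partial>\<^sub>t G / G\<close> plus a term of size \<open>t\<^sup>-\<^sup>2\<close>, and the
  remainder is cubic in \<open>y\<close>. On the support of \<open>J\<close>, \<open>|y|\<close> is at most a multiple of
  \<open>(1 + |x| / sqrt t) / sqrt t\<close>, so the remainder gains \<open>t\<^bsup>-3/2\<^esup>\<close>, and the factors that grow in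
  \<open>|x| / sqrt t\<close> are beaten by the Gaussian.\<close>

theorem heat_kernel_consistency:
  "\<exists>C>0. \<forall>t\<ge>1. \<forall>x.
     \<bar>nonlocal_op J (\<lambda>y. heat_kernel (diffusivity J) y t) x - heat_kernel_dt (diffusivity J) x t\<bar>
       \<le> C * (t + (norm x)\<^sup>2) powr (- (real DIM('a) / 2) - 3 / 2)"
proof -
  define a where "a = diffusivity J"
  have a: "0 < a" using diffusivity_pos by (simp add: a_def)
  obtain \<rho> where \<rho>: "0 < \<rho>" "\<And>z. \<rho> < norm z \<Longrightarrow> J z = 0"
    using J_zero_outside by blast
  let ?n = "real DIM('a)"
  define m where "m = (\<integral>z. J z * (norm z) ^ 4 \<partial>lborel)"
  have m: "0 \<le> m" using J_nonneg by (simp add: m_def)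
  \<comment> \<open>\<open>D\<close> is chosen such that \<open>|y z| \<le> D (1 + |x|) / t\<close> on the support of \<open>J\<close>.\<close>
  define D where "D = (2 * \<rho> + \<rho>\<^sup>2) / (4 * a)"
  have D: "0 < D" using \<rho> a by (simp add: D_def add_pos_pos)
  define B where "B = exp (D + (D + 3 + 2 * (?n / 2 + 3 / 2))\<^sup>2 / (4 * (1 / (4 * a))))"
  define E where "E = m / (32 * a\<^sup>2) + D ^ 3"
  have E: "0 < E" using m a D by (simp add: E_def add_nonneg_pos)
  define C where "C = (4 * pi * a) powr (- (?n / 2)) * E * B"
  have C: "0 < C" using a E by (simp add: C_def B_def)
  have "\<bar>nonlocal_op J (\<lambda>y. heat_kernel a y t) x - heat_kernel_dt a x t\<bar>
       \<le> C * (t + (norm x)\<^sup>2) powr (- (?n / 2) - 3 / 2)" if t: "1 \<le> t" for t x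
  proof -
    define c where "c = 1 / (4 * a * t)"
    have c: "0 < c" using a t by (simp add: c_def)
    define y where "y z = c * (2 * (x \<bullet> z) - (norm z)\<^sup>2)" for z
    define s where "s = norm x / sqrt t"
    have s: "0 \<le> s" using t by (simp add: s_def)
    have cont_y: "continuous_on UNIV y" unfolding y_def by (intro continuous_intros)
    have shift: "heat_kernel a (x - z) t = heat_kernel a x t * exp (y z)" for z
    proof -
      have eq: "(norm (x - z))\<^sup>2 = (norm x)\<^sup>2 - (2 * (x \<bullet> z) - (norm z)\<^sup>2)"
        by (simp add: power2_norm_eq_inner inner_diff_left inner_diff_right inner_commute)
      have e: "- ((norm (x - z))\<^sup>2 / (4 * a * t)) = - ((norm x)\<^sup>2 / (4 * a * t)) + y z"
        unfolding eq by (simp add: y_def c_def diff_divide_distrib)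
      show ?thesis
        unfolding heat_kernel_def e exp_add by (simp only: mult_ac)
    qed
    define r where "r z = exp (y z) - (1 + y z + (y z)\<^sup>2 / 2)" for z
    have cont_r: "continuous_on UNIV r" unfolding r_def by (intro continuous_intros cont_y) auto
    have "nonlocal_op J (\<lambda>y. heat_kernel a y t) x
        = (\<integral>z. J z * (heat_kernel a (x - z) t - heat_kernel a x t) \<partial>lborel)"
      by (rule nonlocal_op_lborel[OF continuous_heat_kernel_space])
    also have "\<dots> = (\<integral>z. heat_kernel a x t * (J z * y z + J z * (y z)\<^sup>2 / 2 + J z * r z) \<partial>lborel)"
      by (intro Bochner_Integration.integral_cong[OF refl]) (simp add: shift r_def algebra_simps)
    also have "\<dots> = heat_kernel a x t *
        ((\<integral>z. J z * y z \<partial>lborel) + (\<integral>z. J z * (y z)\<^sup>2 \<partial>lborel) / 2 + (\<integral>z. J z * r z \<partial>lborel))"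
      using integrable_J_times[OF cont_y] integrable_J_times[OF cont_r]
        integrable_J_times[OF continuous_on_power[OF cont_y, of 2]] by simp
    also have "(\<integral>z. J z * y z \<partial>lborel) = - ?n / (2 * t)"
    proof -
      have "(\<integral>z. J z * y z \<partial>lborel)
          = (\<integral>z. 2 * c * (J z * (x \<bullet> z)) - c * (J z * (norm z)\<^sup>2) \<partial>lborel)"
        by (intro Bochner_Integration.integral_cong[OF refl]) (simp add: y_def algebra_simps)
      also have "\<dots> = 2 * c * (\<integral>z. J z * (x \<bullet> z) \<partial>lborel) - c * (\<integral>z. J z * (norm z)\<^sup>2 \<partial>lborel)"
        by (subst Bochner_Integration.integral_diff)
          (auto intro!: integrable_mult_right integrable_J_times continuous_intros)
      also have "(\<integral>z. J z * (x \<bullet> z) \<partial>lborel) = 0"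
        by (rule integral_J_odd) (auto intro!: continuous_intros)
      finally show ?thesis
        using a t by (simp add: norm_moment c_def a_def[symmetric])
    qed
    also have "(\<integral>z. J z * (y z)\<^sup>2 \<partial>lborel) = (norm x)\<^sup>2 / (2 * a * t\<^sup>2) + c\<^sup>2 * m"
    proof -
      have "(\<integral>z. J z * (y z)\<^sup>2 \<partial>lborel)
          = (\<integral>z. 4 * c\<^sup>2 * (J z * (x \<bullet> z)\<^sup>2) - 4 * c\<^sup>2 * (J z * ((x \<bullet> z) * (norm z)\<^sup>2))
              + c\<^sup>2 * (J z * (norm z) ^ 4) \<partial>lborel)"
        by (intro Bochner_Integration.integral_cong[OF refl])
          (simp add: y_def algebra_simps power2_eq_square power4_eq_xxxx)
      also have "\<dots> = 4 * c\<^sup>2 * (\<integral>z. J z * (x \<bullet> z)\<^sup>2 \<partial>lborel)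
          - 4 * c\<^sup>2 * (\<integral>z. J z * ((x \<bullet> z) * (norm z)\<^sup>2) \<partial>lborel) + c\<^sup>2 * m"
        unfolding m_def
        by (subst Bochner_Integration.integral_add Bochner_Integration.integral_diff,
            (auto intro!: integrable_mult_right integrable_J_times continuous_intros)[2])+ simp
      also have "(\<integral>z. J z * ((x \<bullet> z) * (norm z)\<^sup>2) \<partial>lborel) = 0"
        by (rule integral_J_odd) (auto intro!: continuous_intros)
      finally show ?thesis
        unfolding second_moment a_def[symmetric]
        using a t by (simp add: c_def power2_eq_square field_simps)
    qed
    finally have eq: "nonlocal_op J (\<lambda>y. heat_kernel a y t) x - heat_kernel_dt a x t
        = heat_kernel a x t * (c\<^sup>2 * m / 2 + (\<integral>z. J z * r z \<partial>lborel))"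
      by (simp add: heat_kernel_dt_def algebra_simps add_divide_distrib)
    define q where "q = D * ((1 + s) / sqrt t)"
    have q: "0 \<le> q" using D s t by (simp add: q_def)
    have yq: "\<bar>y z\<bar> \<le> q" if z: "norm z \<le> \<rho>" for z
    proof -
      have "\<bar>2 * (x \<bullet> z) - (norm z)\<^sup>2\<bar> \<le> 2 * \<bar>x \<bullet> z\<bar> + (norm z)\<^sup>2"
        using abs_triangle_ineq4[of "2 * (x \<bullet> z)" "(norm z)\<^sup>2"] by (simp add: abs_mult)
      also have "\<dots> \<le> 2 * (norm x * \<rho>) + \<rho>\<^sup>2"
      proof (intro add_mono mult_left_mono)
        have "\<bar>x \<bullet> z\<bar> \<le> norm x * norm z" by (rule Cauchy_Schwarz_ineq2)
        also have "\<dots> \<le> norm x * \<rho>" using z by (intro mult_left_mono) auto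
        finally show "\<bar>x \<bullet> z\<bar> \<le> norm x * \<rho>" .
        show "(norm z)\<^sup>2 \<le> \<rho>\<^sup>2" using z by (intro power_mono) auto
      qed auto
      also have "\<dots> \<le> (2 * \<rho> + \<rho>\<^sup>2) * (1 + norm x)"
        using \<rho>(1) by (simp add: algebra_simps)
      finally have "\<bar>y z\<bar> \<le> c * ((2 * \<rho> + \<rho>\<^sup>2) * (1 + norm x))"
        using c by (simp add: y_def abs_mult)
      also have "\<dots> = D * ((1 + norm x) / t)"
        by (simp add: D_def c_def)
      also have "\<dots> \<le> q"
        unfolding q_def
      proof (intro mult_left_mono)
        have st: "1 \<le> sqrt t" "sqrt t * sqrt t = t" using t by auto
        have "(1 + norm x) / t = (1 / sqrt t + s) / sqrt t"
          using st by (simp add: s_def add_divide_distrib)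
        also have "\<dots> \<le> (1 + s) / sqrt t"
          using st(1) by (intro divide_right_mono add_right_mono) auto
        finally show "(1 + norm x) / t \<le> (1 + s) / sqrt t" .
      qed (use D in auto)
      finally show ?thesis .
    qed
    have t32: "t powr (3 / 2) = sqrt t ^ 3"
    proof -
      have "t powr (3 / 2) = (t powr (1 / 2)) powr 3" using t by (simp add: powr_powr)
      then show ?thesis using t by (simp add: powr_half_sqrt powr_numeral)
    qed
    define P where "P = t powr (- (3 / 2)) * ((1 + s) ^ 3 * exp (D * (1 + s)))"
    have rem: "\<bar>\<integral>z. J z * r z \<partial>lborel\<bar> \<le> D ^ 3 * P"
    proof -
      have "\<bar>\<integral>z. J z * r z \<partial>lborel\<bar> \<le> (\<integral>z. \<bar>J z * r z\<bar> \<partial>lborel)"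
        using integral_norm_bound[of lborel "\<lambda>z. J z * r z"] by simp
      also have "\<dots> \<le> (\<integral>z. J z * (q ^ 3 * exp q) \<partial>lborel)"
      proof (rule integral_mono)
        show "integrable lborel (\<lambda>z. \<bar>J z * r z\<bar>)"
          using integrable_abs[OF integrable_J_times[OF cont_r]] .
        show "integrable lborel (\<lambda>z. J z * (q ^ 3 * exp q))"
          using J_integrable by simp
        fix z
        show "\<bar>J z * r z\<bar> \<le> J z * (q ^ 3 * exp q)"
        proof (cases "norm z \<le> \<rho>")
          case True
          have "\<bar>r z\<bar> \<le> \<bar>y z\<bar> ^ 3 * exp \<bar>y z\<bar>"
            unfolding r_def by (rule exp_second_order)
          also have "\<dots> \<le> q ^ 3 * exp q"
            using yq[OF True] q by (intro mult_mono power_mono) auto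
          finally show ?thesis
            using J_nonneg[of z] by (simp add: abs_mult mult_left_mono)
        qed (simp add: \<rho>)
      qed
      also have "\<dots> = q ^ 3 * exp q" using J_integral by simp
      also have "q ^ 3 = D ^ 3 * (t powr (- (3 / 2)) * (1 + s) ^ 3)"
        unfolding q_def powr_minus t32 by (simp add: power_mult_distrib power_divide divide_inverse power_inverse mult_ac)
      finally have "\<bar>\<integral>z. J z * r z \<partial>lborel\<bar> \<le> D ^ 3 * (t powr (- (3 / 2)) * (1 + s) ^ 3) * exp q" .
      also have "\<dots> \<le> D ^ 3 * (t powr (- (3 / 2)) * (1 + s) ^ 3) * exp (D * (1 + s))"
      proof (rule mult_left_mono)
        have "(1 + s) / sqrt t \<le> (1 + s) / 1"
          using s t by (intro divide_left_mono) auto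
        then have "q \<le> D * ((1 + s) / 1)"
          unfolding q_def by (rule mult_left_mono) (use D in simp)
        then show "exp q \<le> exp (D * (1 + s))" by simp
      qed (use D s in simp)
      finally show ?thesis by (simp only: P_def mult_ac)
    qed
    have main: "c\<^sup>2 * m / 2 \<le> m / (32 * a\<^sup>2) * P"
    proof -
      have "c\<^sup>2 * m / 2 = m / (32 * a\<^sup>2) * t powr (- 2)"
        using t a by (simp add: c_def powr_minus powr_numeral power2_eq_square field_simps)
      also have "\<dots> \<le> m / (32 * a\<^sup>2) * P"
      proof (rule mult_left_mono)
        have Q: "1 * 1 \<le> (1 + s) ^ 3 * exp (D * (1 + s))"
          using s D by (intro mult_mono one_le_power) auto
        have "t powr (- 2) \<le> t powr (- (3 / 2)) * (1 * 1)" using t by (simp add: powr_mono)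
        also have "\<dots> \<le> P"
          unfolding P_def by (rule mult_left_mono[OF Q]) simp
        finally show "t powr (- 2) \<le> P" .
      qed (use m in simp)
      finally show ?thesis .
    qed
    have "\<bar>nonlocal_op J (\<lambda>y. heat_kernel a y t) x - heat_kernel_dt a x t\<bar>
        = heat_kernel a x t * \<bar>c\<^sup>2 * m / 2 + (\<integral>z. J z * r z \<partial>lborel)\<bar>"
      by (simp add: eq abs_mult heat_kernel_nonneg)
    also have "\<dots> \<le> heat_kernel a x t * (E * P)"
    proof (rule mult_left_mono[OF _ heat_kernel_nonneg])
      have "0 \<le> c\<^sup>2 * m / 2" using m by simp
      then show "\<bar>c\<^sup>2 * m / 2 + (\<integral>z. J z * r z \<partial>lborel)\<bar> \<le> E * P"
        using rem main unfolding E_def distrib_right by linarith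
    qed
    also have "\<dots> = (4 * pi * a) powr (- (?n / 2)) * E * t powr (- (?n / 2) - 3 / 2) *
        ((1 + s) ^ 3 * exp (D * (1 + s)) * exp (- (1 / (4 * a)) * s\<^sup>2))"
    proof -
      have p: "t powr (- (?n / 2) - 3 / 2) = t powr (- (?n / 2)) * t powr (- (3 / 2))"
        by (simp add: powr_add[symmetric])
      have "heat_kernel a x t = (4 * pi * a) powr (- (?n / 2)) * t powr (- (?n / 2)) * exp (- (1 / (4 * a)) * s\<^sup>2)"
        unfolding s_def using a t by (intro heat_kernel_scaled) auto
      then show ?thesis by (simp only: p P_def mult_ac)
    qed
    also have "\<dots> \<le> (4 * pi * a) powr (- (?n / 2)) * E * t powr (- (?n / 2) - 3 / 2) *
        (B * (1 + s\<^sup>2) powr (- (?n / 2 + 3 / 2)))"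
    proof (intro mult_left_mono)
      have "(1 + s) ^ 3 * exp (D * (1 + s)) * exp (- (1 / (4 * a)) * s\<^sup>2) * (1 + s\<^sup>2) powr (?n / 2 + 3 / 2) \<le> B"
        unfolding B_def using a s by (intro gaussian_beats_powers) auto
      moreover have "0 < (1 + s\<^sup>2) powr (?n / 2 + 3 / 2)"
        by (simp add: add_nonneg_eq_0_iff)
      ultimately show "(1 + s) ^ 3 * exp (D * (1 + s)) * exp (- (1 / (4 * a)) * s\<^sup>2)
          \<le> B * (1 + s\<^sup>2) powr (- (?n / 2 + 3 / 2))"
        by (simp only: powr_minus[of "1 + s\<^sup>2"] divide_inverse[symmetric] pos_le_divide_eq)
    qed (use E in auto)
    also have "(1 + s\<^sup>2) powr (- (?n / 2 + 3 / 2))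
        = t powr (?n / 2 + 3 / 2) * (t + (norm x)\<^sup>2) powr (- (?n / 2 + 3 / 2))"
      unfolding s_def using t by (intro self_similar_powr) auto
    also have "(4 * pi * a) powr (- (?n / 2)) * E * t powr (- (?n / 2) - 3 / 2) *
        (B * (t powr (?n / 2 + 3 / 2) * (t + (norm x)\<^sup>2) powr (- (?n / 2 + 3 / 2))))
        = C * (t powr (- (?n / 2) - 3 / 2) * t powr (?n / 2 + 3 / 2)) * (t + (norm x)\<^sup>2) powr (- (?n / 2) - 3 / 2)"
      by (simp add: C_def mult_ac)
    also have "t powr (- (?n / 2) - 3 / 2) * t powr (?n / 2 + 3 / 2) = 1"
      using t by (simp add: powr_add[symmetric])
    finally show ?thesis by simp
  qed
  then show ?thesis using C a_def by blast
qed

end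

section \<open>Superpositions of heat kernels\<close>

text \<open>The difference quotients are dominated by \<open>g\<close> through the mean value theorem, so dominated convergence
  applies along every sequence tending to \<open>t\<close>.\<close>

lemma has_real_derivative_integral_dominated:
  fixes f f' :: "'r \<Rightarrow> real \<Rightarrow> real"
  assumes d: "0 < d"
    and deriv: "\<And>r s. \<bar>s - t\<bar> < d \<Longrightarrow> (f r has_real_derivative f' r s) (at s)"
    and int: "\<And>s. \<bar>s - t\<bar> < d \<Longrightarrow> integrable M (\<lambda>r. f r s)"
    and meas [measurable]: "(\<lambda>r. f' r t) \<in> borel_measurable M"
    and bound: "\<And>r s. \<bar>s - t\<bar> < d \<Longrightarrow> \<bar>f' r s\<bar> \<le> g r"
    and g: "integrable M g"
  shows "((\<lambda>s. \<integral>r. f r s \<partial>M) has_real_derivative (\<integral>r. f' r t \<partial>M)) (at t)"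
  unfolding DERIV_def tendsto_at_iff_sequentially
proof (intro allI impI)
  fix X :: "nat \<Rightarrow> real"
  assume X: "\<forall>i. X i \<in> UNIV - {0}" "X \<longlonglongrightarrow> 0"
  let ?q = "\<lambda>r h. (f r (t + h) - f r t) / h"
  \<comment> \<open>Finitely many terms of the sequence may leave the interval where the bound holds; there the
    quotient is replaced by its limit.\<close>
  define s where "s n r = (if \<bar>X n\<bar> < d then ?q r (X n) else f' r t)" for n r
  have int_t: "integrable M (\<lambda>r. f r t)" using int[of t] d by simp
  have int_X: "integrable M (\<lambda>r. f r (t + X n))" if "\<bar>X n\<bar> < d" for n
    using int[of "t + X n"] that by simp
  have small: "eventually (\<lambda>n. \<bar>X n\<bar> < d) sequentially"
    using tendstoD[OF X(2) d] by (simp add: dist_real_def)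
  have "(\<lambda>n. integral\<^sup>L M (s n)) \<longlonglongrightarrow> (\<integral>r. f' r t \<partial>M)"
  proof (rule integral_dominated_convergence[where w = g])
    show "s n \<in> borel_measurable M" for n
    proof (cases "\<bar>X n\<bar> < d")
      case True
      then show ?thesis
        using borel_measurable_integrable[OF int_t] borel_measurable_integrable[OF int_X[OF True]]
        by (simp add: s_def[abs_def])
    qed (simp add: s_def[abs_def])
    show "AE r in M. (\<lambda>n. s n r) \<longlonglongrightarrow> f' r t"
    proof (rule AE_I2)
      fix r
      have "((\<lambda>h. ?q r h) \<longlongrightarrow> f' r t) (at 0)"
        using deriv[of t r] d by (simp add: DERIV_def)
      then have "(\<lambda>n. ?q r (X n)) \<longlonglongrightarrow> f' r t"
        using X unfolding tendsto_at_iff_sequentially by (simp add: o_def)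
      moreover have "eventually (\<lambda>n. ?q r (X n) = s n r) sequentially"
        using small by eventually_elim (simp add: s_def)
      ultimately show "(\<lambda>n. s n r) \<longlonglongrightarrow> f' r t"
        by (rule Lim_transform_eventually)
    qed
    show "AE r in M. norm (s n r) \<le> g r" for n
    proof (rule AE_I2)
      fix r
      show "norm (s n r) \<le> g r"
      proof (cases "\<bar>X n\<bar> < d")
        case True
        have "norm (f r (t + X n) - f r t) \<le> g r * norm ((t + X n) - t)"
        proof (rule field_differentiable_bound[of "{t - \<bar>X n\<bar>..t + \<bar>X n\<bar>}"])
          fix z assume "z \<in> {t - \<bar>X n\<bar>..t + \<bar>X n\<bar>}"
          then have z: "\<bar>z - t\<bar> < d" using True by auto
          show "(f r has_real_derivative f' r z) (at z within {t - \<bar>X n\<bar>..t + \<bar>X n\<bar>})"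
            using deriv[OF z] by (rule DERIV_subset) simp
          show "norm (f' r z) \<le> g r" using bound[OF z] by simp
        qed auto
        then show ?thesis
          using True X(1) by (simp add: s_def divide_le_eq)
      next
        case False
        then show ?thesis using bound[of t r] d by (simp add: s_def)
      qed
    qed
  qed (use g in simp_all)
  moreover have "eventually (\<lambda>n. integral\<^sup>L M (s n)
      = ((\<lambda>h. ((\<integral>r. f r (t + h) \<partial>M) - (\<integral>r. f r t \<partial>M)) / h) \<circ> X) n) sequentially"
    using small
  proof eventually_elim
    case (elim n)
    then show ?case
      using int_t int_X[OF elim] by (simp add: s_def[abs_def])
  qed
  ultimately show "((\<lambda>h. ((\<integral>r. f r (t + h) \<partial>M) - (\<integral>r. f r t \<partial>M)) / h) \<circ> X) \<longlonglongrightarrow> (\<integral>r. f' r t \<partial>M)"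
    by (rule Lim_transform_eventually)
qed

lemma has_bochner_integral_of_has_integral:
  fixes f :: "real \<Rightarrow> real"
  assumes [measurable]: "f \<in> borel_measurable borel" "S \<in> sets borel"
    and nn: "\<And>x. 0 \<le> f x" and I: "(f has_integral I) S"
  shows "has_bochner_integral lborel (\<lambda>x. f x * indicator S x) I"
proof (rule has_bochner_integral_nn_integral)
  show "0 \<le> I" using I nn by (rule has_integral_nonneg) 
  have "(\<integral>\<^sup>+ x. ennreal (f x * indicator S x) \<partial>lborel) = (\<integral>\<^sup>+ x. ennreal (indicator S x * f x) \<partial>lborel)"
    by (simp add: mult.commute)
  also have "\<dots> = (\<integral>\<^sup>+ x. ennreal (indicator S x * f x) \<partial>lebesgue)"
    by (rule nn_integral_completion[symmetric])
  also have "\<dots> = ennreal I"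
    using nn_integral_has_integral_lebesgue[OF nn I] by (simp add: nn_integral_completion)
  finally show "(\<integral>\<^sup>+ x. ennreal (f x * indicator S x) \<partial>lborel) = ennreal I" .
qed (use nn in \<open>auto split: split_indicator\<close>)

lemma powr_tail_integral:
  fixes p R :: real
  assumes "p < 0" "0 < R"
  shows "has_bochner_integral lborel (\<lambda>r. r powr (p - 1) * indicator {R..} r) (R powr p / (- p))"
proof -
  have "((\<lambda>r. r powr (p - 1)) has_integral - (R powr (p - 1 + 1)) / (p - 1 + 1)) {R..}"
    using assms by (intro has_integral_powr_to_inf) auto
  then show ?thesis
    by (intro has_bochner_integral_of_has_integral) auto
qed

lemma powr_initial_integral:
  fixes m R :: real
  assumes "0 < m" "0 \<le> R"
  shows "has_bochner_integral lborel (\<lambda>r. r powr (m - 1) * indicator {0..R} r) (R powr m / m)"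
proof -
  have "((\<lambda>r. r powr (m - 1)) has_integral (R powr (m - 1 + 1)) / (m - 1 + 1)) {0..R}"
    using assms by (intro has_integral_powr_from_0) auto
  then show ?thesis
    by (intro has_bochner_integral_of_has_integral) auto
qed

text \<open>The point of this estimate is that it only sees \<open>R = 1 + t + X\<close>. For \<open>r \<le> R\<close> the second factor is at most
  \<open>R\<^sup>-\<^sup>M\<close>, and for \<open>r \<ge> R\<close> it is at most \<open>r\<^sup>-\<^sup>M\<close>; in both ranges \<open>r\<^sup>k \<le> r\<^bsup>m-1\<^esup>\<close>. The exponent \<open>m\<close> may be
  taken larger than \<open>k + 1\<close>: this small loss keeps the integral over \<open>r \<le> R\<close> free of logarithms and of
  case distinctions when \<open>k \<le> -1\<close>.\<close>

lemma mixture_integral_bound: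
  fixes g :: "real \<Rightarrow> real" and k m M t X C :: real
  assumes [measurable]: "g \<in> borel_measurable borel"
    and m: "0 < m" "k + 1 \<le> m" "m < M" and tX: "0 \<le> t" "0 \<le> X" and C: "0 \<le> C"
    and g: "\<And>r. 1 \<le> r \<Longrightarrow> \<bar>g r\<bar> \<le> C * (r powr k * (t + r + X) powr (- M))"
  shows "integrable lborel (\<lambda>r. g r * indicator {1..} r)"
    and "\<bar>\<integral>r. g r * indicator {1..} r \<partial>lborel\<bar> \<le> C * (1 / m + 1 / (M - m)) * (1 + t + X) powr (m - M)"
proof -
  define R where "R = 1 + t + X"
  have R: "1 \<le> R" using tX by (simp add: R_def)
  let ?h = "\<lambda>r. C * (R powr (- M) * (r powr (m - 1) * indicator {0..R} r)
    + r powr ((m - M) - 1) * indicator {R..} r)"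
  have h: "has_bochner_integral lborel ?h (C * (R powr (- M) * (R powr m / m) + R powr (m - M) / (- (m - M))))"
    using powr_initial_integral[of m R] powr_tail_integral[of "m - M" R] m R
    by (intro has_bochner_integral_add has_bochner_integral_mult_right) auto
  have bound: "\<bar>g r * indicator {1..} r\<bar> \<le> ?h r" for r
  proof (cases "1 \<le> r")
    case True
    have "r powr k * (t + r + X) powr (- M)
        \<le> R powr (- M) * (r powr (m - 1) * indicator {0..R} r) + r powr ((m - M) - 1) * indicator {R..} r"
    proof (cases "r \<le> R")
      case r: True
      have "r powr k * (t + r + X) powr (- M) \<le> r powr (m - 1) * R powr (- M)"
        using True m tX by (intro mult_mono powr_mono powr_mono2') (auto simp: R_def)
      then show ?thesis
        using r True by (auto simp: mult.commute intro: add_increasing2 split: split_indicator)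
    next
      case r: False
      have "r powr k * (t + r + X) powr (- M) \<le> r powr (m - 1) * r powr (- M)"
        using True m tX by (intro mult_mono powr_mono powr_mono2') auto
      also have "\<dots> = r powr ((m - M) - 1)"
        by (simp add: powr_add[symmetric] algebra_simps)
      finally show ?thesis using r True by simp
    qed
    then have "C * (r powr k * (t + r + X) powr (- M)) \<le> ?h r"
      by (rule mult_left_mono[OF _ C])
    then show ?thesis using g[OF True] True by simp
  qed (use C in simp)
  show int: "integrable lborel (\<lambda>r. g r * indicator {1..} r)"
    by (rule Bochner_Integration.integrable_bound[OF integrable.intros[OF h]])
      (use bound in \<open>auto intro!: AE_I2 order_trans[OF bound]\<close>)
  have "\<bar>\<integral>r. g r * indicator {1..} r \<partial>lborel\<bar> \<le> (\<integral>r. \<bar>g r * indicator {1..} r\<bar> \<partial>lborel)"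
    using integral_norm_bound[of lborel "\<lambda>r. g r * indicator {1..} r"] by simp
  also have "\<dots> \<le> (\<integral>r. ?h r \<partial>lborel)"
    using integrable_abs[OF int] integrable.intros[OF h] bound by (rule integral_mono)
  also have "\<dots> = C * (R powr (- M) * (R powr m / m) + R powr (m - M) / (- (m - M)))"
    using h by (rule has_bochner_integral_integral_eq)
  also have "R powr (- M) * (R powr m / m) = R powr (m - M) / m"
    by (simp add: powr_add[symmetric])
  also have "C * (R powr (m - M) / m + R powr (m - M) / (- (m - M)))
      = C * (1 / m + 1 / (M - m)) * R powr (m - M)"
    by (simp add: algebra_simps)
  finally show "\<bar>\<integral>r. g r * indicator {1..} r \<partial>lborel\<bar> \<le> C * (1 / m + 1 / (M - m)) * (1 + t + X) powr (m - M)"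
    by (simp add: R_def)
qed

text \<open>Starting the integral at \<open>1\<close> instead of \<open>0\<close> keeps all heat kernels at times at least \<open>1\<close>, so that the
  superposition is smooth and bounded up to \<open>t = 0\<close> and the consistency estimate applies for all \<open>t \<ge> 0\<close>.\<close>

definition heat_mixture :: "real \<Rightarrow> real \<Rightarrow> 'a::euclidean_space \<Rightarrow> real \<Rightarrow> real" where
  "heat_mixture a k x t =
     (\<integral>r. r powr k * heat_kernel a x (t + r) * indicator {1..} r \<partial>lborel)"

definition heat_mixture_dt :: "real \<Rightarrow> real \<Rightarrow> 'a::euclidean_space \<Rightarrow> real \<Rightarrow> real" where
  "heat_mixture_dt a k x t =
     (\<integral>r. r powr k * heat_kernel_dt a x (t + r) * indicator {1..} r \<partial>lborel)"

lemma heat_mixture_measurable [measurable]: "(\<lambda>x. heat_mixture a k x t) \<in> borel_measurable borel"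
  unfolding heat_mixture_def by measurable

lemma heat_mixture_nonneg: "0 \<le> heat_mixture a k x t"
  unfolding heat_mixture_def by (intro integral_nonneg_AE AE_I2) (simp add: heat_kernel_nonneg)

lemma half_shift_powr_le:
  fixes s r e :: real
  assumes "- (1 / 2) \<le> s" "1 \<le> r" "e \<le> 0"
  shows "(s + r) powr e \<le> 2 powr (- e) * r powr e"
proof -
  have "(s + r) powr e \<le> (r / 2) powr e"
    using assms by (intro powr_mono2') auto
  then show ?thesis using assms by (simp add: powr_divide powr_minus field_simps)
qed

lemma integrable_powr_tail_bounded:
  fixes g :: "real \<Rightarrow> real"
  assumes [measurable]: "g \<in> borel_measurable borel" and "p < 0"
    and g: "\<And>r. 1 \<le> r \<Longrightarrow> \<bar>g r\<bar> \<le> C * r powr (p - 1)"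
  shows "integrable lborel (\<lambda>r. g r * indicator {1..} r)"
proof (rule Bochner_Integration.integrable_bound)
  show "integrable lborel (\<lambda>r. C * (r powr (p - 1) * indicator {1..} r))"
    using integrable.intros[OF powr_tail_integral[OF \<open>p < 0\<close>, of 1]] by simp
  show "AE r in lborel. norm (g r * indicator {1..} r) \<le> norm (C * (r powr (p - 1) * indicator {1..} r))"
    using g by (intro AE_I2) (force split: split_indicator)
qed simp

context
  fixes a k :: real
  assumes a: "0 < a"
begin

lemma heat_mixture_integrable:
  fixes x :: "'a::euclidean_space"
  assumes k: "k + 1 < real DIM('a) / 2" and t: "- (1 / 2) \<le> t"
  shows "integrable lborel (\<lambda>r. r powr k * heat_kernel a x (t + r) * indicator {1..} r)"
proof (rule integrable_powr_tail_bounded)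
  let ?n = "real DIM('a)" and ?c = "(4 * pi * a) powr (- (real DIM('a) / 2))"
  show "k + 1 - ?n / 2 < 0" using k by simp
  fix r :: real assume r: "1 \<le> r"
  have "heat_kernel a x (t + r) \<le> ?c * (t + r) powr (- (?n / 2))"
    using a t r by (intro heat_kernel_le_powr) auto
  also have "\<dots> \<le> ?c * (2 powr (- (- (?n / 2))) * r powr (- (?n / 2)))"
    using t r by (intro mult_left_mono half_shift_powr_le) auto
  finally have "r powr k * heat_kernel a x (t + r) \<le> r powr k * (?c * (2 powr (- (- (?n / 2))) * r powr (- (?n / 2))))"
    by (rule mult_left_mono) simp
  also have "\<dots> = ?c * 2 powr (?n / 2) * (r powr k * r powr (- (?n / 2)))"
    by simp
  also have "r powr k * r powr (- (?n / 2)) = r powr (k + 1 - ?n / 2 - 1)"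
    by (simp add: powr_add[symmetric])
  finally show "\<bar>r powr k * heat_kernel a x (t + r)\<bar> \<le> ?c * 2 powr (?n / 2) * r powr (k + 1 - ?n / 2 - 1)"
    by (simp add: heat_kernel_nonneg)
qed simp

lemma heat_mixture_has_derivative:
  fixes x :: "'a::euclidean_space"
  assumes k: "k + 1 < real DIM('a) / 2" and t: "0 \<le> t"
  shows "((\<lambda>t. heat_mixture a k x t) has_real_derivative heat_mixture_dt a k x t) (at t)"
  unfolding heat_mixture_def heat_mixture_dt_def
proof (rule has_real_derivative_integral_dominated[where d = "1 / 2"])
  let ?n = "real DIM('a)"
  let ?c = "(4 * pi * a) powr (- (?n / 2)) * (1 + ?n / 2)"
  let ?g = "\<lambda>r. ?c * 2 powr (?n / 2 + 1) * r powr (k - ?n / 2 - 1)"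
  show "integrable lborel (\<lambda>r. ?g r * indicator {1..} r)"
  proof (rule integrable_powr_tail_bounded)
    show "k - ?n / 2 < 0" using k by simp
    show "\<bar>?g r\<bar> \<le> ?c * 2 powr (?n / 2 + 1) * r powr (k - ?n / 2 - 1)" for r
      by (simp add: abs_mult)
  qed simp
  fix s assume "\<bar>s - t\<bar> < 1 / 2"
  then have s: "- (1 / 2) \<le> s" using t by linarith
  show "integrable lborel (\<lambda>r. r powr k * heat_kernel a x (s + r) * indicator {1..} r)"
    by (rule heat_mixture_integrable[OF k s])
  fix r :: real
  show "((\<lambda>s. r powr k * heat_kernel a x (s + r) * indicator {1..} r) has_real_derivative
      r powr k * heat_kernel_dt a x (s + r) * indicator {1..} r) (at s)"
  proof (cases "1 \<le> r")
    case True
    have "((\<lambda>u. heat_kernel a x u) has_real_derivative heat_kernel_dt a x (s + r)) (at (s + r))"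
      using a s True by (intro heat_kernel_has_derivative) auto
    then have "((\<lambda>s. heat_kernel a x (s + r)) has_real_derivative heat_kernel_dt a x (s + r)) (at s)"
      by (simp add: DERIV_shift)
    from DERIV_cmult_right[OF DERIV_cmult[OF this, of "r powr k"], of "indicator {1..} r"]
    show ?thesis .
  qed simp
  show "\<bar>r powr k * heat_kernel_dt a x (s + r) * indicator {1..} r\<bar> \<le> ?g r * indicator {1..} r"
  proof (cases "1 \<le> r")
    case True
    have "\<bar>heat_kernel_dt a x (s + r)\<bar> \<le> ?c * (s + r) powr (- (?n / 2) - 1)"
      using a s True by (intro abs_heat_kernel_dt_le) auto
    also have "\<dots> \<le> ?c * (2 powr (- (- (?n / 2) - 1)) * r powr (- (?n / 2) - 1))"
      using s True by (intro mult_left_mono half_shift_powr_le) auto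
    finally have "r powr k * \<bar>heat_kernel_dt a x (s + r)\<bar>
        \<le> r powr k * (?c * (2 powr (- (- (?n / 2) - 1)) * r powr (- (?n / 2) - 1)))"
      by (rule mult_left_mono) simp
    also have "\<dots> = ?c * 2 powr (?n / 2 + 1) * (r powr k * r powr (- (?n / 2) - 1))"
      by (simp add: add.commute)
    also have "r powr k * r powr (- (?n / 2) - 1) = r powr (k - ?n / 2 - 1)"
      by (simp add: powr_add[symmetric] algebra_simps)
    finally show ?thesis using True by (simp add: abs_mult)
  qed simp
qed simp_all

lemma heat_mixture_upper:
  assumes m: "0 < m" "k + 1 \<le> m" "m < real DIM('a) / 2"
  shows "\<exists>C>0. \<forall>t\<ge>0. \<forall>x::'a::euclidean_space.
    heat_mixture a k x t \<le> C * (1 + t + (norm x)\<^sup>2) powr (m - real DIM('a) / 2)"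
proof -
  let ?n = "real DIM('a)"
  obtain C where C: "0 < C" "\<And>t (x::'a). 0 < t \<Longrightarrow>
      heat_kernel a x t \<le> C * (t powr (?n / 2 - ?n / 2) * (t + (norm x)\<^sup>2) powr (- (?n / 2)))"
    using heat_kernel_tail[OF a, of "?n / 2", where 'a='a] by auto
  show ?thesis
  proof (intro exI conjI allI impI)
    show "0 < C * (1 / m + 1 / (?n / 2 - m))"
      using C m by (intro mult_pos_pos add_pos_pos) auto
    fix t :: real and x :: 'a assume t: "0 \<le> t"
    have "\<bar>\<integral>r. r powr k * heat_kernel a x (t + r) * indicator {1..} r \<partial>lborel\<bar>
        \<le> C * (1 / m + 1 / (?n / 2 - m)) * (1 + t + (norm x)\<^sup>2) powr (m - ?n / 2)"
    proof (rule mixture_integral_bound(2)[where k = k])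
      fix r :: real assume r: "1 \<le> r"
      have "heat_kernel a x (t + r) \<le> C * (t + r + (norm x)\<^sup>2) powr (- (?n / 2))"
        using C(2)[of "t + r" x] t r by simp
      then have "r powr k * heat_kernel a x (t + r) \<le> r powr k * (C * (t + r + (norm x)\<^sup>2) powr (- (?n / 2)))"
        by (rule mult_left_mono) simp
      then show "\<bar>r powr k * heat_kernel a x (t + r)\<bar> \<le> C * (r powr k * (t + r + (norm x)\<^sup>2) powr (- (?n / 2)))"
        by (simp add: heat_kernel_nonneg mult_ac)
    qed (use m t C in simp_all)
    then show "heat_mixture a k x t \<le> C * (1 / m + 1 / (?n / 2 - m)) * (1 + t + (norm x)\<^sup>2) powr (m - ?n / 2)"
      unfolding heat_mixture_def by linarith
  qed
qed

text \<open>The range \<open>R \<le> r \<le> 2 R\<close> with \<open>R = 1 + t + |x|\<^sup>2\<close> alone gives the bound, since there the Gaussian factor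
  is bounded below.\<close>

lemma heat_mixture_lower:
  assumes k: "k + 1 < real DIM('a) / 2"
  shows "\<exists>c>0. \<forall>t\<ge>0. \<forall>x::'a::euclidean_space.
    c * (1 + t + (norm x)\<^sup>2) powr (k + 1 - real DIM('a) / 2) \<le> heat_mixture a k x t"
proof -
  let ?n = "real DIM('a)"
  let ?A = "(4 * pi * a) powr (- (?n / 2))"
  define c where "c = min 1 (2 powr k) * (?A * 3 powr (- (?n / 2)) * exp (- (1 / (4 * a))))"
  have c: "0 < c" using a by (simp add: c_def)
  show ?thesis
  proof (intro exI[of _ c] conjI allI impI)
    show "0 < c" by (rule c)
    fix t :: real and x :: 'a assume t: "0 \<le> t"
    define R where "R = 1 + t + (norm x)\<^sup>2"
    have R: "1 \<le> R" using t by (simp add: R_def)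
    have low: "c * R powr (k - ?n / 2) * indicator {R..2 * R} r
        \<le> r powr k * heat_kernel a x (t + r) * indicator {1..} r" for r
    proof (cases "r \<in> {R..2 * R}")
      case True
      then have r: "R \<le> r" "r \<le> 2 * R" "1 \<le> r" "0 < t + r" using R t by auto
      have 1: "min 1 (2 powr k) * R powr k \<le> r powr k"
      proof (cases "0 \<le> k")
        case True
        have "min 1 (2 powr k) * R powr k \<le> 1 * R powr k"
          by (intro mult_right_mono) auto
        also have "\<dots> \<le> r powr k" using r R True by (simp add: powr_mono2)
        finally show ?thesis .
      next
        case False
        have "min 1 (2 powr k) * R powr k \<le> 2 powr k * R powr k"
          by (intro mult_right_mono) auto
        also have "\<dots> = (2 * R) powr k" using R by (simp add: powr_mult)
        also have "\<dots> \<le> r powr k" using r R False by (intro powr_mono2') auto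
        finally show ?thesis .
      qed
      have "t \<le> R" by (simp add: R_def)
      then have "t + r \<le> 3 * R" using r(2) by linarith
      then have 2: "(3 * R) powr (- (?n / 2)) \<le> (t + r) powr (- (?n / 2))"
        using r by (intro powr_mono2') auto
      have "(norm x)\<^sup>2 \<le> t + r" using r t by (simp add: R_def)
      then have "(norm x)\<^sup>2 / (4 * a * (t + r)) \<le> (t + r) / (4 * a * (t + r))"
        using r a by (intro divide_right_mono) auto
      also have "\<dots> = 1 / (4 * a)" using r by simp
      finally have 3: "exp (- (1 / (4 * a))) \<le> exp (- ((norm x)\<^sup>2 / (4 * a * (t + r))))"
        by simp
      have "c * R powr (k - ?n / 2)
          = (min 1 (2 powr k) * R powr k) * (?A * ((3 * R) powr (- (?n / 2)) * exp (- (1 / (4 * a)))))"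
      proof -
        have "R powr (k - ?n / 2) = R powr k * R powr (- (?n / 2))"
          by (simp add: powr_add[symmetric])
        moreover have "(3 * R) powr (- (?n / 2)) = 3 powr (- (?n / 2)) * R powr (- (?n / 2))"
          by (rule powr_mult)
        ultimately show ?thesis by (simp only: c_def mult_ac)
      qed
      also have "\<dots> \<le> r powr k * (?A * ((t + r) powr (- (?n / 2)) * exp (- ((norm x)\<^sup>2 / (4 * a * (t + r))))))"
        using 1 2 3 by (intro mult_mono mult_left_mono) auto
      also have "\<dots> = r powr k * heat_kernel a x (t + r)"
        unfolding heat_kernel_def powr_mult[of "4 * pi * a" "t + r"] by (simp only: mult_ac)
      finally show ?thesis using True r by simp
    qed (auto simp: heat_kernel_nonneg)
    have "(\<integral>r. c * R powr (k - ?n / 2) * indicator {R..2 * R} r \<partial>lborel) \<le> heat_mixture a k x t"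
      unfolding heat_mixture_def
    proof (rule integral_mono)
      show "integrable lborel (\<lambda>r. c * R powr (k - ?n / 2) * indicator {R..2 * R} r)"
        using R by (intro integrable_mult_right integrable_real_indicator) auto
      show "integrable lborel (\<lambda>r. r powr k * heat_kernel a x (t + r) * indicator {1..} r)"
        using k t by (intro heat_mixture_integrable) auto
    qed (rule low)
    moreover have "(\<integral>r. c * R powr (k - ?n / 2) * indicator {R..2 * R} r \<partial>lborel)
        = c * (R powr (k - ?n / 2) * R)"
      using R by simp
    moreover have "R powr (k - ?n / 2) * R = R powr (k + 1 - ?n / 2)"
      using R powr_add[of R "k - ?n / 2" 1] by (simp add: algebra_simps)
    ultimately show "c * (1 + t + (norm x)\<^sup>2) powr (k + 1 - ?n / 2) \<le> heat_mixture a k x t"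
      unfolding R_def[symmetric] by (simp only:)
  qed
qed

end

lemma heat_mixture_bounded:
  assumes a: "0 < a" and k: "k + 1 < real DIM('a) / 2"
  shows "\<exists>C>0. \<forall>t\<ge>0. \<forall>x::'a::euclidean_space. heat_mixture a k x t \<le> C"
proof -
  let ?n = "real DIM('a)"
  define m where "m = max (k + 1) (?n / 4)"
  have m: "0 < m" "k + 1 \<le> m" "m < ?n / 2"
    unfolding m_def max_less_iff_conj less_max_iff_disj using k DIM_positive[where 'a='a] by auto
  obtain C where C: "0 < C" "\<And>t (x::'a). 0 \<le> t \<Longrightarrow>
      heat_mixture a k x t \<le> C * (1 + t + (norm x)\<^sup>2) powr (m - ?n / 2)"
    using heat_mixture_upper[OF a m] by blast
  have "heat_mixture a k y t \<le> C" if t: "0 \<le> t" for y :: 'a and t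
  proof -
    have "(1 + t + (norm y)\<^sup>2) powr (m - ?n / 2) \<le> (1 + t + (norm y)\<^sup>2) powr 0"
      using t m by (intro powr_mono) auto
    also have "\<dots> = 1" using t by (simp add: add_nonneg_eq_0_iff)
    finally have "C * (1 + t + (norm y)\<^sup>2) powr (m - ?n / 2) \<le> C * 1"
      using C(1) by (intro mult_left_mono) auto
    then show ?thesis using C(2)[OF t, of y] by linarith
  qed
  then show ?thesis using C(1) by blast
qed

context dispersal
begin

lemma nonlocal_op_heat_mixture:
  fixes x :: 'a
  assumes k: "k + 1 < real DIM('a) / 2" and t: "0 \<le> t"
  shows "nonlocal_op J (\<lambda>y. heat_mixture (diffusivity J) k y t) x
    = (\<integral>r. r powr k * nonlocal_op J (\<lambda>y. heat_kernel (diffusivity J) y (t + r)) x * indicator {1..} r \<partial>lborel)"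
proof -
  define a where "a = diffusivity J"
  have a: "0 < a" using diffusivity_pos by (simp add: a_def)
  let ?n = "real DIM('a)" 
  obtain C where C: "\<And>t (x::'a). 0 \<le> t \<Longrightarrow> heat_mixture a k x t \<le> C"
    using heat_mixture_bounded[OF a k] by blast
  have Vb: "\<bar>heat_mixture a k y t\<bar> \<le> C" for y :: 'a
    using C[OF t, of y] by (simp add: heat_mixture_nonneg)
  have V_meas: "(\<lambda>y. heat_mixture a k y t) \<in> borel_measurable lebesgue"
    by (rule measurable_completion) simp
  let ?F = "\<lambda>y r. J (x - y) * (r powr k * heat_kernel a y (t + r) * indicator {1..} r)"
  have inner: "(\<integral>r. ?F y r \<partial>lborel) = J (x - y) * heat_mixture a k y t" for y
    unfolding heat_mixture_def by simp
  have F_abs: "\<bar>?F y r\<bar> = ?F y r" for y r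
    by (simp add: J_nonneg heat_kernel_nonneg)
  have int_JV: "integrable lborel (\<lambda>y. J (x - y) * heat_mixture a k y t)"
    using integrable_J_mult[OF V_meas Vb, of x] by (subst (asm) integrable_completion) auto
  have F_int: "integrable (lborel \<Otimes>\<^sub>M lborel) (\<lambda>(y, r). ?F y r)"
  proof (rule lborel_pair.Fubini_integrable)
    show "(\<lambda>(y, r). ?F y r) \<in> borel_measurable (lborel \<Otimes>\<^sub>M lborel)" by measurable
    show "integrable lborel (\<lambda>y. \<integral>r. norm (case (y, r) of (y, r) \<Rightarrow> ?F y r) \<partial>lborel)"
      unfolding prod.case real_norm_def F_abs inner by (rule int_JV)
    show "AE y in lborel. integrable lborel (\<lambda>r. case (y, r) of (y, r) \<Rightarrow> ?F y r)"
      using heat_mixture_integrable[OF a k, of t] t by (intro AE_I2) simp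
  qed
  have "nonlocal_op J (\<lambda>y. heat_mixture a k y t) x
      = (\<integral>y. J (x - y) * heat_mixture a k y t \<partial>lebesgue) - heat_mixture a k x t"
    by (rule nonlocal_op_eq[OF V_meas Vb])
  also have "(\<integral>y. J (x - y) * heat_mixture a k y t \<partial>lebesgue) = (\<integral>y. (\<integral>r. ?F y r \<partial>lborel) \<partial>lborel)"
    unfolding inner by (rule integral_completion) measurable
  also have "\<dots> = (\<integral>r. (\<integral>y. ?F y r \<partial>lborel) \<partial>lborel)"
    by (rule lborel_pair.Fubini_integral[OF F_int, symmetric])
  also have "\<dots> - heat_mixture a k x t
      = (\<integral>r. (\<integral>y. ?F y r \<partial>lborel) - r powr k * heat_kernel a x (t + r) * indicator {1..} r \<partial>lborel)"
    unfolding heat_mixture_def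
    using lborel_pair.integrable_snd[OF F_int] heat_mixture_integrable[OF a k, of t x] t
    by (intro Bochner_Integration.integral_diff[symmetric]) auto
  also have "\<dots> = (\<integral>r. r powr k * nonlocal_op J (\<lambda>y. heat_kernel a y (t + r)) x * indicator {1..} r \<partial>lborel)"
  proof (rule Bochner_Integration.integral_cong[OF refl])
    fix r :: real
    show "(\<integral>y. ?F y r \<partial>lborel) - r powr k * heat_kernel a x (t + r) * indicator {1..} r
        = r powr k * nonlocal_op J (\<lambda>y. heat_kernel a y (t + r)) x * indicator {1..} r"
    proof (cases "1 \<le> r")
      case True
      have hb: "\<bar>heat_kernel a y (t + r)\<bar> \<le> (4 * pi * a) powr (- (?n / 2)) * (t + r) powr (- (?n / 2))" for y :: 'a
        using heat_kernel_le_powr[OF a, of "t + r" y] t True by (simp add: heat_kernel_nonneg)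
      have hm: "(\<lambda>y::'a. heat_kernel a y (t + r)) \<in> borel_measurable lebesgue"
        by (rule measurable_completion) simp
      have "(\<integral>y. ?F y r \<partial>lborel) = r powr k * (\<integral>y. J (x - y) * heat_kernel a y (t + r) \<partial>lborel)"
        using True by (simp add: mult.left_commute)
      also have "(\<integral>y. J (x - y) * heat_kernel a y (t + r) \<partial>lborel)
          = (\<integral>y. J (x - y) * heat_kernel a y (t + r) \<partial>lebesgue)"
        by (rule integral_completion[symmetric]) measurable
      finally show ?thesis
        using nonlocal_op_eq[OF hm hb, of x] True by (simp add: right_diff_distrib)
    qed simp
  qed
  finally show ?thesis by (simp add: a_def)
qed

theorem heat_mixture_consistency:
  assumes k: "k + 1 < real DIM('a) / 2" and m: "0 < m" "k + 1 \<le> m" "m < real DIM('a) / 2 + 3 / 2"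
  shows "\<exists>C>0. \<forall>t\<ge>0. \<forall>x.
     \<bar>nonlocal_op J (\<lambda>y. heat_mixture (diffusivity J) k y t) x - heat_mixture_dt (diffusivity J) k x t\<bar>
       \<le> C * (1 + t + (norm x)\<^sup>2) powr (m - real DIM('a) / 2 - 3 / 2)"
proof -
  define a where "a = diffusivity J"
  have a: "0 < a" using diffusivity_pos by (simp add: a_def)
  let ?n = "real DIM('a)" 
  obtain C where C: "0 < C" "\<And>t (x::'a). 1 \<le> t \<Longrightarrow>
      \<bar>nonlocal_op J (\<lambda>y. heat_kernel a y t) x - heat_kernel_dt a x t\<bar>
       \<le> C * (t + (norm x)\<^sup>2) powr (- (?n / 2) - 3 / 2)"
    using heat_kernel_consistency unfolding a_def by blast
  show ?thesis
    unfolding a_def[symmetric]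
  proof (intro exI conjI allI impI)
    show "0 < C * (1 / m + 1 / ((?n / 2 + 3 / 2) - m))"
      using C m by (intro mult_pos_pos add_pos_pos) auto
    fix t :: real and x :: 'a assume t: "0 \<le> t"
    let ?e = "\<lambda>r. nonlocal_op J (\<lambda>y. heat_kernel a y (t + r)) x"
    have e_meas [measurable]: "?e \<in> borel_measurable borel"
    proof -
      have "nonlocal_op J (\<lambda>y. heat_kernel a y (t + r)) x
          = (\<integral>y. J (x - y) * (heat_kernel a y (t + r) - heat_kernel a x (t + r)) \<partial>lborel)" for r
        unfolding nonlocal_op_def by (rule integral_completion) measurable
      then show ?thesis by simp
    qed
    let ?g = "\<lambda>r. r powr k * (?e r - heat_kernel_dt a x (t + r))"
    define m' where "m' = max (k + 1) (?n / 4)"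
    have m': "0 < m'" "k + 1 \<le> m'" "m' < ?n / 2"
      unfolding m'_def max_less_iff_conj less_max_iff_disj using k DIM_positive[where 'a='a] by auto
    have int_dt: "integrable lborel (\<lambda>r. r powr k * heat_kernel_dt a x (t + r) * indicator {1..} r)"
    proof (rule mixture_integral_bound(1)[where k = k and m = m'])
      fix r :: real assume r: "1 \<le> r"
      let ?c = "(4 * pi * a) powr (- (?n / 2)) * (1 + ?n / 2)"
      have "\<bar>heat_kernel_dt a x (t + r)\<bar> \<le> ?c * (t + r) powr (- (?n / 2) - 1)"
        using a t r by (intro abs_heat_kernel_dt_le) auto
      then have "r powr k * \<bar>heat_kernel_dt a x (t + r)\<bar> \<le> r powr k * (?c * (t + r) powr (- (?n / 2) - 1))"
        by (rule mult_left_mono) simp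
      then show "\<bar>r powr k * heat_kernel_dt a x (t + r)\<bar>
          \<le> ?c * (r powr k * (t + r + 0) powr (- (?n / 2 + 1)))"
        by (simp add: abs_mult mult.left_commute)
    qed (use m' t in auto)
    have g_le: "\<bar>?g r\<bar> \<le> C * (r powr k * (t + r + (norm x)\<^sup>2) powr (- (?n / 2 + 3 / 2)))"
      if r: "1 \<le> r" for r
    proof -
      have "r powr k * \<bar>?e r - heat_kernel_dt a x (t + r)\<bar>
          \<le> r powr k * (C * (t + r + (norm x)\<^sup>2) powr (- (?n / 2) - 3 / 2))"
        using C(2)[of "t + r" x] t r by (intro mult_left_mono) auto
      then show ?thesis by (simp add: abs_mult mult.left_commute)
    qed
    have int_g: "integrable lborel (\<lambda>r. ?g r * indicator {1..} r)"
      by (rule mixture_integral_bound(1)[where k = k and m = m, OF _ _ _ _ _ _ _ g_le])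
        (use m t C in auto)
    have bound: "\<bar>\<integral>r. ?g r * indicator {1..} r \<partial>lborel\<bar>
        \<le> C * (1 / m + 1 / ((?n / 2 + 3 / 2) - m)) * (1 + t + (norm x)\<^sup>2) powr (m - (?n / 2 + 3 / 2))"
      by (rule mixture_integral_bound(2)[where k = k, OF _ _ _ _ _ _ _ g_le])
        (use m t C in auto)
    have split: "r powr k * ?e r * indicator {1..} r
        = ?g r * indicator {1..} r + r powr k * heat_kernel_dt a x (t + r) * indicator {1..} r" for r
      by (simp add: algebra_simps)
    have "nonlocal_op J (\<lambda>y. heat_mixture a k y t) x
        = (\<integral>r. ?g r * indicator {1..} r \<partial>lborel) + heat_mixture_dt a k x t"
      unfolding nonlocal_op_heat_mixture[OF k t, folded a_def] heat_mixture_dt_def split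
      using int_g int_dt by (rule Bochner_Integration.integral_add)
    then show "\<bar>nonlocal_op J (\<lambda>y. heat_mixture a k y t) x - heat_mixture_dt a k x t\<bar>
        \<le> C * (1 / m + 1 / ((?n / 2 + 3 / 2) - m)) * (1 + t + (norm x)\<^sup>2) powr (m - ?n / 2 - 3 / 2)"
      using bound by (simp add: diff_diff_eq)
  qed
qed

end

section \<open>Barriers for nonlocal diffusion with absorption\<close>

lemma lebesgue_measurable_AE_eq:
  fixes f g :: "'a::euclidean_space \<Rightarrow> real"
  assumes g [measurable]: "g \<in> borel_measurable borel" and eq: "AE x in lborel. f x = g x"
  shows "f \<in> borel_measurable lebesgue"
proof (rule borel_measurableI)
  fix S :: "real set" assume S: "open S"
  have "g -` S \<in> sets lebesgue"
    using measurable_sets[OF measurable_completion[of g lborel borel], of S] S by simp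
  moreover have "AE x in lebesgue. x \<in> g -` S \<longleftrightarrow> x \<in> f -` S"
    by (rule AE_completion) (use eq in \<open>eventually_elim, auto\<close>)
  ultimately show "f -` S \<inter> space lebesgue \<in> sets lebesgue"
    using completion.in_sets_AE[of "g -` S" "f -` S" lborel] by simp
qed

text \<open>Joint Lebesgue measurability only makes almost every section measurable. Continuity in time carries this
  over to every \<open>t\<close>, as a limit of sections at measurable times.\<close>

lemma section_measurable_of_continuous_in_time:
  fixes u :: "'a::euclidean_space \<Rightarrow> real \<Rightarrow> real"
  assumes meas: "(\<lambda>(x, t). u x t) \<in> borel_measurable (lebesgue_on (UNIV \<times> {0..}))"
    and cont: "\<And>x. continuous_on {0..} (u x)" and t: "0 \<le> t"
  shows "(\<lambda>x. u x t) \<in> borel_measurable lebesgue"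
proof -
  let ?S = "UNIV \<times> {0..} :: ('a \<times> real) set"
  have "closed ?S" by (intro closed_Times) auto
  then have "?S \<in> sets lebesgue" by (simp add: borel_closed)
  then have "(\<lambda>z. if z \<in> ?S then (\<lambda>(x, t). u x t) z else 0) \<in> borel_measurable lebesgue"
    using meas by (simp only: borel_measurable_if)
  from completion_ex_borel_measurable_real[OF this]
  obtain g where g: "g \<in> borel_measurable lborel"
    "AE z in lborel. (if z \<in> ?S then (\<lambda>(x, t). u x t) z else 0) = g z"
    by blast
  from g(2) obtain N where N: "N \<in> null_sets lborel"
    "\<And>z. z \<notin> N \<Longrightarrow> (if z \<in> ?S then (\<lambda>(x, t). u x t) z else 0) = g z"
    by (auto elim!: AE_E3)
  have gm [measurable]: "g \<in> borel_measurable (borel \<Otimes>\<^sub>M borel)"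
    using g(1) by (simp add: borel_prod)
  have Nm [measurable]: "N \<in> sets (borel \<Otimes>\<^sub>M borel)"
    using N(1) by (subst borel_prod) (auto simp: null_sets_def)
  have "AE z in lborel \<Otimes>\<^sub>M lborel. z \<notin> N"
    unfolding lborel_prod by (rule AE_not_in[OF N(1)])
  then have "AE x in lborel. AE t in lborel. (x, t) \<notin> N"
    by (rule lborel_pair.AE_pair)
  moreover have "{z \<in> space (lborel \<Otimes>\<^sub>M lborel). (fst z, snd z) \<notin> N} \<in> sets (lborel \<Otimes>\<^sub>M lborel :: ('a \<times> real) measure)"
    by measurable
  ultimately have "AE t in lborel. AE x in lborel. (x, t) \<notin> N"
    using lborel_pair.AE_commute[of "\<lambda>x t. (x, t) \<notin> N"] by blast
  then have good: "AE s in lborel. 0 \<le> s \<longrightarrow> (\<lambda>x. u x s) \<in> borel_measurable lebesgue"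
  proof eventually_elim
    case (elim s)
    show ?case
    proof
      assume s: "0 \<le> s"
      show "(\<lambda>x. u x s) \<in> borel_measurable lebesgue"
      proof (rule lebesgue_measurable_AE_eq)
        show "(\<lambda>x. g (x, s)) \<in> borel_measurable borel" by measurable
        show "AE x in lborel. u x s = g (x, s)"
          using elim by eventually_elim (use N(2)[of "(_, s)"] s in force)
      qed
    qed
  qed
  have "\<exists>s. t < s \<and> s < t + 1 / Suc n \<and> (\<lambda>x. u x s) \<in> borel_measurable lebesgue" for n
  proof (rule ccontr)
    assume *: "\<nexists>s. t < s \<and> s < t + 1 / Suc n \<and> (\<lambda>x. u x s) \<in> borel_measurable lebesgue"
    from good have "AE s in lborel. s \<notin> {t<..<t + 1 / Suc n}"
      by eventually_elim (use * t in auto)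
    then have "{t<..<t + 1 / Suc n} \<in> null_sets lborel"
      by (subst AE_iff_null_sets) auto
    then have "emeasure lborel {t<..<t + 1 / Suc n} = 0" by (rule null_setsD1)
    moreover have "emeasure lborel {t<..<t + 1 / Suc n} = ennreal (1 / Suc n)"
      by (subst emeasure_lborel_Ioo) auto
    ultimately show False by simp
  qed
  then obtain s where s: "\<And>n. t < s n" "\<And>n. s n < t + 1 / Suc n"
    "\<And>n. (\<lambda>x. u x (s n)) \<in> borel_measurable lebesgue"
    by metis
  have "s \<longlonglongrightarrow> t"
  proof (rule tendsto_sandwich[where f = "\<lambda>_. t" and h = "\<lambda>n. t + 1 / Suc n"])
    show "(\<lambda>n. t + 1 / Suc n) \<longlonglongrightarrow> t"
      using tendsto_add[OF tendsto_const LIMSEQ_inverse_real_of_nat, of t]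
      by (simp add: inverse_eq_divide del: of_nat_Suc)
    show "eventually (\<lambda>n. t \<le> s n) sequentially" "eventually (\<lambda>n. s n \<le> t + 1 / Suc n) sequentially"
      using s(1,2) by (auto intro!: always_eventually less_imp_le)
  qed simp
  show ?thesis
  proof (rule borel_measurable_LIMSEQ_real)
    show "(\<lambda>x. u x (s n)) \<in> borel_measurable lebesgue" for n by (rule s(3))
    fix x :: 'a
    show "(\<lambda>n. u x (s n)) \<longlonglongrightarrow> u x t"
      using continuous_on_tendsto_compose[OF cont \<open>s \<longlonglongrightarrow> t\<close>] s(1) t
      by (simp add: less_imp_le order_trans[OF t] always_eventually)
  qed
qed

lemma nonlocal_solution_facts:
  fixes u :: "'a::euclidean_space \<Rightarrow> real \<Rightarrow> real"
  assumes sol: "nonlocal_solution J p u0 u"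
  shows nonlocal_solution_continuous: "continuous_on {0..} (u x)"
    and nonlocal_solution_measurable: "0 \<le> t \<Longrightarrow> (\<lambda>x. u x t) \<in> borel_measurable lebesgue"
    and nonlocal_solution_nonneg: "0 \<le> t \<Longrightarrow> 0 \<le> u x t"
    and nonlocal_solution_deriv: "0 < t \<Longrightarrow>
      (u x has_real_derivative nonlocal_op J (\<lambda>y. u y t) x - u x t powr p) (at t)"
    and nonlocal_solution_init: "u x 0 = u0 x"
    and nonlocal_solution_bounded: "\<exists>B. \<forall>t\<ge>0. \<forall>x. \<bar>u x t\<bar> \<le> B"
proof -
  note s = sol[unfolded nonlocal_solution_def]
  show cont: "continuous_on {0..} (u x)" for x
  proof -
    obtain v where "\<forall>t\<ge>0. (u x has_real_derivative v t) (at t within {0..})"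
      using s by blast
    then show ?thesis by (intro DERIV_continuous_on) auto
  qed
  show "0 \<le> t \<Longrightarrow> (\<lambda>x. u x t) \<in> borel_measurable lebesgue"
    using s cont by (intro section_measurable_of_continuous_in_time) blast+
  show "0 \<le> t \<Longrightarrow> 0 \<le> u x t" using s by blast
  show "0 < t \<Longrightarrow> (u x has_real_derivative nonlocal_op J (\<lambda>y. u y t) x - u x t powr p) (at t)"
    using s unfolding nonlocal_op_def by blast
  show "u x 0 = u0 x" using s by blast
  obtain B where "\<forall>z\<in>(\<lambda>(x, t). u x t) ` (UNIV \<times> {0..}). norm z \<le> B"
    using s unfolding bounded_iff by blast
  then have "\<forall>t\<ge>0. \<forall>x. \<bar>u x t\<bar> \<le> B" by fastforce
  then show "\<exists>B. \<forall>t\<ge>0. \<forall>x. \<bar>u x t\<bar> \<le> B" by blast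
qed

context dispersal
begin

text \<open>Both sides are compared with powers of \<open>R = 1 + t + |x|\<^sup>2\<close>. Passing from \<open>k\<close> to \<open>k - \<kappa>\<close>, and the loss \<open>\<kappa>\<close>
  in \<open>mixture_integral_bound\<close>, together cost the factor \<open>R\<^bsup>2\<kappa>\<^esup>\<close>, which is little compared with
  the gain \<open>R\<^bsup>-3/2\<^esup>\<close> from the consistency of the heat kernel.\<close>

lemma consistency_absorbed:
  assumes k: "0 \<le> k + 1" "k + 1 < real DIM('a) / 2" and \<kappa>: "0 < \<kappa>" "\<kappa> \<le> 1 / 8"
    and k': "k' = k \<or> k' = k - \<kappa>" and \<delta>: "0 < \<delta>" "\<delta> \<le> 1 / 4"
  shows "\<exists>C>0. \<forall>t\<ge>0. \<forall>x.
     \<bar>nonlocal_op J (\<lambda>y. heat_mixture (diffusivity J) k' y t) x - heat_mixture_dt (diffusivity J) k' x t\<bar>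
       \<le> C * ((1 + t) powr (- 1 - \<delta>) * heat_mixture (diffusivity J) (k - \<kappa>) x t)"
proof -
  define a where "a = diffusivity J"
  have a: "0 < a" using diffusivity_pos by (simp add: a_def)
  let ?n = "real DIM('a)" 
  define m where "m = k + 1 + \<kappa>"
  have k'2: "k' + 1 < ?n / 2" using k \<kappa> k' by auto
  obtain C where C: "0 < C" "\<And>t x. 0 \<le> t \<Longrightarrow>
      \<bar>nonlocal_op J (\<lambda>y. heat_mixture a k' y t) x - heat_mixture_dt a k' x t\<bar>
       \<le> C * (1 + t + (norm x)\<^sup>2) powr (m - ?n / 2 - 3 / 2)"
    using heat_mixture_consistency[OF k'2, of m] k \<kappa> k' unfolding m_def a_def by auto
  obtain c where c: "0 < c" "\<And>t x. 0 \<le> t \<Longrightarrow>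
      c * (1 + t + (norm (x::'a))\<^sup>2) powr (k - \<kappa> + 1 - ?n / 2) \<le> heat_mixture a (k - \<kappa>) x t"
    using heat_mixture_lower[OF a, of "k - \<kappa>", where 'a='a] k \<kappa> by auto
  show ?thesis
    unfolding a_def[symmetric]
  proof (intro exI conjI allI impI)
    show "0 < C / c" using C c by simp
    fix t :: real and x :: 'a assume t: "0 \<le> t"
    define R where "R = 1 + t + (norm x)\<^sup>2"
    have R: "1 \<le> R" "1 + t \<le> R" using t by (auto simp: R_def)
    have split: "R powr (m - ?n / 2 - 3 / 2) = R powr (2 * \<kappa> - 3 / 2) * R powr (k - \<kappa> + 1 - ?n / 2)"
      by (simp add: powr_add[symmetric] m_def algebra_simps)
    have "R powr (2 * \<kappa> - 3 / 2) \<le> R powr (- 1 - \<delta>)"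
      using R \<kappa> \<delta> by (intro powr_mono) auto
    also have "\<dots> \<le> (1 + t) powr (- 1 - \<delta>)"
      using R t \<delta> by (intro powr_mono2') auto
    finally have 1: "R powr (2 * \<kappa> - 3 / 2) \<le> (1 + t) powr (- 1 - \<delta>)" .
    have 2: "R powr (k - \<kappa> + 1 - ?n / 2) \<le> heat_mixture a (k - \<kappa>) x t / c"
      using c(2)[OF t, of x] c(1) by (simp add: R_def pos_le_divide_eq mult.commute)
    have "\<bar>nonlocal_op J (\<lambda>y. heat_mixture a k' y t) x - heat_mixture_dt a k' x t\<bar>
        \<le> C * (R powr (2 * \<kappa> - 3 / 2) * R powr (k - \<kappa> + 1 - ?n / 2))"
      using C(2)[OF t, of x] by (simp add: R_def[symmetric] split)
    also have "\<dots> \<le> C * ((1 + t) powr (- 1 - \<delta>) * (heat_mixture a (k - \<kappa>) x t / c))"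
      using 1 2 C(1) by (intro mult_left_mono mult_mono) auto
    finally show "\<bar>nonlocal_op J (\<lambda>y. heat_mixture a k' y t) x - heat_mixture_dt a k' x t\<bar>
        \<le> C / c * ((1 + t) powr (- 1 - \<delta>) * heat_mixture a (k - \<kappa>) x t)"
      by simp
  qed
qed

text \<open>The barrier is \<open>A V\<^sub>k + b(t) V\<^bsub>k-\<kappa>\<^esub>\<close>. Its defect as a supersolution and the source term
  are both multiples of \<open>(1 + t)\<^bsup>-1-\<delta>\<^esup> V\<^bsub>k-\<kappa>\<^esub>\<close>, and they are compensated by \<open>b' V\<^bsub>k-\<kappa>\<^esub>\<close> when \<open>b\<close> solves
  \<open>b' = c\<^sub>2 (1 + t)\<^bsup>-1-\<delta>\<^esup> b\<close> with large initial value; such a \<open>b\<close> stays bounded. The sign of \<open>A\<close> is arbitrary,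
  so that the lemma yields upper bounds for \<open>u\<close> and, applied to \<open>-u\<close>, lower ones.\<close>

theorem mixture_barrier:
  fixes w w' :: "'a \<Rightarrow> real \<Rightarrow> real"
  assumes k: "0 \<le> k + 1" "k + 1 < real DIM('a) / 2" and \<kappa>: "0 < \<kappa>" "\<kappa> \<le> 1 / 8"
    and \<delta>: "0 < \<delta>" "\<delta> \<le> 1 / 4"
    and meas: "\<And>t. 0 \<le> t \<Longrightarrow> (\<lambda>x. w x t) \<in> borel_measurable lebesgue"
    and bdd: "\<And>x t. 0 \<le> t \<Longrightarrow> \<bar>w x t\<bar> \<le> W"
    and cont: "\<And>x. continuous_on {0..} (w x)"
    and deriv: "\<And>x t. 0 < t \<Longrightarrow> (w x has_real_derivative w' x t) (at t)"
    and sub: "\<And>x t. 0 < t \<Longrightarrow> w' x t \<le> nonlocal_op J (\<lambda>y. w y t) x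
      + Q * ((1 + t) powr (- 1 - \<delta>) * heat_mixture (diffusivity J) (k - \<kappa>) x t)"
    and init: "\<And>x. w x 0 \<le> A * heat_mixture (diffusivity J) k x 0 + D * heat_mixture (diffusivity J) (k - \<kappa>) x 0"
  shows "\<exists>B\<ge>0. \<forall>t\<ge>0. \<forall>x.
    w x t \<le> A * heat_mixture (diffusivity J) k x t + B * heat_mixture (diffusivity J) (k - \<kappa>) x t"
proof -
  define a where "a = diffusivity J"
  have a: "0 < a" using diffusivity_pos by (simp add: a_def)
  let ?V = "heat_mixture a k :: 'a \<Rightarrow> real \<Rightarrow> real" and ?V' = "heat_mixture a (k - \<kappa>) :: 'a \<Rightarrow> real \<Rightarrow> real"
  let ?dV = "heat_mixture_dt a k :: 'a \<Rightarrow> real \<Rightarrow> real" and ?dV' = "heat_mixture_dt a (k - \<kappa>) :: 'a \<Rightarrow> real \<Rightarrow> real"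
  have k': "k - \<kappa> + 1 < real DIM('a) / 2" using k \<kappa> by simp
  obtain C1 where C1: "0 < C1" "\<And>t x. 0 \<le> t \<Longrightarrow>
      \<bar>nonlocal_op J (\<lambda>y. ?V y t) x - ?dV x t\<bar> \<le> C1 * ((1 + t) powr (- 1 - \<delta>) * ?V' x t)"
    using consistency_absorbed[OF k \<kappa> disjI1[OF refl] \<delta>] unfolding a_def by blast
  obtain C2 where C2: "0 < C2" "\<And>t x. 0 \<le> t \<Longrightarrow>
      \<bar>nonlocal_op J (\<lambda>y. ?V' y t) x - ?dV' x t\<bar> \<le> C2 * ((1 + t) powr (- 1 - \<delta>) * ?V' x t)"
    using consistency_absorbed[OF k \<kappa> disjI2[OF refl] \<delta>] unfolding a_def by blast
  obtain V1 where V1: "\<And>t (x::'a). 0 \<le> t \<Longrightarrow> ?V x t \<le> V1"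
    using heat_mixture_bounded[OF a k(2)] by blast
  obtain V2 where V2: "\<And>t (x::'a). 0 \<le> t \<Longrightarrow> ?V' x t \<le> V2"
    using heat_mixture_bounded[OF a k'] by blast
  have V1': "\<bar>?V x t\<bar> \<le> V1" and V2': "\<bar>?V' x t\<bar> \<le> V2" if "0 \<le> t" for x t
    using V1[OF that, of x] V2[OF that, of x] by (simp_all add: heat_mixture_nonneg)
  \<comment> \<open>The part \<open>C2\<close> of the growth rate absorbs the defect of \<open>b V\<^bsub>k-\<kappa>\<^esub>\<close> itself, the part \<open>1\<close> the source and the
    defect of \<open>A V\<^sub>k\<close>, since \<open>b \<ge> q\<close>. The factor \<open>exp (c2 / \<delta>)\<close> in \<open>B\<close> compensates
    the smallest value of the exponential in \<open>b\<close>.\<close>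
  define c2 where "c2 = C2 + 1"
  define q where "q = \<bar>Q\<bar> + \<bar>A\<bar> * C1"
  define B where "B = exp (c2 / \<delta>) * (q + \<bar>D\<bar>)"
  have q: "0 \<le> q" using C1 by (simp add: q_def)
  have B: "0 \<le> B" using q by (simp add: B_def)
  define b where "b t = B * exp (- (c2 / \<delta>) * (1 + t) powr (- \<delta>))" for t
  have c2: "0 < c2" using C2 by (simp add: c2_def)
  have b_ge: "q + \<bar>D\<bar> \<le> b t" if t: "0 \<le> t" for t
  proof -
    have "(1 + t) powr (- \<delta>) \<le> 1 powr (- \<delta>)" using t \<delta> by (intro powr_mono2') auto
    then have "c2 / \<delta> * (1 + t) powr (- \<delta>) \<le> c2 / \<delta> * 1"
      using c2 \<delta> by (intro mult_left_mono) auto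
    then have "exp (- (c2 / \<delta>)) \<le> exp (- (c2 / \<delta>) * (1 + t) powr (- \<delta>))"
      by simp
    then have "B * exp (- (c2 / \<delta>)) \<le> b t"
      unfolding b_def by (rule mult_left_mono[OF _ B])
    moreover have "B * exp (- (c2 / \<delta>)) = q + \<bar>D\<bar>"
      by (simp add: B_def exp_minus)
    ultimately show ?thesis by simp
  qed
  have b_le: "b t \<le> B" if "0 \<le> t" for t
    unfolding b_def using c2 \<delta> B by (intro mult_left_le) auto
  have b_nonneg: "0 \<le> b t" for t using B by (simp add: b_def)
  have b_deriv: "(b has_real_derivative c2 * (1 + t) powr (- 1 - \<delta>) * b t) (at t)" if t: "0 < t" for t
  proof -
    have "((\<lambda>t. (1 + t) powr (- \<delta>)) has_real_derivative - \<delta> * (1 + t) powr (- \<delta> - 1)) (at t)"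
      using t by (auto intro!: derivative_eq_intros)
    from DERIV_cmult[OF DERIV_fun_exp[OF DERIV_cmult[OF this, of "- (c2 / \<delta>)"]], of B]
    have "(b has_real_derivative B * (exp (- (c2 / \<delta>) * (1 + t) powr (- \<delta>)) *
        (- (c2 / \<delta>) * (- \<delta> * (1 + t) powr (- \<delta> - 1))))) (at t)"
      unfolding b_def[abs_def] .
    moreover have "- \<delta> - 1 = - 1 - \<delta>" by simp
    ultimately show ?thesis using \<delta> by (simp add: b_def mult_ac)
  qed
  define z where "z x t = w x t - (A * ?V x t + b t * ?V' x t)" for x t
  have "z x t \<le> 0" if t: "0 \<le> t" for x t
  proof (rule nonlocal_comparison[where w = z and w' = "\<lambda>x t. w' x t - (A * ?dV x t
      + (c2 * (1 + t) powr (- 1 - \<delta>) * b t * ?V' x t + ?dV' x t * b t))", OF _ _ _ _ _ _ t])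
    have Vm: "(\<lambda>x. heat_mixture a l x s :: real) \<in> borel_measurable (lebesgue :: 'a measure)" for l s
      by (rule measurable_completion) simp
    show "(\<lambda>x. z x s) \<in> borel_measurable lebesgue" if "0 \<le> s" for s
      unfolding z_def using meas[OF that] Vm[of k s] Vm[of "k - \<kappa>" s] by measurable
    show "\<bar>z x s\<bar> \<le> W + (\<bar>A\<bar> * V1 + B * V2)" if s: "0 \<le> s" for x s
    proof -
      have "\<bar>A * ?V x s\<bar> = \<bar>A\<bar> * \<bar>?V x s\<bar>" "\<bar>b s * ?V' x s\<bar> = b s * \<bar>?V' x s\<bar>"
        using b_nonneg[of s] by (simp_all add: abs_mult)
      then have "\<bar>z x s\<bar> \<le> \<bar>w x s\<bar> + (\<bar>A\<bar> * \<bar>?V x s\<bar> + b s * \<bar>?V' x s\<bar>)"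
        unfolding z_def by linarith
      also have "\<dots> \<le> W + (\<bar>A\<bar> * V1 + B * V2)"
        using bdd[OF s, of x] V1'[OF s, of x] V2'[OF s, of x] b_le[OF s] B
        by (intro add_mono mult_mono) auto
      finally show ?thesis .
    qed
    have Vd: "((\<lambda>t. ?V x t) has_real_derivative ?dV x s) (at s)" if "0 \<le> s" for x s
      by (rule heat_mixture_has_derivative[OF a k(2) that])
    have Vd': "((\<lambda>t. ?V' x t) has_real_derivative ?dV' x s) (at s)" if "0 \<le> s" for x s
      by (rule heat_mixture_has_derivative[OF a k' that])
    show "continuous_on {0..} (z x)" for x
    proof -
      have "continuous_on {0..} (\<lambda>t. ?V x t)" "continuous_on {0..} (\<lambda>t. ?V' x t)"
        using Vd Vd' by (auto intro!: continuous_at_imp_continuous_on DERIV_isCont)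
      moreover have "continuous_on {0..} b"
        unfolding b_def[abs_def] by (intro continuous_intros) auto
      ultimately show ?thesis
        unfolding z_def[abs_def] using cont[of x] by (intro continuous_intros)
    qed
    show "(z x has_real_derivative w' x s - (A * ?dV x s
      + (c2 * (1 + s) powr (- 1 - \<delta>) * b s * ?V' x s + ?dV' x s * b s))) (at s)" if s: "0 < s" for x s
      unfolding z_def[abs_def]
      using s by (intro DERIV_diff DERIV_add DERIV_cmult DERIV_mult deriv Vd Vd' b_deriv) auto
    show "w' x s - (A * ?dV x s
      + (c2 * (1 + s) powr (- 1 - \<delta>) * b s * ?V' x s + ?dV' x s * b s)) \<le> nonlocal_op J (\<lambda>y. z y s) x"
      if s: "0 < s" for x s
    proof -
      have s0: "0 \<le> s" using s by simp
      define E where "E = (1 + s) powr (- 1 - \<delta>) * ?V' x s"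
      have E: "0 \<le> E" by (simp add: E_def heat_mixture_nonneg)
      let ?L = "\<lambda>f. nonlocal_op J f x"
      have Lz: "?L (\<lambda>y. z y s) = ?L (\<lambda>y. w y s) - (A * ?L (\<lambda>y. ?V y s) + b s * ?L (\<lambda>y. ?V' y s))"
        unfolding z_def
        by (rule nonlocal_op_lincomb[OF meas[OF s0] bdd[OF s0] Vm V1'[OF s0] Vm V2'[OF s0]])
      have e1: "A * (?L (\<lambda>y. ?V y s) - ?dV x s) \<le> \<bar>A\<bar> * C1 * E"
      proof -
        have "A * (?L (\<lambda>y. ?V y s) - ?dV x s) \<le> \<bar>A\<bar> * \<bar>?L (\<lambda>y. ?V y s) - ?dV x s\<bar>"
          by (simp add: abs_mult[symmetric])
        also have "\<dots> \<le> \<bar>A\<bar> * (C1 * E)"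
          using C1(2)[OF s0, of x] by (intro mult_left_mono) (auto simp: E_def)
        finally show ?thesis by simp
      qed
      have e2: "b s * (?L (\<lambda>y. ?V' y s) - ?dV' x s) \<le> b s * (C2 * E)"
        using C2(2)[OF s0, of x] by (intro mult_left_mono b_nonneg) (auto simp: E_def)
      have e3: "w' x s \<le> ?L (\<lambda>y. w y s) + \<bar>Q\<bar> * E"
      proof -
        have "Q * E \<le> \<bar>Q\<bar> * E" using E by (intro mult_right_mono) auto
        then show ?thesis using sub[OF s, of x] by (simp add: E_def a_def)
      qed
      have e4: "\<bar>A\<bar> * C1 * E + \<bar>Q\<bar> * E + b s * (C2 * E) \<le> c2 * b s * E"
      proof -
        have "(q + b s * C2) * E \<le> (c2 * b s) * E"
        proof (rule mult_right_mono[OF _ E])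
          have "q \<le> b s" using b_ge[OF s0] by linarith
          then show "q + b s * C2 \<le> c2 * b s" by (simp add: c2_def algebra_simps)
        qed
        then show ?thesis by (simp add: q_def algebra_simps)
      qed
      have E_eq: "c2 * (1 + s) powr (- 1 - \<delta>) * b s * ?V' x s = c2 * b s * E"
        by (simp add: E_def)
      show ?thesis
        unfolding Lz E_eq using e1 e2 e3 e4 by (simp add: algebra_simps)
    qed
    show "z x 0 \<le> 0" for x
    proof -
      have "D * ?V' x 0 \<le> b 0 * ?V' x 0"
        using b_ge[of 0] q by (intro mult_right_mono heat_mixture_nonneg) auto
      then show ?thesis
        using init[of x] by (simp add: z_def a_def)
    qed
  qed
  then have "w x t \<le> A * ?V x t + B * ?V' x t" if t: "0 \<le> t" for x t
    using mult_right_mono[OF b_le[OF t] heat_mixture_nonneg[of a "k - \<kappa>" x t]] t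
    unfolding z_def by (smt (verit))
  then show ?thesis using B unfolding a_def by blast
qed

end

section \<open>Behaviour of the superpositions at spatial infinity\<close>

lemma heat_mixture_mono:
  fixes x :: "'a::euclidean_space"
  assumes a: "0 < a" and k: "k' \<le> k" "k + 1 < real DIM('a) / 2" and t: "0 \<le> t"
  shows "heat_mixture a k' x t \<le> heat_mixture a k x t"
  unfolding heat_mixture_def
proof (rule integral_mono)
  show "integrable lborel (\<lambda>r. r powr k' * heat_kernel a x (t + r) * indicator {1..} r)"
    "integrable lborel (\<lambda>r. r powr k * heat_kernel a x (t + r) * indicator {1..} r)"
    using k t by (auto intro!: heat_mixture_integrable[OF a])
  show "r powr k' * heat_kernel a x (t + r) * indicator {1..} r
      \<le> r powr k * heat_kernel a x (t + r) * indicator {1..} r" for r :: real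
    using k by (auto intro!: mult_right_mono powr_mono heat_kernel_nonneg split: split_indicator)
qed

lemma power2_powr:
  fixes x :: real
  assumes "0 < x"
  shows "(x\<^sup>2) powr e = x powr (2 * e)"
proof -
  have "x\<^sup>2 = x powr 2" using assms by (simp add: powr_numeral)
  then show ?thesis by (simp only: powr_powr)
qed

text \<open>This is the value of \<open>\<integral> r\<^sup>k G(x, r) dr\<close> over \<open>r > 0\<close> at \<open>|x| = 1\<close> in dimension \<open>n\<close>. In closed form it is
  \<open>(4 a)\<^bsup>-k-1\<^esup> \<pi>\<^bsup>-n/2\<^esup> \<Gamma>(n/2 - k - 1)\<close>.\<close>

definition riesz_const :: "real \<Rightarrow> real \<Rightarrow> real \<Rightarrow> real" where
  "riesz_const n a k = (\<integral>r. r powr k * ((4 * pi * a * r) powr (- (n / 2)) * exp (- (1 / (4 * a * r))))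
     * indicator {0..} r \<partial>lborel)"

text \<open>For \<open>k = -1\<close> the measure \<open>r\<^sup>-\<^sup>1 dr\<close> is invariant under the substitution that removes \<open>a\<close>. This is why the
  constant in the critical case is the same for all kernels.\<close>

lemma riesz_const_scale:
  assumes "0 < a"
  shows "riesz_const n a (- 1) = riesz_const n 1 (- 1)"
proof -
  have "riesz_const n 1 (- 1) = \<bar>a\<bar> *\<^sub>R (\<integral>r. (0 + a * r) powr (- 1) *
      ((4 * pi * 1 * (0 + a * r)) powr (- (n / 2)) * exp (- (1 / (4 * 1 * (0 + a * r)))))
      * indicator {0..} (0 + a * r) \<partial>lborel)"
    unfolding riesz_const_def by (rule lborel_integral_real_affine) (use assms in simp)
  also have "\<dots> = (\<integral>r. a * ((0 + a * r) powr (- 1) *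
      ((4 * pi * 1 * (0 + a * r)) powr (- (n / 2)) * exp (- (1 / (4 * 1 * (0 + a * r)))))
      * indicator {0..} (0 + a * r)) \<partial>lborel)"
    by (simp only: integral_mult_right_zero real_scaleR_def abs_of_pos[OF assms])
  also have "\<dots> = riesz_const n a (- 1)"
    unfolding riesz_const_def
  proof (rule Bochner_Integration.integral_cong[OF refl])
    fix r :: real
    have ind: "indicator {0..} (0 + a * r) = (indicator {0..} r :: real)"
      using assms by (auto simp: zero_le_mult_iff split: split_indicator)
    have e: "4 * pi * 1 * (0 + a * r) = 4 * pi * a * r" "4 * 1 * (0 + a * r) = 4 * a * r" by simp_all
    have p: "a * (0 + a * r) powr (- 1) = r powr (- 1)"
      using assms by (simp add: powr_mult powr_minus_divide abs_mult)
    show "a * ((0 + a * r) powr (- 1) *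
        ((4 * pi * 1 * (0 + a * r)) powr (- (n / 2)) * exp (- (1 / (4 * 1 * (0 + a * r)))))
        * indicator {0..} (0 + a * r))
        = r powr (- 1) * ((4 * pi * a * r) powr (- (n / 2)) * exp (- (1 / (4 * a * r)))) * indicator {0..} r"
      unfolding ind e by (simp only: mult.assoc[symmetric] p)
  qed
  finally show ?thesis ..
qed

context
  fixes a k \<alpha> :: real
  assumes a: "0 < a" and \<alpha>: "0 < \<alpha>" and exponent: "2 * k + 2 = real DIM('a::euclidean_space) - \<alpha>"
begin

text \<open>The decay exponent \<open>\<alpha> + 2\<close> is the one for which the powers of \<open>r\<close> cancel exactly; any exponent
  larger than \<open>\<alpha>\<close> makes the short times negligible at infinity.\<close>

lemma mixture_initial_bound:
  "\<exists>C>0. \<forall>x::'a. x \<noteq> 0 \<longrightarrow> (\<forall>r. \<bar>r powr k * heat_kernel a x r * indicator {0..<1} r\<bar>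
     \<le> C * norm x powr (- (\<alpha> + 2)) * indicator {0..1} r)"
proof -
  let ?n = "real DIM('a)"
  have "0 \<le> \<alpha> / 2 + 1" using \<alpha> by simp
  then obtain C where C: "0 < C" "\<And>r (x::'a). 0 < r \<Longrightarrow>
      heat_kernel a x r \<le> C * (r powr (\<alpha> / 2 + 1 - ?n / 2) * (r + (norm x)\<^sup>2) powr (- (\<alpha> / 2 + 1)))"
    using heat_kernel_tail[OF a, where 'a='a] by blast
  have "\<bar>r powr k * heat_kernel a x r * indicator {0..<1} r\<bar> \<le> C * norm x powr (- (\<alpha> + 2)) * indicator {0..1} r"
    if x: "x \<noteq> 0" for x :: 'a and r
  proof (cases "0 < r \<and> r < 1")
    case True
    have "r powr k * heat_kernel a x r
        \<le> r powr k * (C * (r powr (\<alpha> / 2 + 1 - ?n / 2) * (r + (norm x)\<^sup>2) powr (- (\<alpha> / 2 + 1))))"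
      using C(2)[of r x] True by (intro mult_left_mono) auto
    also have "\<dots> = C * (r powr k * r powr (\<alpha> / 2 + 1 - ?n / 2)) * (r + (norm x)\<^sup>2) powr (- (\<alpha> / 2 + 1))"
      by simp
    also have "r powr k * r powr (\<alpha> / 2 + 1 - ?n / 2) = r powr (k + (\<alpha> / 2 + 1 - ?n / 2))"
      by (rule powr_add[symmetric])
    also have "k + (\<alpha> / 2 + 1 - ?n / 2) = 0" using exponent by simp
    also have "r powr 0 = 1" using True by simp
    also have "C * 1 * (r + (norm x)\<^sup>2) powr (- (\<alpha> / 2 + 1)) \<le> C * ((norm x)\<^sup>2) powr (- (\<alpha> / 2 + 1))"
      using C(1) True x \<alpha> by (auto intro!: powr_mono2')
    also have "((norm x)\<^sup>2) powr (- (\<alpha> / 2 + 1)) = norm x powr (- (\<alpha> + 2))"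
      using x power2_powr[of "norm x" "- (\<alpha> / 2 + 1)"] by simp
    finally show ?thesis using True by (simp add: heat_kernel_nonneg)
  next
    case False
    then show ?thesis using C(1) by (auto simp: heat_kernel_def split: split_indicator)
  qed
  then show ?thesis using C(1) by blast
qed

lemma mixture_initial_integrable:
  fixes x :: 'a
  assumes "x \<noteq> 0"
  shows "integrable lborel (\<lambda>r. r powr k * heat_kernel a x r * indicator {0..<1} r)"
proof -
  obtain C where C: "0 < C" "\<And>r. \<bar>r powr k * heat_kernel a x r * indicator {0..<1} r\<bar>
     \<le> C * norm x powr (- (\<alpha> + 2)) * indicator {0..1} r"
    using mixture_initial_bound assms by blast
  show ?thesis
  proof (rule Bochner_Integration.integrable_bound)
    show "integrable lborel (\<lambda>r::real. C * norm x powr (- (\<alpha> + 2)) * indicator {0..1} r)"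
      by (intro integrable_mult_right integrable_real_indicator) auto
    show "AE r in lborel. norm (r powr k * heat_kernel a x r * indicator {0..<1} r)
        \<le> norm (C * norm x powr (- (\<alpha> + 2)) * indicator {0..1} r)"
      using C(2) by (intro AE_I2) (auto intro: order_trans[OF _ abs_ge_self])
  qed simp
qed

lemma exponent_less: "k + 1 < real DIM('a) / 2"
  using \<alpha> exponent by simp

lemma mixture_split:
  fixes x :: 'a
  assumes "x \<noteq> 0"
  shows "integrable lborel (\<lambda>r. r powr k * heat_kernel a x r * indicator {0..} r)"
    and "(\<integral>r. r powr k * heat_kernel a x r * indicator {0..} r \<partial>lborel)
      = (\<integral>r. r powr k * heat_kernel a x r * indicator {0..<1} r \<partial>lborel) + heat_mixture a k x 0"
proof -
  have eq: "(\<lambda>r. r powr k * heat_kernel a x r * indicator {0..} r)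
      = (\<lambda>r. r powr k * heat_kernel a x r * indicator {0..<1} r
        + r powr k * heat_kernel a x (0 + r) * indicator {1..} r)"
    by (auto split: split_indicator)
  note int = mixture_initial_integrable[OF assms] heat_mixture_integrable[OF a exponent_less, of 0 x]
  show "integrable lborel (\<lambda>r. r powr k * heat_kernel a x r * indicator {0..} r)"
    unfolding eq using int by (intro Bochner_Integration.integrable_add) auto
  show "(\<integral>r. r powr k * heat_kernel a x r * indicator {0..} r \<partial>lborel)
      = (\<integral>r. r powr k * heat_kernel a x r * indicator {0..<1} r \<partial>lborel) + heat_mixture a k x 0"
    unfolding eq heat_mixture_def using int by (intro Bochner_Integration.integral_add) auto
qed

lemma riesz_identity:
  fixes x :: 'a
  assumes x: "x \<noteq> 0"
  shows "(\<integral>r. r powr k * heat_kernel a x r * indicator {0..} r \<partial>lborel)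
    = riesz_const (real DIM('a)) a k * norm x powr (- \<alpha>)"
proof -
  let ?n = "real DIM('a)" and ?c = "(norm x)\<^sup>2"
  have c: "0 < ?c" using x by simp
  let ?f = "\<lambda>r. r powr k * ((4 * pi * a * r) powr (- (?n / 2)) * exp (- (1 / (4 * a * r)))) * indicator {0..} r"
  have "(\<integral>r. r powr k * heat_kernel a x r * indicator {0..} r \<partial>lborel)
      = \<bar>?c\<bar> *\<^sub>R (\<integral>r. (0 + ?c * r) powr k * heat_kernel a x (0 + ?c * r) * indicator {0..} (0 + ?c * r) \<partial>lborel)"
    by (rule lborel_integral_real_affine) (use x in simp)
  also have "\<dots> = ?c * (\<integral>r. (?c powr k * ?c powr (- (?n / 2))) * ?f r \<partial>lborel)"
  proof -
    have "(0 + ?c * r) powr k * heat_kernel a x (0 + ?c * r) * indicator {0..} (0 + ?c * r)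
        = (?c powr k * ?c powr (- (?n / 2))) * ?f r" for r
    proof -
      have ind: "indicator {0..} (?c * r) = (indicator {0..} r :: real)"
        using c by (auto simp: zero_le_mult_iff split: split_indicator)
      have p: "(4 * pi * a * (?c * r)) powr (- (?n / 2)) = ?c powr (- (?n / 2)) * (4 * pi * a * r) powr (- (?n / 2))"
        by (subst powr_mult[symmetric]) (simp add: mult_ac)
      have e: "?c / (4 * a * (?c * r)) = 1 / (4 * a * r)" using c by simp
      show ?thesis
        unfolding add_0 ind heat_kernel_def p e powr_mult[of ?c r k] by (simp only: mult_ac)
    qed
    then show ?thesis by simp
  qed
  also have "\<dots> = (?c * (?c powr k * ?c powr (- (?n / 2)))) * riesz_const ?n a k"
    unfolding riesz_const_def by simp
  also have "?c * (?c powr k * ?c powr (- (?n / 2))) = ?c powr (1 + (k + - (?n / 2)))"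
    unfolding powr_add using c by simp
  also have "1 + (k + - (?n / 2)) = - \<alpha> / 2" using exponent by simp
  also have "?c powr (- \<alpha> / 2) = norm x powr (- \<alpha>)"
    using x power2_powr[of "norm x" "- \<alpha> / 2"] by simp
  finally show ?thesis by simp
qed

lemma heat_mixture_initial_asymptotics:
  "((\<lambda>x::'a. norm x powr \<alpha> * heat_mixture a k x 0) \<longlongrightarrow> riesz_const (real DIM('a)) a k) at_infinity"
proof -
  let ?c = "riesz_const (real DIM('a)) a k"
  obtain C where C: "0 < C" "\<And>x r. (x::'a) \<noteq> 0 \<Longrightarrow> \<bar>r powr k * heat_kernel a x r * indicator {0..<1} r\<bar>
     \<le> C * norm x powr (- (\<alpha> + 2)) * indicator {0..1} r"
    using mixture_initial_bound by blast
  have bound: "norm (norm x powr \<alpha> * heat_mixture a k x 0 - ?c) \<le> C * norm x powr (- 2)" if x: "x \<noteq> 0" for x :: 'a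
  proof -
    let ?I = "\<integral>r. r powr k * heat_kernel a x r * indicator {0..<1} r \<partial>lborel"
    have "heat_mixture a k x 0 = ?c * norm x powr (- \<alpha>) - ?I"
      using mixture_split(2)[OF x] riesz_identity[OF x] by simp
    then have "norm x powr \<alpha> * heat_mixture a k x 0 - ?c = - (norm x powr \<alpha> * ?I)"
      using x by (simp add: right_diff_distrib powr_minus field_simps)
    moreover have "\<bar>?I\<bar> \<le> C * norm x powr (- (\<alpha> + 2))"
    proof -
      have "\<bar>?I\<bar> \<le> (\<integral>r. \<bar>r powr k * heat_kernel a x r * indicator {0..<1} r\<bar> \<partial>lborel)"
        using integral_norm_bound[of lborel "\<lambda>r. r powr k * heat_kernel a x r * indicator {0..<1} r"] by simp
      also have "\<dots> \<le> (\<integral>r. C * norm x powr (- (\<alpha> + 2)) * indicator {0..1::real} r \<partial>lborel)"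
      proof (rule integral_mono)
        show "integrable lborel (\<lambda>r. \<bar>r powr k * heat_kernel a x r * indicator {0..<1} r\<bar>)"
          by (rule integrable_abs[OF mixture_initial_integrable[OF x]])
        show "integrable lborel (\<lambda>r. C * norm x powr (- (\<alpha> + 2)) * indicator {0..1::real} r)"
          by (intro integrable_mult_right integrable_real_indicator) auto
      qed (rule C(2)[OF x])
      also have "\<dots> = C * norm x powr (- (\<alpha> + 2))" by simp
      finally show ?thesis .
    qed
    ultimately have "norm (norm x powr \<alpha> * heat_mixture a k x 0 - ?c)
        \<le> norm x powr \<alpha> * (C * norm x powr (- (\<alpha> + 2)))"
      by (simp add: abs_mult mult_left_mono)
    also have "\<dots> = C * norm x powr (- 2)"
      using x by (simp add: powr_add[symmetric])
    finally show ?thesis .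
  qed
  have "((\<lambda>x::'a. norm x powr (- 2)) \<longlongrightarrow> 0) at_infinity"
    by (rule tendsto_neg_powr[OF _ filterlim_norm_at_top]) simp
  then have "((\<lambda>x::'a. C * norm x powr (- 2)) \<longlongrightarrow> C * 0) at_infinity"
    by (intro tendsto_mult tendsto_const)
  then have lim: "((\<lambda>x::'a. C * norm x powr (- 2)) \<longlongrightarrow> 0) at_infinity" by simp
  have "eventually (\<lambda>x::'a. norm (norm x powr \<alpha> * heat_mixture a k x 0 - ?c) \<le> C * norm x powr (- 2)) at_infinity"
    using eventually_not_equal_at_infinity[of 0] by eventually_elim (rule bound)
  then have "((\<lambda>x::'a. norm x powr \<alpha> * heat_mixture a k x 0 - ?c) \<longlongrightarrow> 0) at_infinity"
    using lim by (rule Lim_null_comparison)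
  then show ?thesis by (simp add: Lim_null[symmetric])
qed

lemma riesz_const_pos: "0 < riesz_const (real DIM('a)) a k"
proof -
  obtain x :: 'a where x: "norm x = 1" using vector_choose_size[of 1] by auto
  then have x0: "x \<noteq> 0" by auto
  obtain c where c: "0 < c" "\<And>t (x::'a). 0 \<le> t \<Longrightarrow>
      c * (1 + t + (norm x)\<^sup>2) powr (k + 1 - real DIM('a) / 2) \<le> heat_mixture a k x t"
    using heat_mixture_lower[OF a exponent_less] by blast
  have "0 < c * (1 + 0 + (norm x)\<^sup>2) powr (k + 1 - real DIM('a) / 2)" using c(1) x by simp
  also have "\<dots> \<le> heat_mixture a k x 0" by (rule c(2)) simp
  also have "\<dots> \<le> (\<integral>r. r powr k * heat_kernel a x r * indicator {0..<1} r \<partial>lborel) + heat_mixture a k x 0"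
    by (simp add: heat_kernel_nonneg integral_nonneg_AE)
  also have "\<dots> = riesz_const (real DIM('a)) a k"
    using mixture_split(2)[OF x0] riesz_identity[OF x0] x by simp
  finally show ?thesis .
qed

text \<open>Far away the two functions are asymptotic to each other, which is measured by \<open>\<epsilon>\<close>; on the remaining ball
  everything is bounded, and the second superposition is bounded below.\<close>

lemma initial_sandwich:
  fixes u0 :: "'a \<Rightarrow> real"
  assumes u0: "bounded (range u0)" "((\<lambda>x. norm x powr \<alpha> * u0 x) \<longlongrightarrow> A) at_infinity" and \<epsilon>: "0 < \<epsilon>"
    and k': "k' + 1 < real DIM('a) / 2"
  shows "\<exists>D\<ge>0. \<forall>x. \<bar>u0 x - A / riesz_const (real DIM('a)) a k * heat_mixture a k x 0\<bar>
    \<le> \<epsilon> * heat_mixture a k x 0 + D * heat_mixture a k' x 0"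
proof -
  let ?n = "real DIM('a)"
  define A' where "A' = A / riesz_const ?n a k"
  let ?V = "\<lambda>x::'a. heat_mixture a k x 0" and ?V' = "\<lambda>x::'a. heat_mixture a k' x 0"
  obtain c where c: "0 < c" "\<And>t (x::'a). 0 \<le> t \<Longrightarrow>
      c * (1 + t + (norm x)\<^sup>2) powr (k + 1 - ?n / 2) \<le> heat_mixture a k x t"
    using heat_mixture_lower[OF a exponent_less] by blast
  have Vpos: "0 < ?V x" for x
  proof -
    have "0 < 1 + 0 + (norm x)\<^sup>2" by (simp add: add_pos_nonneg)
    then have "0 < c * (1 + 0 + (norm x)\<^sup>2) powr (k + 1 - ?n / 2)" using c(1) by simp
    then show ?thesis using c(2)[OF order_refl, of x] by linarith
  qed
  obtain c' where c': "0 < c'" "\<And>t (x::'a). 0 \<le> t \<Longrightarrow>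
      c' * (1 + t + (norm x)\<^sup>2) powr (k' + 1 - ?n / 2) \<le> heat_mixture a k' x t"
    using heat_mixture_lower[OF a k'] by blast
  obtain V1 where V1: "0 < V1" "\<And>t (x::'a). 0 \<le> t \<Longrightarrow> heat_mixture a k x t \<le> V1"
    using heat_mixture_bounded[OF a exponent_less] by blast
  obtain U where U: "\<And>x. \<bar>u0 x\<bar> \<le> U" using u0(1) by (auto simp: bounded_iff)
  have "((\<lambda>x. (norm x powr \<alpha> * u0 x) / (norm x powr \<alpha> * ?V x)) \<longlongrightarrow> A') at_infinity"
    unfolding A'_def using riesz_const_pos
    by (intro tendsto_divide u0(2) heat_mixture_initial_asymptotics) auto
  then have "eventually (\<lambda>x. dist ((norm x powr \<alpha> * u0 x) / (norm x powr \<alpha> * ?V x)) A' < \<epsilon>) at_infinity"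
    using \<epsilon> by (rule tendstoD)
  moreover have "eventually (\<lambda>x::'a. x \<noteq> 0) at_infinity" by (rule eventually_not_equal_at_infinity)
  ultimately have "eventually (\<lambda>x. \<bar>u0 x - A' * ?V x\<bar> \<le> \<epsilon> * ?V x) at_infinity"
  proof eventually_elim
    case (elim x)
    have "\<bar>u0 x / ?V x - A'\<bar> < \<epsilon>" using elim by (simp add: dist_real_def)
    then have "\<bar>u0 x / ?V x - A'\<bar> * ?V x \<le> \<epsilon> * ?V x"
      using Vpos[of x] by (intro mult_right_mono) auto
    moreover have "\<bar>u0 x / ?V x - A'\<bar> * ?V x = \<bar>(u0 x / ?V x - A') * ?V x\<bar>"
      using Vpos[of x] by (simp add: abs_mult)
    moreover have "(u0 x / ?V x - A') * ?V x = u0 x - A' * ?V x"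
      using Vpos[of x] by (simp add: left_diff_distrib)
    ultimately show ?case by simp
  qed
  then obtain \<rho> where \<rho>: "\<And>x. \<rho> \<le> norm x \<Longrightarrow> \<bar>u0 x - A' * ?V x\<bar> \<le> \<epsilon> * ?V x"
    by (auto simp: eventually_at_infinity)
  define v where "v = c' * (1 + \<rho>\<^sup>2) powr (k' + 1 - ?n / 2)"
  have v: "0 < v" unfolding v_def using c'(1) by (intro mult_pos_pos) (auto simp: add_nonneg_eq_0_iff)
  define D where "D = (U + \<bar>A'\<bar> * V1) / v"
  have U0: "0 \<le> U" using U[of 0] by linarith
  have D: "0 \<le> D" unfolding D_def using U0 V1(1) v by simp
  have "\<bar>u0 x - A' * ?V x\<bar> \<le> \<epsilon> * ?V x + D * ?V' x" for x
  proof (cases "\<rho> \<le> norm x")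
    case True
    have "0 \<le> D * ?V' x" using D by (simp add: heat_mixture_nonneg)
    then show ?thesis using \<rho>[OF True] by linarith
  next
    case False
    have "(norm x)\<^sup>2 \<le> \<rho>\<^sup>2" using False by (intro power_mono) auto
    then have "(1 + \<rho>\<^sup>2) powr (k' + 1 - ?n / 2) \<le> (1 + 0 + (norm x)\<^sup>2) powr (k' + 1 - ?n / 2)"
      using k' by (intro powr_mono2') (auto simp: add_pos_nonneg)
    then have "v \<le> c' * (1 + 0 + (norm x)\<^sup>2) powr (k' + 1 - ?n / 2)"
      unfolding v_def using c'(1) by (intro mult_left_mono) auto
    also have "\<dots> \<le> ?V' x" by (rule c'(2)) simp
    finally have "D * v \<le> D * ?V' x" by (rule mult_left_mono[OF _ D])
    moreover have "D * v = U + \<bar>A'\<bar> * V1" using v by (simp add: D_def)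
    moreover have "\<bar>u0 x - A' * ?V x\<bar> \<le> U + \<bar>A'\<bar> * V1"
    proof -
      have "\<bar>A' * ?V x\<bar> \<le> \<bar>A'\<bar> * V1"
        unfolding abs_mult using V1(2)[OF order_refl, of x] by (intro mult_left_mono) (auto simp: heat_mixture_nonneg)
      then show ?thesis using U[of x] by linarith
    qed
    moreover have "0 \<le> \<epsilon> * ?V x" using \<epsilon> by (simp add: heat_mixture_nonneg)
    ultimately show ?thesis by linarith
  qed
  then show ?thesis using D unfolding A'_def by blast
qed

end

context dispersal
begin

text \<open>Two applications of \<open>mixture_barrier\<close>. The upper bound drops the absorption term; it provides
  \<open>u \<le> C V\<^sub>k\<close>, and with it the absorption term becomes an admissible source in the equation for \<open>-u\<close>.\<close>

theorem solution_sandwich: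
  fixes u0 :: "'a \<Rightarrow> real" and u :: "'a \<Rightarrow> real \<Rightarrow> real"
  assumes sol: "nonlocal_solution J p u0 u"
    and u0: "bounded (range u0)" "((\<lambda>x. norm x powr \<alpha> * u0 x) \<longlongrightarrow> A) at_infinity"
    and A: "0 < A" and \<alpha>: "0 < \<alpha>" "\<alpha> \<le> real DIM('a)"
    and k: "2 * k + 2 = real DIM('a) - \<alpha>"
    and \<eta>: "0 < \<eta>" "(p - 1) * \<alpha> / 2 = 1 + 2 * \<eta>"
    and \<kappa>: "0 < \<kappa>" "\<kappa> \<le> 1 / 8" "\<kappa> < \<alpha> / 2" "(p + 1) * \<kappa> \<le> \<eta>"
    and \<epsilon>: "0 < \<epsilon>"
  shows "\<exists>B\<ge>0. \<forall>t\<ge>0. \<forall>x.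
    \<bar>u x t - A / riesz_const (real DIM('a)) (diffusivity J) k * heat_mixture (diffusivity J) k x t\<bar>
      \<le> \<epsilon> * heat_mixture (diffusivity J) k x t + B * heat_mixture (diffusivity J) (k - \<kappa>) x t"
proof -
  define a where "a = diffusivity J"
  have a: "0 < a" using diffusivity_pos by (simp add: a_def)
  let ?n = "real DIM('a)"
  let ?V = "heat_mixture a k :: 'a \<Rightarrow> real \<Rightarrow> real" and ?V' = "heat_mixture a (k - \<kappa>) :: 'a \<Rightarrow> real \<Rightarrow> real"
  define A' where "A' = A / riesz_const ?n a k"
  have A': "0 < A'" unfolding A'_def using A riesz_const_pos[OF a \<alpha>(1) k] by simp
  have k1: "0 \<le> k + 1" "k + 1 < ?n / 2" and k': "k - \<kappa> + 1 < ?n / 2" using k \<alpha> \<kappa> by auto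
  have p: "1 < p"
  proof -
    have "0 < (p - 1) * \<alpha>" using \<eta> by simp
    then show ?thesis using \<alpha> by (simp add: zero_less_mult_iff)
  qed
  define \<delta> where "\<delta> = min (1 / 4) \<eta>"
  have \<delta>: "0 < \<delta>" "\<delta> \<le> 1 / 4" "\<delta> \<le> \<eta>" using \<eta> by (auto simp: \<delta>_def)
  obtain D where D: "0 \<le> D" "\<And>x. \<bar>u0 x - A' * ?V x 0\<bar> \<le> \<epsilon> * ?V x 0 + D * ?V' x 0"
    using initial_sandwich[OF a \<alpha>(1) k u0 \<epsilon> k'] unfolding A'_def by blast
  note facts = nonlocal_solution_continuous[OF sol] nonlocal_solution_measurable[OF sol]
    nonlocal_solution_nonneg[OF sol] nonlocal_solution_deriv[OF sol] nonlocal_solution_init[OF sol]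
  obtain W where W: "\<And>t x. 0 \<le> t \<Longrightarrow> \<bar>u x t\<bar> \<le> W"
    using nonlocal_solution_bounded[OF sol] by blast
  have "\<exists>B\<ge>0. \<forall>t\<ge>0. \<forall>x. u x t \<le> (A' + \<epsilon>) * ?V x t + B * ?V' x t"
    unfolding a_def
  proof (rule mixture_barrier[OF k1 \<kappa>(1,2) \<delta>(1,2) facts(2) W facts(1) facts(4)])
    show "nonlocal_op J (\<lambda>y. u y t) x - u x t powr p \<le> nonlocal_op J (\<lambda>y. u y t) x
      + 0 * ((1 + t) powr (- 1 - \<delta>) * heat_mixture (diffusivity J) (k - \<kappa>) x t)" for x t
      by simp
    show "u x 0 \<le> (A' + \<epsilon>) * heat_mixture (diffusivity J) k x 0 + D * heat_mixture (diffusivity J) (k - \<kappa>) x 0" for x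
      using D(2)[of x] unfolding facts(5) a_def distrib_right by linarith
  qed
  then obtain B1 where B1: "0 \<le> B1" "\<And>t x. 0 \<le> t \<Longrightarrow> u x t \<le> (A' + \<epsilon>) * ?V x t + B1 * ?V' x t"
    by blast
  define C where "C = A' + \<epsilon> + B1"
  have C: "0 < C" using A' \<epsilon> B1(1) by (simp add: C_def)
  have u_le: "u x t \<le> C * ?V x t" if t: "0 \<le> t" for x t
  proof -
    have "B1 * ?V' x t \<le> B1 * ?V x t"
      using heat_mixture_mono[OF a _ k1(2) t, of "k - \<kappa>" x] \<kappa>(1) B1(1) by (intro mult_left_mono) auto
    then show ?thesis using B1(2)[OF t, of x] by (simp add: C_def algebra_simps)
  qed
  obtain C2 where C2: "0 < C2" "\<And>t x. 0 \<le> t \<Longrightarrow>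
      ?V x t \<le> C2 * (1 + t + (norm x)\<^sup>2) powr (k + 1 + \<kappa> - ?n / 2)"
    using heat_mixture_upper[OF a, of "k + 1 + \<kappa>" k, where 'a='a] k1 \<kappa> k by auto
  obtain c where c: "0 < c" "\<And>t x. 0 \<le> t \<Longrightarrow>
      c * (1 + t + (norm x)\<^sup>2) powr (k - \<kappa> + 1 - ?n / 2) \<le> ?V' x t"
    using heat_mixture_lower[OF a k'] by blast
  define Q where "Q = (C * C2) powr p / c"
  have absorb: "u x t powr p \<le> Q * ((1 + t) powr (- 1 - \<delta>) * ?V' x t)" if t: "0 \<le> t" for x t
  proof -
    define R where "R = 1 + t + (norm x)\<^sup>2"
    have R: "1 \<le> R" "1 + t \<le> R" using t by (auto simp: R_def)
    have "u x t \<le> C * (C2 * R powr (k + 1 + \<kappa> - ?n / 2))"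
      unfolding R_def using C
      by (intro order_trans[OF u_le[OF t, of x]] mult_left_mono C2(2)[OF t]) simp
    then have "u x t powr p \<le> (C * (C2 * R powr (k + 1 + \<kappa> - ?n / 2))) powr p"
      using facts(3)[OF t, of x] p by (intro powr_mono2) auto
    also have "\<dots> = (C * C2) powr p * R powr ((k + 1 + \<kappa> - ?n / 2) * p)"
      unfolding mult.assoc[symmetric] powr_mult[of "C * C2"] powr_powr ..
    \<comment> \<open>The first summand is at most \<open>-1 - \<delta>\<close>; the second is the decay exponent of \<open>V\<^bsub>k-\<kappa>\<^esub>\<close>.\<close>
    also have "(k + 1 + \<kappa> - ?n / 2) * p = (- 1 - 2 * \<eta> + (p + 1) * \<kappa>) + (k - \<kappa> + 1 - ?n / 2)"
    proof -
      have e: "k + 1 + \<kappa> - ?n / 2 = \<kappa> - \<alpha> / 2" "k - \<kappa> + 1 - ?n / 2 = - \<kappa> - \<alpha> / 2"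
        using k by auto
      have "p * \<alpha> / 2 = 1 + 2 * \<eta> + \<alpha> / 2" using \<eta>(2) by (simp add: field_simps)
      then show ?thesis unfolding e by (simp add: algebra_simps)
    qed
    also have "R powr ((- 1 - 2 * \<eta> + (p + 1) * \<kappa>) + (k - \<kappa> + 1 - ?n / 2))
        = R powr (- 1 - 2 * \<eta> + (p + 1) * \<kappa>) * R powr (k - \<kappa> + 1 - ?n / 2)"
      by (rule powr_add)
    also have "(C * C2) powr p * (R powr (- 1 - 2 * \<eta> + (p + 1) * \<kappa>) * R powr (k - \<kappa> + 1 - ?n / 2))
        \<le> (C * C2) powr p * ((1 + t) powr (- 1 - \<delta>) * (?V' x t / c))"
    proof (intro mult_left_mono mult_mono)
      have "R powr (- 1 - 2 * \<eta> + (p + 1) * \<kappa>) \<le> R powr (- 1 - \<delta>)"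
        using R \<kappa>(4) \<delta> \<eta> by (intro powr_mono) auto
      also have "\<dots> \<le> (1 + t) powr (- 1 - \<delta>)"
        using R t \<delta> by (intro powr_mono2') auto
      finally show "R powr (- 1 - 2 * \<eta> + (p + 1) * \<kappa>) \<le> (1 + t) powr (- 1 - \<delta>)" .
      show "R powr (k - \<kappa> + 1 - ?n / 2) \<le> ?V' x t / c"
        using c(2)[OF t, of x] c(1) by (simp add: R_def pos_le_divide_eq mult.commute)
    qed auto
    also have "\<dots> = Q * ((1 + t) powr (- 1 - \<delta>) * ?V' x t)" by (simp add: Q_def)
    finally show ?thesis .
  qed
  have "\<exists>B\<ge>0. \<forall>t\<ge>0. \<forall>x. - u x t \<le> (- (A' - \<epsilon>)) * ?V x t + B * ?V' x t"
    unfolding a_def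
  proof (rule mixture_barrier[OF k1 \<kappa>(1,2) \<delta>(1,2)])
    show "(\<lambda>x. - u x t) \<in> borel_measurable lebesgue" if "0 \<le> t" for t
      using facts(2)[OF that] by measurable
    show "\<bar>- u x t\<bar> \<le> W" if "0 \<le> t" for x t using W[OF that] by simp
    show "continuous_on {0..} (\<lambda>t. - u x t)" for x
      using facts(1) by (intro continuous_intros)
    show "((\<lambda>t. - u x t) has_real_derivative - (nonlocal_op J (\<lambda>y. u y t) x - u x t powr p)) (at t)"
      if "0 < t" for x t
      by (rule DERIV_minus[OF facts(4)[OF that]])
    show "- (nonlocal_op J (\<lambda>y. u y t) x - u x t powr p) \<le> nonlocal_op J (\<lambda>y. - u y t) x
      + Q * ((1 + t) powr (- 1 - \<delta>) * heat_mixture (diffusivity J) (k - \<kappa>) x t)" if t: "0 < t" for x t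
    proof -
      have "nonlocal_op J (\<lambda>y. - u y t) x = (\<integral>y. - (J (x - y) * (u y t - u x t)) \<partial>lebesgue)"
        unfolding nonlocal_op_def by (simp add: algebra_simps)
      then have "nonlocal_op J (\<lambda>y. - u y t) x = - nonlocal_op J (\<lambda>y. u y t) x"
        unfolding nonlocal_op_def by simp
      then show ?thesis using absorb[of t x] t by (simp add: a_def)
    qed
    show "- u x 0 \<le> (- (A' - \<epsilon>)) * heat_mixture (diffusivity J) k x 0 + D * heat_mixture (diffusivity J) (k - \<kappa>) x 0" for x
      using D(2)[of x] unfolding facts(5) a_def by (simp add: algebra_simps abs_le_iff)
  qed
  then obtain B2 where B2: "0 \<le> B2" "\<And>t x. 0 \<le> t \<Longrightarrow> - u x t \<le> (- (A' - \<epsilon>)) * ?V x t + B2 * ?V' x t"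
    by blast
  have "\<bar>u x t - A' * ?V x t\<bar> \<le> \<epsilon> * ?V x t + (B1 + B2) * ?V' x t" if t: "0 \<le> t" for x t
  proof -
    have "0 \<le> B1 * ?V' x t" "0 \<le> B2 * ?V' x t" using B1(1) B2(1) by (simp_all add: heat_mixture_nonneg)
    then show ?thesis
      using B1(2)[OF t, of x] B2(2)[OF t, of x] by (simp add: abs_le_iff algebra_simps)
  qed
  then show ?thesis
    using B1(1) B2(1) unfolding A'_def a_def by (metis add_nonneg_nonneg)
qed

end

section \<open>The limit profiles as superpositions of heat kernels\<close>

lemma heat_kernel_prod:
  fixes x :: "'a::euclidean_space"
  assumes a: "0 < a" and t: "0 < t"
  shows "heat_kernel a x t = (\<Prod>b\<in>Basis. normal_density 0 (sqrt (2 * a * t)) (x \<bullet> b))"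
proof -
  have pos: "0 < 4 * pi * a * t" using a t by simp
  have sq: "(sqrt (2 * a * t))\<^sup>2 = 2 * a * t" using a t by simp
  have "(\<Prod>b\<in>Basis. normal_density 0 (sqrt (2 * a * t)) (x \<bullet> b))
      = (\<Prod>b\<in>(Basis::'a set). 1 / sqrt (4 * pi * a * t)) * (\<Prod>b\<in>Basis. exp (- ((x \<bullet> b)\<^sup>2 / (4 * a * t))))"
    unfolding normal_density_def sq prod.distrib[symmetric] by (intro prod.cong refl) (simp add: mult_ac)
  also have "(\<Prod>b\<in>Basis. exp (- ((x \<bullet> b)\<^sup>2 / (4 * a * t)))) = exp (- ((norm x)\<^sup>2 / (4 * a * t)))"
    unfolding norm_sq_Basis exp_sum[OF finite_Basis, symmetric] sum_negf sum_divide_distrib ..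
  also have "(\<Prod>b\<in>(Basis::'a set). 1 / sqrt (4 * pi * a * t)) = (4 * pi * a * t) powr (- (real DIM('a) / 2))"
  proof -
    have "(4 * pi * a * t) powr (- (real DIM('a) / 2)) = ((4 * pi * a * t) powr (- (1 / 2))) powr (real DIM('a))"
      unfolding powr_powr by simp
    also have "(4 * pi * a * t) powr (- (1 / 2)) = 1 / sqrt (4 * pi * a * t)"
      using pos by (simp add: powr_minus powr_half_sqrt inverse_eq_divide)
    also have "(1 / sqrt (4 * pi * a * t)) powr (real DIM('a)) = (1 / sqrt (4 * pi * a * t)) ^ DIM('a)"
      by (rule powr_realpow) (use pos in simp)
    finally show ?thesis by (simp only: prod_constant)
  qed
  finally show ?thesis by (simp add: heat_kernel_def)
qed

text \<open>Coordinatewise this is the convolution of two centred normal densities.\<close>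

lemma heat_kernel_semigroup:
  fixes x :: "'a::euclidean_space"
  assumes a: "0 < a" and t: "0 < t" and s: "0 < s"
  shows "(\<integral>\<^sup>+y. ennreal (heat_kernel a (x - y) t * heat_kernel a y s) \<partial>lborel) = ennreal (heat_kernel a x (t + s))"
proof -
  let ?N = "\<lambda>t. normal_density 0 (sqrt (2 * a * t))"
  let ?f = "\<lambda>b z. ennreal (?N t (x \<bullet> b - z) * ?N s z)"
  have "(\<integral>\<^sup>+y. ennreal (heat_kernel a (x - y) t * heat_kernel a y s) \<partial>lborel)
      = (\<integral>\<^sup>+y. (\<Prod>b\<in>Basis. ?f b (y \<bullet> b)) \<partial>lborel)"
    unfolding heat_kernel_prod[OF a t] heat_kernel_prod[OF a s] prod.distrib[symmetric] inner_diff_left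
    by (subst prod_ennreal) auto
  also have "\<dots> = (\<Prod>b\<in>Basis. (\<integral>\<^sup>+z. ?f b z \<partial>lborel))"
    by (rule nn_integral_lborel_prod) auto
  also have "\<dots> = (\<Prod>b\<in>Basis. ennreal (?N (t + s) (x \<bullet> b)))"
  proof (rule prod.cong[OF refl])
    fix b :: 'a
    have "(\<integral>\<^sup>+z. ?f b z \<partial>lborel)
        = ennreal (normal_density 0 (sqrt ((sqrt (2 * a * t))\<^sup>2 + (sqrt (2 * a * s))\<^sup>2)) (x \<bullet> b))"
      using conv_normal_density_zero_mean[of "sqrt (2 * a * t)" "sqrt (2 * a * s)"] a t s
      by (simp add: fun_eq_iff)
    also have "(sqrt (2 * a * t))\<^sup>2 + (sqrt (2 * a * s))\<^sup>2 = 2 * a * (t + s)"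
      using a t s by (simp add: distrib_left)
    finally show "(\<integral>\<^sup>+z. ?f b z \<partial>lborel) = ennreal (?N (t + s) (x \<bullet> b))" .
  qed
  also have "\<dots> = ennreal (heat_kernel a x (t + s))"
    using t s by (simp add: heat_kernel_prod[OF a] prod_ennreal)
  finally show ?thesis .
qed

text \<open>The essential supremum could be negative only over a null set; the balls have positive measure, so
  squeezing between \<open>0\<close> and the uniform bound is possible.\<close>

lemma Linfty_norm_tendsto_0:
  fixes F :: "real \<Rightarrow> 'a::euclidean_space \<Rightarrow> real"
  assumes K: "0 < K" and q: "eventually (\<lambda>t. 0 < q t) at_top"
    and meas: "eventually (\<lambda>t. F t \<in> borel_measurable lebesgue) at_top"
    and small: "\<And>e. 0 < e \<Longrightarrow> eventually (\<lambda>t. \<forall>x. q t * \<bar>F t x\<bar> \<le> e) at_top"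
  shows "((\<lambda>t. ereal (q t) * Linfty_norm {x. norm x \<le> K * sqrt t} (F t)) \<longlongrightarrow> 0) at_top"
proof -
  have meas_S: "(\<lambda>x. ereal \<bar>F t x\<bar>) \<in> borel_measurable (lebesgue_on S)"
    if "F t \<in> borel_measurable lebesgue" for t S
    using measurable_restrict_space1[OF that, of S] by measurable
  have nonneg: "eventually (\<lambda>t. 0 \<le> ereal (q t) * Linfty_norm {x. norm x \<le> K * sqrt t} (F t)) at_top"
    using q meas eventually_gt_at_top[of 0]
  proof eventually_elim
    case (elim t)
    let ?S = "{x::'a. norm x \<le> K * sqrt t}"
    have S: "?S = cball 0 (K * sqrt t)" by auto
    have r: "0 < K * sqrt t" using K elim by simp
    have "emeasure lebesgue (cball (0::'a) (K * sqrt t)) \<noteq> 0"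
    proof -
      have "0 < measure lborel (cball (0::'a) (K * sqrt t))" by (rule content_cball_pos[OF r])
      then show ?thesis by (auto simp: measure_def)
    qed
    then have "emeasure (lebesgue_on ?S) (space (lebesgue_on ?S)) \<noteq> 0"
      unfolding S by (simp add: emeasure_restrict_space)
    then have "0 = esssup (lebesgue_on ?S) (\<lambda>x. 0 :: ereal)"
      by (rule esssup_const[symmetric])
    also have "\<dots> \<le> Linfty_norm ?S (F t)"
      unfolding Linfty_norm_def by (rule esssup_mono) auto
    finally show ?case using elim by simp
  qed
  have upper: "eventually (\<lambda>t. ereal (q t) * Linfty_norm {x. norm x \<le> K * sqrt t} (F t) \<le> ereal e) at_top"
    if e: "0 < e" for e
    using q meas small[OF e]
  proof eventually_elim
    case (elim t)
    have "Linfty_norm {x. norm x \<le> K * sqrt t} (F t) \<le> ereal (e / q t)"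
      unfolding Linfty_norm_def
    proof (rule esssup_I[OF meas_S[OF elim(2)]], rule AE_I2)
      fix x :: 'a
      show "ereal \<bar>F t x\<bar> \<le> ereal (e / q t)"
        using elim(1,3) by (simp add: pos_le_divide_eq mult.commute)
    qed
    then have "ereal (q t) * Linfty_norm {x. norm x \<le> K * sqrt t} (F t) \<le> ereal (q t) * ereal (e / q t)"
      using elim(1) by (intro ereal_mult_left_mono) auto
    then show ?case using elim(1) by simp
  qed
  show ?thesis
  proof (rule order_tendstoI)
    fix b :: ereal assume "b < 0"
    show "eventually (\<lambda>t. b < ereal (q t) * Linfty_norm {x. norm x \<le> K * sqrt t} (F t)) at_top"
      using nonneg by eventually_elim (use \<open>b < 0\<close> in \<open>rule less_le_trans\<close>)
  next
    fix b :: ereal assume "0 < b"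
    then obtain e where e: "0 < ereal e" "ereal e < b" using ereal_dense2 by blast
    have "eventually (\<lambda>t. ereal (q t) * Linfty_norm {x. norm x \<le> K * sqrt t} (F t) \<le> ereal e) at_top"
      using upper e(1) by simp
    then show "eventually (\<lambda>t. ereal (q t) * Linfty_norm {x. norm x \<le> K * sqrt t} (F t) < b) at_top"
    proof eventually_elim
      case (elim t)
      then show ?case using e(2) by (rule le_less_trans)
    qed
  qed
qed

context
  fixes a k \<alpha> :: real
  assumes a: "0 < a" and \<alpha>: "0 < \<alpha>" "\<alpha> < real DIM('a::euclidean_space)"
    and exponent: "2 * k + 2 = real DIM('a) - \<alpha>"
begin

lemma short_mixture_bound:
  fixes x :: 'a
  assumes t: "0 < t"
  shows "integrable lborel (\<lambda>r. r powr k * heat_kernel a x (t + r) * indicator {0..<1} r)"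
    and "\<bar>\<integral>r. r powr k * heat_kernel a x (t + r) * indicator {0..<1} r \<partial>lborel\<bar>
      \<le> (4 * pi * a) powr (- (real DIM('a) / 2)) / (k + 1) * t powr (- (real DIM('a) / 2))"
proof -
  let ?n = "real DIM('a)" and ?c = "(4 * pi * a) powr (- (real DIM('a) / 2)) * t powr (- (real DIM('a) / 2))"
  have k1: "0 < k + 1" using \<alpha> exponent by simp
  note I = powr_initial_integral[OF k1 zero_le_one]
  have le: "\<bar>r powr k * heat_kernel a x (t + r) * indicator {0..<1} r\<bar>
      \<le> ?c * (r powr (k + 1 - 1) * indicator {0..1} r)" for r
  proof (cases "0 \<le> r \<and> r < 1")
    case True
    have "heat_kernel a x (t + r) \<le> (4 * pi * a) powr (- (?n / 2)) * (t + r) powr (- (?n / 2))"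
      using t True by (intro heat_kernel_le_powr a) auto
    also have "\<dots> \<le> ?c" using t True by (intro mult_left_mono powr_mono2') auto
    finally have "r powr k * heat_kernel a x (t + r) \<le> r powr k * ?c" by (rule mult_left_mono) simp
    then show ?thesis using True by (simp add: heat_kernel_nonneg mult_ac)
  qed (auto split: split_indicator)
  show int: "integrable lborel (\<lambda>r. r powr k * heat_kernel a x (t + r) * indicator {0..<1} r)"
  proof (rule Bochner_Integration.integrable_bound)
    show "integrable lborel (\<lambda>r. ?c * (r powr (k + 1 - 1) * indicator {0..1} r))"
      by (rule integrable_mult_right[OF integrable.intros[OF I]])
    show "AE r in lborel. norm (r powr k * heat_kernel a x (t + r) * indicator {0..<1} r)
        \<le> norm (?c * (r powr (k + 1 - 1) * indicator {0..1} r))"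
      using le by (intro AE_I2) (simp only: real_norm_def, rule order_trans[OF _ abs_ge_self])
  qed simp
  have "\<bar>\<integral>r. r powr k * heat_kernel a x (t + r) * indicator {0..<1} r \<partial>lborel\<bar>
      \<le> (\<integral>r. \<bar>r powr k * heat_kernel a x (t + r) * indicator {0..<1} r\<bar> \<partial>lborel)"
    using integral_norm_bound[of lborel "\<lambda>r. r powr k * heat_kernel a x (t + r) * indicator {0..<1} r"] by simp
  also have "\<dots> \<le> (\<integral>r. ?c * (r powr (k + 1 - 1) * indicator {0..1} r) \<partial>lborel)"
    by (rule integral_mono[OF integrable_abs[OF int] integrable_mult_right[OF integrable.intros[OF I]] le])
  also have "\<dots> = ?c * (1 powr (k + 1) / (k + 1))"
    using has_bochner_integral_integral_eq[OF I] by simp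
  finally show "\<bar>\<integral>r. r powr k * heat_kernel a x (t + r) * indicator {0..<1} r \<partial>lborel\<bar>
      \<le> (4 * pi * a) powr (- (?n / 2)) / (k + 1) * t powr (- (?n / 2))"
    by simp
qed

text \<open>Write \<open>|y|\<^sup>-\<^sup>\<alpha>\<close> as a superposition of heat kernels in \<open>y\<close>, exchange the integrals by Tonelli's theorem, and
  use the semigroup property.\<close>

lemma heat_power_solution_mixture:
  fixes x :: 'a
  assumes t: "0 < t"
  shows "heat_power_solution a \<alpha> A x t = A / riesz_const (real DIM('a)) a k *
    (\<integral>r. r powr k * heat_kernel a x (t + r) * indicator {0..} r \<partial>lborel)"
proof -
  let ?c = "riesz_const (real DIM('a)) a k"
  have c: "0 < ?c" by (rule riesz_const_pos[OF a \<alpha>(1) exponent])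
  have riesz: "ennreal (?c * norm y powr (- \<alpha>))
      = (\<integral>\<^sup>+r. ennreal (r powr k * heat_kernel a y r * indicator {0..} r) \<partial>lborel)" if y: "y \<noteq> 0" for y :: 'a
    unfolding riesz_identity[OF a \<alpha>(1) exponent y, symmetric]
    by (intro nn_integral_eq_integral[symmetric] mixture_split(1)[OF a \<alpha>(1) exponent y] AE_I2)
      (simp add: heat_kernel_nonneg)
  have "(\<integral>\<^sup>+y. ennreal (?c * (heat_kernel a (x - y) t * norm y powr (- \<alpha>))) \<partial>lborel)
      = (\<integral>\<^sup>+y. (\<integral>\<^sup>+r. ennreal (heat_kernel a (x - y) t) * ennreal (r powr k * heat_kernel a y r * indicator {0..} r) \<partial>lborel) \<partial>lborel)"
  proof (rule nn_integral_cong_AE, use AE_lborel_singleton[of 0] in eventually_elim)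
    fix y :: 'a assume y: "y \<noteq> 0"
    have "ennreal (?c * (heat_kernel a (x - y) t * norm y powr (- \<alpha>)))
        = ennreal (heat_kernel a (x - y) t) * ennreal (?c * norm y powr (- \<alpha>))"
      using c by (simp add: ennreal_mult[symmetric] heat_kernel_nonneg mult_ac)
    also have "\<dots> = (\<integral>\<^sup>+r. ennreal (heat_kernel a (x - y) t) * ennreal (r powr k * heat_kernel a y r * indicator {0..} r) \<partial>lborel)"
      unfolding riesz[OF y] by (rule nn_integral_cmult[symmetric]) measurable
    finally show "ennreal (?c * (heat_kernel a (x - y) t * norm y powr (- \<alpha>))) = \<dots>" .
  qed
  also have "\<dots> = (\<integral>\<^sup>+r. (\<integral>\<^sup>+y. ennreal (heat_kernel a (x - y) t) * ennreal (r powr k * heat_kernel a y r * indicator {0..} r) \<partial>lborel) \<partial>lborel)"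
    by (rule lborel_pair.Fubini'[symmetric]) measurable
  also have "\<dots> = (\<integral>\<^sup>+r. ennreal (r powr k * heat_kernel a x (t + r) * indicator {0..} r) \<partial>lborel)"
  proof (rule nn_integral_cong)
    fix r :: real
    show "(\<integral>\<^sup>+y. ennreal (heat_kernel a (x - y) t) * ennreal (r powr k * heat_kernel a y r * indicator {0..} r) \<partial>lborel)
        = ennreal (r powr k * heat_kernel a x (t + r) * indicator {0..} r)"
    proof (cases "0 < r")
      case True
      have "(\<integral>\<^sup>+y. ennreal (heat_kernel a (x - y) t) * ennreal (r powr k * heat_kernel a y r * indicator {0..} r) \<partial>lborel)
          = (\<integral>\<^sup>+y. ennreal (r powr k) * ennreal (heat_kernel a (x - y) t * heat_kernel a y r) \<partial>lborel)"
        using True by (intro nn_integral_cong) (simp add: ennreal_mult[symmetric] heat_kernel_nonneg mult_ac)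
      also have "\<dots> = ennreal (r powr k) * ennreal (heat_kernel a x (t + r))"
        using heat_kernel_semigroup[OF a t True, of x] by (subst nn_integral_cmult) simp_all
      finally show ?thesis using True by (simp add: ennreal_mult[symmetric] heat_kernel_nonneg)
    qed (cases "r = 0"; simp)
  qed
  finally have eq: "(\<integral>\<^sup>+y. ennreal (?c * (heat_kernel a (x - y) t * norm y powr (- \<alpha>))) \<partial>lborel)
      = (\<integral>\<^sup>+r. ennreal (r powr k * heat_kernel a x (t + r) * indicator {0..} r) \<partial>lborel)" .
  have "(\<integral>y. ?c * (heat_kernel a (x - y) t * norm y powr (- \<alpha>)) \<partial>lborel)
      = (\<integral>r. r powr k * heat_kernel a x (t + r) * indicator {0..} r \<partial>lborel)"
    using c eq by (subst (1 2) integral_eq_nn_integral) (auto simp: heat_kernel_nonneg)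
  then have I: "?c * (\<integral>y. heat_kernel a (x - y) t * norm y powr (- \<alpha>) \<partial>lborel)
      = (\<integral>r. r powr k * heat_kernel a x (t + r) * indicator {0..} r \<partial>lborel)" by simp
  have "heat_power_solution a \<alpha> A x t = A * (\<integral>y. heat_kernel a (x - y) t * norm y powr (- \<alpha>) \<partial>lborel)"
    unfolding heat_power_solution_def by (simp add: mult.left_commute)
  also have "\<dots> = A / ?c * (?c * (\<integral>y. heat_kernel a (x - y) t * norm y powr (- \<alpha>) \<partial>lborel))"
    using c by simp
  finally show ?thesis unfolding I .
qed

lemma heat_power_solution_near_mixture:
  assumes t: "0 < t" and A: "0 \<le> A"
  shows "\<bar>A / riesz_const (real DIM('a)) a k * heat_mixture a k x t - heat_power_solution a \<alpha> A (x::'a) t\<bar>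
    \<le> A / riesz_const (real DIM('a)) a k * ((4 * pi * a) powr (- (real DIM('a) / 2)) / (k + 1)) *
      t powr (- (real DIM('a) / 2))"
proof -
  let ?c = "riesz_const (real DIM('a)) a k"
  let ?I = "\<integral>r. r powr k * heat_kernel a x (t + r) * indicator {0..<1} r \<partial>lborel"
  have c: "0 < ?c" by (rule riesz_const_pos[OF a \<alpha>(1) exponent])
  have eq: "(\<lambda>r. r powr k * heat_kernel a x (t + r) * indicator {0..} r)
      = (\<lambda>r. r powr k * heat_kernel a x (t + r) * indicator {0..<1} r
        + r powr k * heat_kernel a x (t + r) * indicator {1..} r)"
    by (auto split: split_indicator)
  have "(\<integral>r. r powr k * heat_kernel a x (t + r) * indicator {0..} r \<partial>lborel) = ?I + heat_mixture a k x t"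
    unfolding eq heat_mixture_def
    using short_mixture_bound(1)[OF t] heat_mixture_integrable[OF a exponent_less[OF a \<alpha>(1) exponent], of t x] t
    by (intro Bochner_Integration.integral_add) auto
  then have "A / ?c * heat_mixture a k x t - heat_power_solution a \<alpha> A x t = - (A / ?c * ?I)"
    unfolding heat_power_solution_mixture[OF t] by (simp add: distrib_left)
  then have "\<bar>A / ?c * heat_mixture a k x t - heat_power_solution a \<alpha> A x t\<bar> = A / ?c * \<bar>?I\<bar>"
    using c A by (simp add: abs_mult)
  also have "\<dots> \<le> A / ?c * ((4 * pi * a) powr (- (real DIM('a) / 2)) / (k + 1) * t powr (- (real DIM('a) / 2)))"
    using c A by (intro mult_left_mono short_mixture_bound(2)[OF t]) auto
  finally show ?thesis by simp
qed

end

text \<open>For \<open>r \<le> t\<close> replace \<open>G(x, t + r)\<close> by \<open>G(x, t)\<close>: the error is at most \<open>r\<close> times a time derivative of size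
  \<open>t\<^bsup>-N/2-1\<^esup>\<close>, and the weight \<open>1/r\<close> integrates to \<open>ln t\<close>. For \<open>r \<ge> t\<close> the integrand is at most
  a multiple of \<open>r\<^bsup>-N/2-1\<^esup>\<close>.\<close>

lemma log_mixture_asymptotics:
  assumes a: "0 < a"
  shows "\<exists>C>0. \<forall>t\<ge>1. \<forall>x::'a::euclidean_space.
    \<bar>heat_mixture a (- 1) x t - ln t * heat_kernel a x t\<bar> \<le> C * t powr (- (real DIM('a) / 2))"
proof -
  let ?n = "real DIM('a)"
  let ?A = "(4 * pi * a) powr (- (?n / 2))"
  define C1 where "C1 = ?A * (1 + ?n / 2)"
  have A: "0 < ?A" using a by simp
  have C1: "0 < C1" using A by (simp add: C1_def add_pos_nonneg)
  have n: "0 < ?n" using DIM_positive[where 'a='a] by simp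
  show ?thesis
  proof (intro exI[of _ "C1 + ?A * (2 / ?n)"] conjI allI impI)
    show "0 < C1 + ?A * (2 / ?n)" using C1 A n by (intro add_pos_pos mult_pos_pos) auto
    fix t :: real and x :: 'a assume t: "1 \<le> t"
    let ?f = "\<lambda>r. r powr (- 1) * heat_kernel a x (t + r) * indicator {1..} r"
    let ?g = "\<lambda>r. heat_kernel a x t * (1 / r * indicator {1..t} r)"
    let ?h = "\<lambda>r. C1 * t powr (- (?n / 2) - 1) * indicator {1..t} r
      + ?A * (r powr (- (?n / 2) - 1) * indicator {t..} r)"
    have int_f: "integrable lborel ?f"
      using n t by (intro heat_mixture_integrable a) auto
    have log: "has_bochner_integral lborel (\<lambda>r. 1 / r * indicator {1..t} r) (ln t - ln 1)"
      by (rule has_bochner_integral_FTC_Icc_real)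
        (use t in \<open>auto intro!: derivative_eq_intros continuous_intros\<close>)
    have int_g: "integrable lborel ?g"
      by (rule integrable_mult_right[OF integrable.intros[OF log]])
    have tail: "has_bochner_integral lborel (\<lambda>r. r powr (- (?n / 2) - 1) * indicator {t..} r) (t powr (- (?n / 2)) / (?n / 2))"
      using powr_tail_integral[of "- (?n / 2)" t] n t by simp
    have int_1: "integrable lborel (\<lambda>r. C1 * t powr (- (?n / 2) - 1) * indicator {1..t} r)"
      using t by (intro integrable_mult_right integrable_real_indicator) auto
    have int_2: "integrable lborel (\<lambda>r. ?A * (r powr (- (?n / 2) - 1) * indicator {t..} r))"
      by (rule integrable_mult_right[OF integrable.intros[OF tail]])
    have le: "\<bar>?f r - ?g r\<bar> \<le> ?h r" for r
    proof (cases "1 \<le> r")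
      case r: True
      have first: "\<bar>r powr (- 1) * heat_kernel a x (t + r) - heat_kernel a x t * (1 / r)\<bar> \<le> C1 * t powr (- (?n / 2) - 1)"
      proof -
        have "norm (heat_kernel a x (t + r) - heat_kernel a x t) \<le> C1 * t powr (- (?n / 2) - 1) * norm (t + r - t)"
        proof (rule field_differentiable_bound[of "{t..t + r}"])
          fix z assume z: "z \<in> {t..t + r}"
          then show "((\<lambda>t. heat_kernel a x t) has_real_derivative heat_kernel_dt a x z) (at z within {t..t + r})"
            using t a by (intro DERIV_subset[OF heat_kernel_has_derivative]) auto
          have "\<bar>heat_kernel_dt a x z\<bar> \<le> C1 * z powr (- (?n / 2) - 1)"
            unfolding C1_def using z t a by (intro abs_heat_kernel_dt_le) auto
          also have "\<dots> \<le> C1 * t powr (- (?n / 2) - 1)"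
            using z t C1 by (intro mult_left_mono powr_mono2') auto
          finally show "norm (heat_kernel_dt a x z) \<le> C1 * t powr (- (?n / 2) - 1)" by simp
        qed (use r in auto)
        then have "\<bar>heat_kernel a x (t + r) - heat_kernel a x t\<bar> / r \<le> C1 * t powr (- (?n / 2) - 1)"
          using r by (simp add: divide_le_eq)
        moreover have "r powr (- 1) * heat_kernel a x (t + r) - heat_kernel a x t * (1 / r)
            = (heat_kernel a x (t + r) - heat_kernel a x t) / r"
          using r by (simp add: powr_minus_divide diff_divide_distrib)
        ultimately show ?thesis using r by (simp add: abs_divide)
      qed
      have second: "\<bar>r powr (- 1) * heat_kernel a x (t + r)\<bar> \<le> ?A * r powr (- (?n / 2) - 1)"
      proof -
        have "heat_kernel a x (t + r) \<le> ?A * (t + r) powr (- (?n / 2))"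
          using r t by (intro heat_kernel_le_powr a) auto
        also have "\<dots> \<le> ?A * r powr (- (?n / 2))"
          using r t by (intro mult_left_mono powr_mono2') auto
        finally have "r powr (- 1) * heat_kernel a x (t + r) \<le> r powr (- 1) * (?A * r powr (- (?n / 2)))"
          by (rule mult_left_mono) simp
        also have "\<dots> = ?A * (r powr (- (?n / 2)) * r powr (- 1))" by (simp only: mult_ac)
        also have "r powr (- (?n / 2)) * r powr (- 1) = r powr (- (?n / 2) - 1)"
          by (simp only: powr_add[symmetric] diff_conv_add_uminus)
        finally show ?thesis by (simp add: heat_kernel_nonneg)
      qed
      have nn: "0 \<le> ?A * r powr (- (?n / 2) - 1)" by simp
      show ?thesis
      proof (cases "r \<le> t")
        case True
        have "?f r - ?g r = r powr (- 1) * heat_kernel a x (t + r) - heat_kernel a x t * (1 / r)"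
          using r True by simp
        moreover have "C1 * t powr (- (?n / 2) - 1) \<le> ?h r"
          using r True by (auto split: split_indicator)
        ultimately show ?thesis using first by linarith
      next
        case False
        then show ?thesis using r second by simp
      qed
    next
      case False
      then show ?thesis using t by simp
    qed
    have "heat_mixture a (- 1) x t - ln t * heat_kernel a x t = (\<integral>r. ?f r - ?g r \<partial>lborel)"
      unfolding heat_mixture_def Bochner_Integration.integral_diff[OF int_f int_g]
        integral_mult_right_zero has_bochner_integral_integral_eq[OF log] by simp
    then have "\<bar>heat_mixture a (- 1) x t - ln t * heat_kernel a x t\<bar> \<le> (\<integral>r. \<bar>?f r - ?g r\<bar> \<partial>lborel)"
      using integral_norm_bound[of lborel "\<lambda>r. ?f r - ?g r"] by simp
    also have "\<dots> \<le> (\<integral>r. ?h r \<partial>lborel)"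
      by (rule integral_mono[OF integrable_abs[OF Bochner_Integration.integrable_diff[OF int_f int_g]]
          Bochner_Integration.integrable_add[OF int_1 int_2] le])
    also have "\<dots> = C1 * t powr (- (?n / 2) - 1) * (t - 1) + ?A * (t powr (- (?n / 2)) / (?n / 2))"
      unfolding Bochner_Integration.integral_add[OF int_1 int_2]
      using has_bochner_integral_integral_eq[OF tail] t by simp
    also have "\<dots> \<le> C1 * t powr (- (?n / 2)) + ?A * (2 / ?n) * t powr (- (?n / 2))"
    proof -
      have "t powr (- (?n / 2) - 1) * (t - 1) \<le> t powr (- (?n / 2) - 1) * t"
        by (rule mult_left_mono) auto
      also have "\<dots> = t powr (- (?n / 2))" using t by (simp add: powr_diff)
      finally have "C1 * (t powr (- (?n / 2) - 1) * (t - 1)) \<le> C1 * t powr (- (?n / 2))"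
        using C1 by (intro mult_left_mono) auto
      then show ?thesis by (simp add: mult_ac)
    qed
    finally show "\<bar>heat_mixture a (- 1) x t - ln t * heat_kernel a x t\<bar>
        \<le> (C1 + ?A * (2 / ?n)) * t powr (- (?n / 2))"
      by (simp only: distrib_right)
  qed
qed

section \<open>Convergence to the limit profiles\<close>

context dispersal
begin

text \<open>The requirements on \<open>\<kappa>\<close> in the sandwich are met by any small positive number. For \<open>\<alpha> < N\<close> it can moreover be
  so small that \<open>k - \<kappa> + 1\<close> is still positive; then \<open>V\<^bsub>k-\<kappa>\<^esub>\<close> is \<open>O(t\<^bsup>-\<alpha>/2-\<kappa>\<^esup>)\<close>.\<close>

theorem convergence_below_critical_decay:
  fixes u0 :: "'a \<Rightarrow> real" and u :: "'a \<Rightarrow> real \<Rightarrow> real"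
  assumes sol: "nonlocal_solution J p u0 u"
    and u0: "bounded (range u0)" "((\<lambda>x. norm x powr \<alpha> * u0 x) \<longlongrightarrow> A) at_infinity"
    and A: "0 < A" and \<alpha>: "0 < \<alpha>" "\<alpha> < real DIM('a)" and p: "1 + 2 / \<alpha> < p" and e: "0 < e"
  shows "eventually (\<lambda>t. \<forall>x. t powr (\<alpha> / 2) *
    \<bar>u x t - heat_power_solution (diffusivity J) \<alpha> A x t\<bar> \<le> e) at_top"
proof -
  define a where "a = diffusivity J"
  have a: "0 < a" using diffusivity_pos by (simp add: a_def)
  let ?n = "real DIM('a)"
  define k where "k = (?n - \<alpha>) / 2 - 1"
  have k: "2 * k + 2 = ?n - \<alpha>" by (simp add: k_def)
  define \<eta> where "\<eta> = ((p - 1) * \<alpha> / 2 - 1) / 2"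
  have \<eta>: "0 < \<eta>" "(p - 1) * \<alpha> / 2 = 1 + 2 * \<eta>"
    using p \<alpha> by (simp_all add: \<eta>_def field_simps)
  have p1: "1 < p" using p \<alpha> by (smt (verit) divide_pos_pos)
  define \<kappa> where "\<kappa> = Min {1 / 8, \<alpha> / 4, \<eta> / (p + 1), (?n - \<alpha>) / 4}"
  have \<kappa>: "0 < \<kappa>" "\<kappa> \<le> 1 / 8" "\<kappa> < \<alpha> / 2" "(p + 1) * \<kappa> \<le> \<eta>" "\<kappa> < (?n - \<alpha>) / 2"
  proof -
    show "0 < \<kappa>" using \<alpha> \<eta> p1 by (simp add: \<kappa>_def)
    have le: "\<kappa> \<le> 1 / 8" "\<kappa> \<le> \<alpha> / 4" "\<kappa> \<le> \<eta> / (p + 1)" "\<kappa> \<le> (?n - \<alpha>) / 4"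
      unfolding \<kappa>_def by (intro Min_le; simp)+
    then show "\<kappa> \<le> 1 / 8" "\<kappa> < \<alpha> / 2" "\<kappa> < (?n - \<alpha>) / 2" using \<alpha> by simp_all
    show "(p + 1) * \<kappa> \<le> \<eta>" using le(3) p1 by (simp add: pos_le_divide_eq mult.commute)
  qed
  define c where "c = riesz_const ?n a k"
  have c: "0 < c" unfolding c_def by (rule riesz_const_pos[OF a \<alpha>(1) k])
  let ?V = "heat_mixture a k :: 'a \<Rightarrow> real \<Rightarrow> real" and ?V' = "heat_mixture a (k - \<kappa>) :: 'a \<Rightarrow> real \<Rightarrow> real"
  have decay: "\<exists>C>0. \<forall>t>0. \<forall>x::'a. heat_mixture a l x t \<le> C * t powr (l + 1 - ?n / 2)"
    if l: "0 < l + 1" "l + 1 < ?n / 2" for l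
  proof -
    obtain C where C: "0 < C" "\<And>t (x::'a). 0 \<le> t \<Longrightarrow>
        heat_mixture a l x t \<le> C * (1 + t + (norm x)\<^sup>2) powr (l + 1 - ?n / 2)"
      using heat_mixture_upper[OF a l(1) order_refl l(2)] by blast
    have "heat_mixture a l x t \<le> C * t powr (l + 1 - ?n / 2)" if t: "0 < t" for t and x :: 'a
    proof -
      have "(1 + t + (norm x)\<^sup>2) powr (l + 1 - ?n / 2) \<le> t powr (l + 1 - ?n / 2)"
        using t l by (intro powr_mono2') auto
      from mult_left_mono[OF this less_imp_le[OF C(1)]] show ?thesis
        using C(2)[of t x] t by linarith
    qed
    then show ?thesis using C(1) by blast
  qed
  have kk: "0 < k + 1" "k + 1 < ?n / 2" "0 < k - \<kappa> + 1" "k - \<kappa> + 1 < ?n / 2"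
    using \<kappa> k \<alpha> by auto
  obtain C1 where C1: "0 < C1" "\<And>t x. 0 < t \<Longrightarrow> ?V x t \<le> C1 * t powr (k + 1 - ?n / 2)"
    using decay[OF kk(1,2)] by blast
  obtain C2 where C2: "0 < C2" "\<And>t x. 0 < t \<Longrightarrow> ?V' x t \<le> C2 * t powr (k - \<kappa> + 1 - ?n / 2)"
    using decay[OF kk(3,4)] by blast
  define \<epsilon> where "\<epsilon> = e / (2 * C1)"
  have \<epsilon>: "0 < \<epsilon>" using e C1 by (simp add: \<epsilon>_def)
  obtain B where B: "0 \<le> B" "\<And>t x. 0 \<le> t \<Longrightarrow> \<bar>u x t - A / c * ?V x t\<bar> \<le> \<epsilon> * ?V x t + B * ?V' x t"
    using solution_sandwich[OF sol u0 A \<alpha>(1) less_imp_le[OF \<alpha>(2)] k \<eta> \<kappa>(1-4) \<epsilon>]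
    unfolding c_def a_def by blast
  define C3 where "C3 = A / c * ((4 * pi * a) powr (- (?n / 2)) / (k + 1))"
  have bound: "t powr (\<alpha> / 2) * \<bar>u x t - heat_power_solution a \<alpha> A x t\<bar>
      \<le> e / 2 + (B * C2 * t powr (- \<kappa>) + C3 * t powr ((\<alpha> - ?n) / 2))" if t: "0 < t" for t x
  proof -
    have "\<bar>u x t - heat_power_solution a \<alpha> A x t\<bar>
        \<le> \<bar>u x t - A / c * ?V x t\<bar> + \<bar>A / c * ?V x t - heat_power_solution a \<alpha> A x t\<bar>" by linarith
    also have "\<dots> \<le> (\<epsilon> * ?V x t + B * ?V' x t) + C3 * t powr (- (?n / 2))"
      using B(2)[of t x] heat_power_solution_near_mixture[OF a \<alpha> k t, of A x] t A
      unfolding C3_def c_def by (intro add_mono) auto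
    also have "\<dots> \<le> (\<epsilon> * (C1 * t powr (k + 1 - ?n / 2)) + B * (C2 * t powr (k - \<kappa> + 1 - ?n / 2)))
        + C3 * t powr (- (?n / 2))"
      by (rule add_right_mono, intro add_mono mult_left_mono)
        (use C1(2)[OF t, of x] C2(2)[OF t, of x] \<epsilon> B(1) in auto)
    finally have "t powr (\<alpha> / 2) * \<bar>u x t - heat_power_solution a \<alpha> A x t\<bar>
        \<le> t powr (\<alpha> / 2) * ((\<epsilon> * (C1 * t powr (k + 1 - ?n / 2)) + B * (C2 * t powr (k - \<kappa> + 1 - ?n / 2)))
        + C3 * t powr (- (?n / 2)))" by (rule mult_left_mono) simp
    also have "\<dots> = \<epsilon> * C1 * (t powr (\<alpha> / 2) * t powr (k + 1 - ?n / 2))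
        + (B * C2 * (t powr (\<alpha> / 2) * t powr (k - \<kappa> + 1 - ?n / 2)) + C3 * (t powr (\<alpha> / 2) * t powr (- (?n / 2))))"
      by (simp only: distrib_left mult_ac add_ac)
    also have "\<dots> = e / 2 + (B * C2 * t powr (- \<kappa>) + C3 * t powr ((\<alpha> - ?n) / 2))"
    proof -
      have x: "\<alpha> / 2 + (k + 1 - ?n / 2) = 0" "\<alpha> / 2 + (k - \<kappa> + 1 - ?n / 2) = - \<kappa>"
        "\<alpha> / 2 + - (?n / 2) = (\<alpha> - ?n) / 2" using k by (auto simp: field_simps)
      have "\<epsilon> * C1 = e / 2" using C1 by (simp add: \<epsilon>_def)
      then show ?thesis unfolding powr_add[symmetric] x using t by simp
    qed
    finally show ?thesis .
  qed
  have "((\<lambda>t. B * C2 * t powr (- \<kappa>) + C3 * t powr ((\<alpha> - ?n) / 2)) \<longlongrightarrow> B * C2 * 0 + C3 * 0) at_top"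
    using \<kappa>(1) \<alpha> by (intro tendsto_intros tendsto_neg_powr filterlim_ident) auto
  then have "eventually (\<lambda>t. B * C2 * t powr (- \<kappa>) + C3 * t powr ((\<alpha> - ?n) / 2) < e / 2) at_top"
    using e by (intro order_tendstoD(2)) auto
  then show ?thesis
    using eventually_gt_at_top[of 0]
  proof eventually_elim
    case (elim t)
    show ?case
    proof
      fix x
      show "t powr (\<alpha> / 2) * \<bar>u x t - heat_power_solution (diffusivity J) \<alpha> A x t\<bar> \<le> e"
        using bound[OF elim(2), of x] elim(1) unfolding a_def by linarith
    qed
  qed
qed

text \<open>Here \<open>V\<^sub>-\<^sub>1\<close> is of size \<open>t\<^bsup>-N/2\<^esup> ln t\<close>, whereas \<open>r\<^bsup>-1-\<kappa>\<^esup>\<close> is integrable at infinity and \<open>V\<^bsub>-1-\<kappa>\<^esub>\<close> is only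
  of size \<open>t\<^bsup>-N/2\<^esup>\<close>. Dividing by \<open>ln t\<close> removes everything but the \<open>\<epsilon>\<close>-term and the profile.\<close>

theorem convergence_critical_decay:
  fixes u0 :: "'a \<Rightarrow> real" and u :: "'a \<Rightarrow> real \<Rightarrow> real"
  assumes sol: "nonlocal_solution J p u0 u"
    and u0: "bounded (range u0)" "((\<lambda>x. norm x powr (real DIM('a)) * u0 x) \<longlongrightarrow> A) at_infinity"
    and A: "0 < A" and p: "1 + 2 / real DIM('a) < p" and e: "0 < e"
  shows "eventually (\<lambda>t. \<forall>x. t powr (real DIM('a) / 2) *
    \<bar>u x t / ln t - A / riesz_const (real DIM('a)) 1 (- 1) * heat_kernel (diffusivity J) x t\<bar> \<le> e) at_top"
proof -
  define a where "a = diffusivity J"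
  have a: "0 < a" using diffusivity_pos by (simp add: a_def)
  let ?n = "real DIM('a)"
  have n: "0 < ?n" using DIM_positive[where 'a='a] by simp
  have k: "2 * (- 1) + 2 = ?n - ?n" by simp
  define \<eta> where "\<eta> = ((p - 1) * ?n / 2 - 1) / 2"
  have \<eta>: "0 < \<eta>" "(p - 1) * ?n / 2 = 1 + 2 * \<eta>"
    using p n by (simp_all add: \<eta>_def field_simps)
  have p1: "1 < p" using p n by (smt (verit) divide_pos_pos)
  define \<kappa> where "\<kappa> = Min {1 / 8, ?n / 4, \<eta> / (p + 1)}"
  have \<kappa>: "0 < \<kappa>" "\<kappa> \<le> 1 / 8" "\<kappa> < ?n / 2" "(p + 1) * \<kappa> \<le> \<eta>"
  proof -
    show "0 < \<kappa>" using n \<eta> p1 by (simp add: \<kappa>_def)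
    have le: "\<kappa> \<le> 1 / 8" "\<kappa> \<le> ?n / 4" "\<kappa> \<le> \<eta> / (p + 1)"
      unfolding \<kappa>_def by (intro Min_le; simp)+
    then show "\<kappa> \<le> 1 / 8" "\<kappa> < ?n / 2" using n by linarith+
    show "(p + 1) * \<kappa> \<le> \<eta>" using le(3) p1 by (simp add: pos_le_divide_eq mult.commute)
  qed
  define c where "c = riesz_const ?n 1 (- 1)"
  have ca: "riesz_const ?n a (- 1) = c" unfolding c_def by (rule riesz_const_scale[OF a])
  have c: "0 < c" unfolding ca[symmetric] by (rule riesz_const_pos[OF a n k])
  let ?V = "heat_mixture a (- 1) :: 'a \<Rightarrow> real \<Rightarrow> real" and ?V' = "heat_mixture a (- 1 - \<kappa>) :: 'a \<Rightarrow> real \<Rightarrow> real"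
  define G where "G = (4 * pi * a) powr (- (?n / 2))"
  have G: "0 < G" using a by (simp add: G_def)
  obtain L where L: "0 < L" "\<And>t x. 1 \<le> t \<Longrightarrow> \<bar>?V x t - ln t * heat_kernel a x t\<bar> \<le> L * t powr (- (?n / 2))"
    using log_mixture_asymptotics[OF a] by blast
  have V'_le: "?V' x t \<le> G / \<kappa> * t powr (- (?n / 2))" if t: "0 < t" for x t
  proof -
    have tail: "has_bochner_integral lborel (\<lambda>r. r powr (- \<kappa> - 1) * indicator {1..} r) (1 powr (- \<kappa>) / (- (- \<kappa>)))"
      using \<kappa>(1) by (intro powr_tail_integral) auto
    have "?V' x t \<le> (\<integral>r. G * t powr (- (?n / 2)) * (r powr (- \<kappa> - 1) * indicator {1..} r) \<partial>lborel)"
      unfolding heat_mixture_def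
    proof (rule integral_mono)
      show "integrable lborel (\<lambda>r. r powr (- 1 - \<kappa>) * heat_kernel a x (t + r) * indicator {1..} r)"
        using n t \<kappa> by (intro heat_mixture_integrable a) auto
      show "integrable lborel (\<lambda>r. G * t powr (- (?n / 2)) * (r powr (- \<kappa> - 1) * indicator {1..} r))"
        by (rule integrable_mult_right[OF integrable.intros[OF tail]])
      fix r :: real
      show "r powr (- 1 - \<kappa>) * heat_kernel a x (t + r) * indicator {1..} r
          \<le> G * t powr (- (?n / 2)) * (r powr (- \<kappa> - 1) * indicator {1..} r)"
      proof (cases "1 \<le> r")
        case True
        have "heat_kernel a x (t + r) \<le> G * (t + r) powr (- (?n / 2))"
          unfolding G_def using t True by (intro heat_kernel_le_powr a) auto
        also have "\<dots> \<le> G * t powr (- (?n / 2))"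
          using t True G by (intro mult_left_mono powr_mono2') auto
        finally have "r powr (- 1 - \<kappa>) * heat_kernel a x (t + r) \<le> r powr (- 1 - \<kappa>) * (G * t powr (- (?n / 2)))"
          by (rule mult_left_mono) simp
        moreover have e: "- \<kappa> - 1 = - 1 - \<kappa>" and i: "indicator {1..} r = (1 :: real)"
          using True by simp_all
        ultimately show ?thesis unfolding e i mult_1_right by (simp only: mult_ac)
      qed simp
    qed
    also have "\<dots> = G * t powr (- (?n / 2)) * (1 powr (- \<kappa>) / (- (- \<kappa>)))"
      using has_bochner_integral_integral_eq[OF tail] by simp
    finally show ?thesis by simp
  qed
  define \<epsilon> where "\<epsilon> = e / (2 * G)"
  have \<epsilon>: "0 < \<epsilon>" using e G by (simp add: \<epsilon>_def)
  obtain B where B: "0 \<le> B" "\<And>t x. 0 \<le> t \<Longrightarrow> \<bar>u x t - A / c * ?V x t\<bar> \<le> \<epsilon> * ?V x t + B * ?V' x t"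
    using solution_sandwich[OF sol u0 A n order_refl k \<eta> \<kappa> \<epsilon>]
    unfolding ca[symmetric] a_def by blast
  define M where "M = \<epsilon> * L + B * (G / \<kappa>) + A / c * L"
  have bound: "t powr (?n / 2) * \<bar>u x t / ln t - A / c * heat_kernel a x t\<bar> \<le> e / 2 + M / ln t"
    if t: "1 < t" for t x
  proof -
    have ln: "0 < ln t" using t by simp
    have h: "heat_kernel a x t \<le> G * t powr (- (?n / 2))"
      unfolding G_def using t by (intro heat_kernel_le_powr a) auto
    have V_le: "?V x t \<le> (ln t * G + L) * t powr (- (?n / 2))"
    proof -
      have "?V x t \<le> ln t * heat_kernel a x t + L * t powr (- (?n / 2))"
        using L(2)[of t x] t by linarith
      also have "\<dots> \<le> ln t * (G * t powr (- (?n / 2))) + L * t powr (- (?n / 2))"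
        using h ln by (intro add_right_mono mult_left_mono) auto
      finally show ?thesis by (simp add: distrib_right)
    qed
    have "\<bar>u x t - A / c * (ln t * heat_kernel a x t)\<bar>
        \<le> \<bar>u x t - A / c * ?V x t\<bar> + A / c * \<bar>?V x t - ln t * heat_kernel a x t\<bar>"
    proof -
      have "A / c * \<bar>?V x t - ln t * heat_kernel a x t\<bar> = \<bar>A / c * ?V x t - A / c * (ln t * heat_kernel a x t)\<bar>"
        unfolding right_diff_distrib[symmetric] abs_mult using A c by simp
      then show ?thesis by linarith
    qed
    also have "\<dots> \<le> (\<epsilon> * ((ln t * G + L) * t powr (- (?n / 2))) + B * (G / \<kappa> * t powr (- (?n / 2))))
        + A / c * (L * t powr (- (?n / 2)))"
    proof (intro add_mono mult_left_mono)
      show "\<bar>u x t - A / c * ?V x t\<bar> \<le> \<epsilon> * ((ln t * G + L) * t powr (- (?n / 2))) + B * (G / \<kappa> * t powr (- (?n / 2)))"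
        using B(2)[of t x] mult_left_mono[OF V_le less_imp_le[OF \<epsilon>]] mult_left_mono[OF V'_le[of t x] B(1)] t
        by linarith
      show "\<bar>?V x t - ln t * heat_kernel a x t\<bar> \<le> L * t powr (- (?n / 2))"
        using t by (intro L(2)) simp
    qed (use A c in auto)
    also have "\<dots> = (ln t * (\<epsilon> * G) + M) * t powr (- (?n / 2))"
      by (simp only: M_def distrib_left distrib_right mult_ac add_ac)
    also have "\<epsilon> * G = e / 2" using G by (simp add: \<epsilon>_def)
    finally have main: "\<bar>u x t - A / c * (ln t * heat_kernel a x t)\<bar> \<le> (ln t * (e / 2) + M) * t powr (- (?n / 2))" .
    have "u x t / ln t - A / c * heat_kernel a x t = (u x t - A / c * (ln t * heat_kernel a x t)) / ln t"
      using ln by (simp add: diff_divide_distrib)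
    then have "t powr (?n / 2) * \<bar>u x t / ln t - A / c * heat_kernel a x t\<bar>
        = t powr (?n / 2) * \<bar>u x t - A / c * (ln t * heat_kernel a x t)\<bar> / ln t"
      using ln by (simp add: abs_divide)
    also have "\<dots> \<le> t powr (?n / 2) * ((ln t * (e / 2) + M) * t powr (- (?n / 2))) / ln t"
      using main ln by (intro divide_right_mono mult_left_mono) auto
    also have "\<dots> = (ln t * (e / 2) + M) * (t powr (?n / 2) * t powr (- (?n / 2))) / ln t"
      by (simp only: mult_ac)
    also have "t powr (?n / 2) * t powr (- (?n / 2)) = 1"
      using t by (simp add: powr_add[symmetric])
    also have "(ln t * (e / 2) + M) * 1 / ln t = e / 2 + M / ln t"
      using ln by (simp add: add_divide_distrib)
    finally show ?thesis .
  qed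
  have "((\<lambda>t::real. M / ln t) \<longlongrightarrow> 0) at_top"
    by (rule tendsto_divide_0[OF tendsto_const filterlim_at_top_imp_at_infinity[OF ln_at_top]])
  then have "eventually (\<lambda>t. M / ln t < e / 2) at_top"
    using e by (intro order_tendstoD(2)) auto
  then show ?thesis
    using eventually_gt_at_top[of 1]
  proof eventually_elim
    case (elim t)
    show ?case
    proof
      fix x
      show "t powr (?n / 2) * \<bar>u x t / ln t - A / riesz_const ?n 1 (- 1) * heat_kernel (diffusivity J) x t\<bar> \<le> e"
        using bound[OF elim(2), of x] elim(1) unfolding a_def c_def by linarith
    qed
  qed
qed

end

theorem theorem4p1:
  shows "\<exists>C :: real \<Rightarrow> real.
    \<forall>(J :: 'a::euclidean_space \<Rightarrow> real) (u0 :: 'a \<Rightarrow> real) (A :: real) (\<alpha> :: real) (p :: real)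
      (u :: 'a \<Rightarrow> real \<Rightarrow> real).
      dispersal_kernel J \<longrightarrow>
      u0 \<in> borel_measurable lebesgue \<longrightarrow> bounded (range u0) \<longrightarrow> (\<forall>x. 0 \<le> u0 x) \<longrightarrow>
      ((\<lambda>x. norm x powr \<alpha> * u0 x) \<longlongrightarrow> A) at_infinity \<longrightarrow>
      0 < A \<longrightarrow> 0 < \<alpha> \<longrightarrow> \<alpha> \<le> real DIM('a) \<longrightarrow> 1 + 2 / \<alpha> < p \<longrightarrow>
      nonlocal_solution J p u0 u \<longrightarrow>
      (\<alpha> < real DIM('a) \<longrightarrow> (\<forall>K>0.
        ((\<lambda>t. ereal (t powr (\<alpha> / 2)) *
              Linfty_norm {x. norm x \<le> K * sqrt t}
                (\<lambda>x. u x t - heat_power_solution (diffusivity J) \<alpha> A x t))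
          \<longlongrightarrow> 0) at_top)) \<and>
      (\<alpha> = real DIM('a) \<longrightarrow> (\<forall>K>0.
        ((\<lambda>t. ereal (t powr (real DIM('a) / 2)) *
              Linfty_norm {x. norm x \<le> K * sqrt t}
                (\<lambda>x. u x t / ln t - C A * heat_kernel (diffusivity J) x t))
          \<longlongrightarrow> 0) at_top))"
proof (intro exI[of _ "\<lambda>A. A / riesz_const (real DIM('a)) 1 (- 1)"] allI impI conjI)
  fix J :: "'a \<Rightarrow> real" and u0 :: "'a \<Rightarrow> real" and A \<alpha> p K :: real and u :: "'a \<Rightarrow> real \<Rightarrow> real"
  assume J: "dispersal_kernel J" and bdd: "bounded (range u0)"
    and lim: "((\<lambda>x. norm x powr \<alpha> * u0 x) \<longlongrightarrow> A) at_infinity"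
    and A: "0 < A" and \<alpha>: "0 < \<alpha>" and p: "1 + 2 / \<alpha> < p"
    and sol: "nonlocal_solution J p u0 u" and K: "0 < K"
  interpret dispersal J by standard (rule J)
  have u_meas: "(\<lambda>x. u x t) \<in> borel_measurable lebesgue" if "0 < t" for t
    using nonlocal_solution_measurable[OF sol, of t] that by simp
  have pos: "eventually (\<lambda>t::real. 0 < t powr q) at_top" for q
    using eventually_gt_at_top[of 0] by eventually_elim simp
  {
    assume lt: "\<alpha> < real DIM('a)"
    show "((\<lambda>t. ereal (t powr (\<alpha> / 2)) * Linfty_norm {x. norm x \<le> K * sqrt t}
        (\<lambda>x. u x t - heat_power_solution (diffusivity J) \<alpha> A x t)) \<longlongrightarrow> 0) at_top"
    proof (rule Linfty_norm_tendsto_0[OF K pos])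
      show "eventually (\<lambda>t. (\<lambda>x. u x t - heat_power_solution (diffusivity J) \<alpha> A x t)
          \<in> borel_measurable lebesgue) at_top"
        using eventually_gt_at_top[of 0]
      proof eventually_elim
        case (elim t)
        have "(\<lambda>x. heat_power_solution (diffusivity J) \<alpha> A x t) \<in> borel_measurable (borel :: 'a measure)"
          unfolding heat_power_solution_def by measurable
        then have "(\<lambda>x. heat_power_solution (diffusivity J) \<alpha> A x t) \<in> borel_measurable (lebesgue :: 'a measure)"
          by (intro measurable_completion) simp
        with u_meas[OF elim] show ?case by (rule borel_measurable_diff)
      qed
    qed (rule convergence_below_critical_decay[OF sol bdd lim A \<alpha> lt p])
  next
    assume eq: "\<alpha> = real DIM('a)"
    show "((\<lambda>t. ereal (t powr (real DIM('a) / 2)) * Linfty_norm {x. norm x \<le> K * sqrt t}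
        (\<lambda>x. u x t / ln t - A / riesz_const (real DIM('a)) 1 (- 1) * heat_kernel (diffusivity J) x t)) \<longlongrightarrow> 0) at_top"
    proof (rule Linfty_norm_tendsto_0[OF K pos])
      show "eventually (\<lambda>t. (\<lambda>x. u x t / ln t - A / riesz_const (real DIM('a)) 1 (- 1) *
          heat_kernel (diffusivity J) x t) \<in> borel_measurable lebesgue) at_top"
        using eventually_gt_at_top[of 0]
      proof eventually_elim
        case (elim t)
        have "(\<lambda>x::'a. A / riesz_const (real DIM('a)) 1 (- 1) * heat_kernel (diffusivity J) x t) \<in> borel_measurable borel"
          by measurable
        then have "(\<lambda>x::'a. A / riesz_const (real DIM('a)) 1 (- 1) * heat_kernel (diffusivity J) x t)
            \<in> borel_measurable lebesgue"
          by (intro measurable_completion) simp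
        with borel_measurable_divide[OF u_meas[OF elim] borel_measurable_const] show ?case
          by (rule borel_measurable_diff)
      qed
    qed (rule convergence_critical_decay[OF sol bdd lim[unfolded eq] A p[unfolded eq]])
  }
qed

end
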